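(* Let $S=(X,\{(V_i,C_i)\}_{i=1}^m)$ be a $k$-ary constraint system and let $\pi$ be a probability distribution on $[m]$. There is a $20L^2$-homomorphism $\alpha:\mathcal{A}_{a+comm}(S,\pi)\to\mathcal{A}_{c-v}(S,\pi)$, where $L=\max_i|V_i|$.
   Context: A $k$-ary constraint system is $S=(X,\{(V_i,C_i)\}_{i=1}^m)$ with $X$ a finite totally ordered set of variables (subsets inherit the order), $V_i\subseteq X$, $C_i\subseteq\mathbb{Z}_k^{V_i}$, $\mathbb{Z}_k=\{0,\dots,k-1\}$. Algebras. $*$-algebras are complex and unital. $\mathbb{C}\mathbb{Z}_k^{*X}$ is the $*$-algebra generated by unitaries $x\in X$ with $x^k=1$; $\mathbb{C}\mathbb{Z}_k^V$ is its abelian analogue. $\Pi_a(x)=\frac1k\sum_{n=0}^{k-1}\omega_k^{-na}x^n$, $\omega_k=e^{2\pi i/k}$; $\Phi_{V,\phi}=\prod_{x\in V}\Pi_{\phi(x)}(x)$ (product in the order of $V$) for $\phi\in\mathbb{Z}_k^V$; $\mathcal{A}(V,C)=\mathbb{C}\mathbb{Z}_k^V/\langle\Phi_{V,\phi}:\phi\notin C\rangle$. A weighted $*$-algebra $(\mathcal{A},\mu)$ is a $*$-algebra with a finitely supported weight function $\mu:\mathcal{A}\to[0,\infty)$; below, weights of coinciding listed elements are added. - $\mathcal{A}_{a+comm}(S,\pi)$: the algebra $\mathbb{C}\mathbb{Z}_k^{*X}$ with weight function $\mu_{a,\pi}+\mu_{comm,\pi}$, where $\mu_{a,\pi}$ has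 weight $\pi(i)$ on $\Phi_{V_i,\phi}$ for $i\in[m]$, $\phi\in\mathbb{Z}_k^{V_i}\setminus C_i$, and $\mu_{comm,\pi}$ has weight $\sum_{i:\,x,y\in V_i}\pi(i)$ on $[\Pi_a(x),\Pi_b(y)]$ for $a,b\in\mathbb{Z}_k$, $x,y\in X$, each being $0$ elsewhere. - $\mathcal{A}_{c-v}(S,\pi)$: the free product of all $\mathcal{A}(V_i,C_i)$ and $\mathbb{C}\mathbb{Z}_k^{*X}$ (with inclusion $\sigma'$ of $\mathbb{C}\mathbb{Z}_k^{*X}$), with weight $\pi(i)/|V_i|$ on $\Phi_{V_i,\phi}(1-\Pi_{\phi(x)}(\sigma'(x)))$ for $i\in[m]$, $x\in V_i$, $\phi\in C_i$ (here $\Phi_{V_i,\phi}$ is the image under inclusion of $\mathcal{A}(V_i,C_i)$), and $0$ elsewhere. $a\lesssim b$ means $b-a=\sum_jc_j^*c_j+\sum_l(f_lg_l-g_lf_l)$ for finitely many elements. A $C$-homomorphism $(\mathcal{A},\mu)\to(\mathcal{B},\nu)$ is a $*$-homomorphism $\alpha:\mathcal{A}\to\mathcal{B}$ with $\alpha(\sum_a\mu(a)a^*a)\lesssim C\sum_b\nu(b)b^*b$. *)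

theory Defs
  imports Complex_Main "HOL-Algebra.Module" "HOL-Algebra.QuotRing" "HOL-Library.Poly_Mapping" "HOL-Library.FuncSet"
begin

section \<open>Complex unital *-algebras\<close>

definition complex_ring :: "complex ring"
  where "complex_ring = \<lparr>carrier = UNIV, mult = (*), one = 1, zero = 0, add = (+)\<rparr>"

record 'a star_algebra = "(complex, 'a) module" +
  involution :: "'a \<Rightarrow> 'a"  (\<open>adj\<index>\<close>)

locale star_algebra = ring A + module complex_ring A for A (structure) +
  assumes smult_mult_left:
      "\<lbrakk>a \<in> carrier A; b \<in> carrier A\<rbrakk> \<Longrightarrow> (c \<odot> a) \<otimes> b = c \<odot> (a \<otimes> b)"
    and smult_mult_right:
      "\<lbrakk>a \<in> carrier A; b \<in> carrier A\<rbrakk> \<Longrightarrow> a \<otimes> (c \<odot> b) = c \<odot> (a \<otimes> b)"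
    and adj_closed: "a \<in> carrier A \<Longrightarrow> adj a \<in> carrier A"
    and adj_add: "\<lbrakk>a \<in> carrier A; b \<in> carrier A\<rbrakk> \<Longrightarrow> adj (a \<oplus> b) = adj a \<oplus> adj b"
    and adj_smult: "a \<in> carrier A \<Longrightarrow> adj (c \<odot> a) = cnj c \<odot> adj a"
    and adj_mult: "\<lbrakk>a \<in> carrier A; b \<in> carrier A\<rbrakk> \<Longrightarrow> adj (a \<otimes> b) = adj b \<otimes> adj a"
    and adj_adj: "a \<in> carrier A \<Longrightarrow> adj (adj a) = a"

definition star_hom :: "('a, 'c) star_algebra_scheme \<Rightarrow> ('b, 'd) star_algebra_scheme \<Rightarrow> ('a \<Rightarrow> 'b) set"
  where "star_hom A B = {h \<in> ring_hom A B.
    (\<forall>c. \<forall>a\<in>carrier A. h (c \<odot>\<^bsub>A\<^esub> a) = c \<odot>\<^bsub>B\<^esub> h a) \<and>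
    (\<forall>a\<in>carrier A. h (adj\<^bsub>A\<^esub> a) = adj\<^bsub>B\<^esub> (h a))}"

definition commutator :: "('a, 'c) ring_scheme \<Rightarrow> 'a \<Rightarrow> 'a \<Rightarrow> 'a"
  where "commutator A a b = a \<otimes>\<^bsub>A\<^esub> b \<ominus>\<^bsub>A\<^esub> b \<otimes>\<^bsub>A\<^esub> a"

definition cyclic_le :: "('a, 'c) star_algebra_scheme \<Rightarrow> 'a \<Rightarrow> 'a \<Rightarrow> bool"
  where "cyclic_le A a b \<longleftrightarrow> a \<in> carrier A \<and> b \<in> carrier A \<and>
    (\<exists>(p::nat) (q::nat) c f g.
       c \<in> {..<p} \<rightarrow> carrier A \<and> f \<in> {..<q} \<rightarrow> carrier A \<and> g \<in> {..<q} \<rightarrow> carrier A \<and>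
       b \<ominus>\<^bsub>A\<^esub> a = (\<Oplus>\<^bsub>A\<^esub>j\<in>{..<p}. adj\<^bsub>A\<^esub> (c j) \<otimes>\<^bsub>A\<^esub> c j)
                   \<oplus>\<^bsub>A\<^esub> (\<Oplus>\<^bsub>A\<^esub>l\<in>{..<q}. commutator A (f l) (g l)))"


section \<open>Weighted *-algebras\<close>

type_synonym 'a weighted_star_algebra = "'a star_algebra \<times> ('a \<Rightarrow> real)"

definition weighted_star_algebra :: "'a weighted_star_algebra \<Rightarrow> bool"
  where "weighted_star_algebra = (\<lambda>(A, \<mu>). star_algebra A \<and>
    finite {a. \<mu> a \<noteq> 0} \<and> {a. \<mu> a \<noteq> 0} \<subseteq> carrier A \<and> (\<forall>a. 0 \<le> \<mu> a))"

definition weighted_square_sum :: "'a weighted_star_algebra \<Rightarrow> 'a"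
  where "weighted_square_sum = (\<lambda>(A, \<mu>).
    \<Oplus>\<^bsub>A\<^esub>a\<in>{a. \<mu> a \<noteq> 0}. complex_of_real (\<mu> a) \<odot>\<^bsub>A\<^esub> (adj\<^bsub>A\<^esub> a \<otimes>\<^bsub>A\<^esub> a))"

definition C_homomorphism ::
    "real \<Rightarrow> 'a weighted_star_algebra \<Rightarrow> 'b weighted_star_algebra \<Rightarrow> ('a \<Rightarrow> 'b) \<Rightarrow> bool"
  where "C_homomorphism K W W' \<alpha> \<longleftrightarrow>
    weighted_star_algebra W \<and> weighted_star_algebra W' \<and> \<alpha> \<in> star_hom (fst W) (fst W') \<and>
    cyclic_le (fst W') (\<alpha> (weighted_square_sum W))
      (complex_of_real K \<odot>\<^bsub>fst W'\<^esub> weighted_square_sum W')"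

text \<open>The weight function of a finite list of elements \<open>e j\<close> with weights \<open>w j\<close>; the weights of
  coinciding elements are added.\<close>

definition listed_weight :: "'j set \<Rightarrow> ('j \<Rightarrow> 'a) \<Rightarrow> ('j \<Rightarrow> real) \<Rightarrow> 'a \<Rightarrow> real"
  where "listed_weight J e w = (\<lambda>a. \<Sum>j\<in>{j \<in> J. e j = a}. w j)"


section \<open>Generators and relations\<close>

text \<open>A word is a list of letters \<open>(x, False)\<close>, which stands for the generator \<open>x\<close>, and
  \<open>(x, True)\<close>, which stands for its adjoint. The monoid operation is written additively because
  the convolution product of \<^typ>\<open>'k \<Rightarrow>\<^sub>0 'c\<close> requires this; it is concatenation, and the
  ring \<open>'g word \<Rightarrow>\<^sub>0 complex\<close> consists of the noncommutative polynomials.\<close>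

datatype 'g word = Word (letters: "('g \<times> bool) list")

instantiation word :: (type) monoid_add
begin
definition zero_word :: "'a word" where "zero_word = Word []"
definition plus_word :: "'a word \<Rightarrow> 'a word \<Rightarrow> 'a word"
  where "plus_word u v = Word (letters u @ letters v)"
instance by standard (auto simp: zero_word_def plus_word_def)
end

definition adj_word :: "'g word \<Rightarrow> 'g word"
  where "adj_word w = Word (rev (map (\<lambda>(x, s). (x, \<not> s)) (letters w)))"

type_synonym 'g star_poly = "'g word \<Rightarrow>\<^sub>0 complex"

definition free_star_algebra :: "'g set \<Rightarrow> 'g star_poly star_algebra"
  where "free_star_algebra G =
    \<lparr>carrier = {p. \<forall>w\<in>Poly_Mapping.keys p. fst ` set (letters w) \<subseteq> G},
     mult = (*), one = 1, zero = 0, add = (+),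
     smult = (\<lambda>c p. Poly_Mapping.single 0 c * p),
     involution = (\<lambda>p. \<Sum>w\<in>Poly_Mapping.keys p.
              Poly_Mapping.single (adj_word w) (cnj (Poly_Mapping.lookup p w)))\<rparr>"

definition free_gen :: "'g \<Rightarrow> 'g star_poly"
  where "free_gen x = Poly_Mapping.single (Word [(x, False)]) 1"

definition star_ideal :: "('a, 'c) star_algebra_scheme \<Rightarrow> 'a set \<Rightarrow> 'a set"
  where "star_ideal A R = Idl\<^bsub>A\<^esub> (R \<union> adj\<^bsub>A\<^esub> ` R)"

text \<open>\<^const>\<open>FactRing\<close> with the induced scalar multiplication and adjoint.\<close>

definition quotient_algebra :: "('a, 'c) star_algebra_scheme \<Rightarrow> 'a set \<Rightarrow> 'a set star_algebra"
  where "quotient_algebra A I =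
    \<lparr>carrier = carrier (A Quot I), mult = mult (A Quot I), one = one (A Quot I),
     zero = zero (A Quot I), add = add (A Quot I),
     smult = (\<lambda>c P. \<Union>a\<in>P. I +>\<^bsub>A\<^esub> (c \<odot>\<^bsub>A\<^esub> a)),
     involution = (\<lambda>P. \<Union>a\<in>P. I +>\<^bsub>A\<^esub> adj\<^bsub>A\<^esub> a)\<rparr>"

definition presented_algebra :: "'g set \<Rightarrow> 'g star_poly set \<Rightarrow> 'g star_poly set star_algebra"
  where "presented_algebra G R =
    quotient_algebra (free_star_algebra G) (star_ideal (free_star_algebra G) R)"

definition presented_gen :: "'g set \<Rightarrow> 'g star_poly set \<Rightarrow> 'g \<Rightarrow> 'g star_poly set"
  where "presented_gen G R x =
    star_ideal (free_star_algebra G) R +>\<^bsub>free_star_algebra G\<^esub> free_gen x"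


section \<open>Free products\<close>

text \<open>The relators which make \<open>j\<close>, a map from \<open>A\<close> to a free *-algebra \<open>F\<close>, a unital
  *-homomorphism.\<close>

definition hom_relators ::
    "('a, 'c) star_algebra_scheme \<Rightarrow> ('b, 'd) star_algebra_scheme \<Rightarrow> ('a \<Rightarrow> 'b) \<Rightarrow> 'b set"
  where "hom_relators A F j =
    {j (a \<oplus>\<^bsub>A\<^esub> b) \<ominus>\<^bsub>F\<^esub> (j a \<oplus>\<^bsub>F\<^esub> j b) | a b. a \<in> carrier A \<and> b \<in> carrier A} \<union>
    {j (a \<otimes>\<^bsub>A\<^esub> b) \<ominus>\<^bsub>F\<^esub> (j a \<otimes>\<^bsub>F\<^esub> j b) | a b. a \<in> carrier A \<and> b \<in> carrier A} \<union>
    {j (c \<odot>\<^bsub>A\<^esub> a) \<ominus>\<^bsub>F\<^esub> (c \<odot>\<^bsub>F\<^esub> j a) | c a. a \<in> carrier A} \<union>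
    {j (adj\<^bsub>A\<^esub> a) \<ominus>\<^bsub>F\<^esub> adj\<^bsub>F\<^esub> (j a) | a. a \<in> carrier A} \<union>
    {j \<one>\<^bsub>A\<^esub> \<ominus>\<^bsub>F\<^esub> \<one>\<^bsub>F\<^esub>}"

text \<open>The free product of a family \<open>A i\<close> (\<open>i \<in> I\<close>) and one further algebra \<open>B\<close>, whose elements may
  have another type: it is generated by the disjoint union of all carriers, subject to the
  relations which make the inclusions unital *-homomorphisms.\<close>

definition free_product_gens ::
    "'i set \<Rightarrow> ('i \<Rightarrow> 'a star_algebra) \<Rightarrow> 'b star_algebra \<Rightarrow> ('i \<times> 'a + 'b) set"
  where "free_product_gens I A B = (SIGMA i:I. carrier (A i)) <+> carrier B"

definition free_product_relators ::
    "'i set \<Rightarrow> ('i \<Rightarrow> 'a star_algebra) \<Rightarrow> 'b star_algebra \<Rightarrow> ('i \<times> 'a + 'b) star_poly set"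
  where "free_product_relators I A B =
    (let F = free_star_algebra (free_product_gens I A B) in
      (\<Union>i\<in>I. hom_relators (A i) F (\<lambda>a. free_gen (Inl (i, a)))) \<union>
      hom_relators B F (\<lambda>b. free_gen (Inr b)))"

definition free_product ::
    "'i set \<Rightarrow> ('i \<Rightarrow> 'a star_algebra) \<Rightarrow> 'b star_algebra \<Rightarrow> ('i \<times> 'a + 'b) star_poly set star_algebra"
  where "free_product I A B =
    presented_algebra (free_product_gens I A B) (free_product_relators I A B)"

definition family_incl ::
    "'i set \<Rightarrow> ('i \<Rightarrow> 'a star_algebra) \<Rightarrow> 'b star_algebra \<Rightarrow> 'i \<Rightarrow> 'a \<Rightarrow> ('i \<times> 'a + 'b) star_poly set"
  where "family_incl I A B i a =
    presented_gen (free_product_gens I A B) (free_product_relators I A B) (Inl (i, a))"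

definition extra_incl ::
    "'i set \<Rightarrow> ('i \<Rightarrow> 'a star_algebra) \<Rightarrow> 'b star_algebra \<Rightarrow> 'b \<Rightarrow> ('i \<times> 'a + 'b) star_poly set"
  where "extra_incl I A B b =
    presented_gen (free_product_gens I A B) (free_product_relators I A B) (Inr b)"


section \<open>The algebras of cyclic groups\<close>

definition order_relators :: "nat \<Rightarrow> 'v set \<Rightarrow> 'v star_poly set"
  where "order_relators k X = (let F = free_star_algebra X in
    (\<Union>x\<in>X. {adj\<^bsub>F\<^esub> (free_gen x) \<otimes>\<^bsub>F\<^esub> free_gen x \<ominus>\<^bsub>F\<^esub> \<one>\<^bsub>F\<^esub>,
            free_gen x \<otimes>\<^bsub>F\<^esub> adj\<^bsub>F\<^esub> (free_gen x) \<ominus>\<^bsub>F\<^esub> \<one>\<^bsub>F\<^esub>,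
            free_gen x [^]\<^bsub>F\<^esub> k \<ominus>\<^bsub>F\<^esub> \<one>\<^bsub>F\<^esub>}))"

definition comm_relators :: "'v set \<Rightarrow> 'v star_poly set"
  where "comm_relators X =
    {commutator (free_star_algebra X) (free_gen x) (free_gen y) | x y. x \<in> X \<and> y \<in> X}"

text \<open>The algebra \<open>\<complex>\<int>\<^sub>k\<^sup>*\<^sup>X\<close> and its generators.\<close>

definition free_cyclic_algebra :: "nat \<Rightarrow> 'v set \<Rightarrow> 'v star_poly set star_algebra"
  where "free_cyclic_algebra k X = presented_algebra X (order_relators k X)"

definition free_cyclic_gen :: "nat \<Rightarrow> 'v set \<Rightarrow> 'v \<Rightarrow> 'v star_poly set"
  where "free_cyclic_gen k X = presented_gen X (order_relators k X)"

text \<open>The algebra \<open>\<complex>\<int>\<^sub>k\<^sup>V\<close> and its generators.\<close>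

definition abelian_cyclic_algebra :: "nat \<Rightarrow> 'v set \<Rightarrow> 'v star_poly set star_algebra"
  where "abelian_cyclic_algebra k V = presented_algebra V (order_relators k V \<union> comm_relators V)"

definition abelian_cyclic_gen :: "nat \<Rightarrow> 'v set \<Rightarrow> 'v \<Rightarrow> 'v star_poly set"
  where "abelian_cyclic_gen k V = presented_gen V (order_relators k V \<union> comm_relators V)"

definition root_of_unity :: "nat \<Rightarrow> complex"
  where "root_of_unity k = exp (2 * of_real pi * \<i> / of_nat k)"

text \<open>\<open>spectral_proj A k u a\<close> is \<open>\<Pi>\<^sub>a(u)\<close>.\<close>

definition spectral_proj :: "('a, 'c) star_algebra_scheme \<Rightarrow> nat \<Rightarrow> 'a \<Rightarrow> nat \<Rightarrow> 'a"
  where "spectral_proj A k u a = (1 / of_nat k) \<odot>\<^bsub>A\<^esub>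
    (\<Oplus>\<^bsub>A\<^esub>n\<in>{..<k}. (root_of_unity k powi (- int (n * a))) \<odot>\<^bsub>A\<^esub> (u [^]\<^bsub>A\<^esub> n))"

text \<open>\<open>assignment_proj A k u V \<phi>\<close> is \<open>\<Phi>\<^bsub>V,\<phi>\<^esub>\<close> in \<open>A\<close>, where \<open>u x\<close> is the element of \<open>A\<close> for the
  variable \<open>x\<close>.\<close>

definition assignment_proj ::
    "('a, 'c) star_algebra_scheme \<Rightarrow> nat \<Rightarrow> ('v::linorder \<Rightarrow> 'a) \<Rightarrow> 'v set \<Rightarrow> ('v \<Rightarrow> nat) \<Rightarrow> 'a"
  where "assignment_proj A k u V \<phi> =
    foldr (\<lambda>x p. spectral_proj A k (u x) (\<phi> x) \<otimes>\<^bsub>A\<^esub> p) (sorted_list_of_set V) \<one>\<^bsub>A\<^esub>"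


section \<open>Constraint systems\<close>

text \<open>The constraints are indexed by \<open>{1..num S}\<close>. The set \<open>\<int>\<^sub>k\<^sup>V\<close> is \<^term>\<open>V \<rightarrow>\<^sub>E {..<k}\<close>, and the
  order of the variables is that of their type.\<close>

record 'v constraint_system =
  vars :: "'v set"
  num :: nat
  scope :: "nat \<Rightarrow> 'v set"
  allowed :: "nat \<Rightarrow> ('v \<Rightarrow> nat) set"

definition is_constraint_system :: "nat \<Rightarrow> 'v::linorder constraint_system \<Rightarrow> bool"
  where "is_constraint_system k S \<longleftrightarrow> k \<ge> 1 \<and> finite (vars S) \<and>
    (\<forall>i\<in>{1..num S}. scope S i \<subseteq> vars S \<and> allowed S i \<subseteq> (scope S i \<rightarrow>\<^sub>E {..<k}))"

definition is_distribution :: "nat \<Rightarrow> (nat \<Rightarrow> real) \<Rightarrow> bool"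
  where "is_distribution m \<pi> \<longleftrightarrow> (\<forall>i\<in>{1..m}. 0 \<le> \<pi> i) \<and> (\<Sum>i\<in>{1..m}. \<pi> i) = 1"

definition max_scope :: "'v constraint_system \<Rightarrow> nat"
  where "max_scope S = Max ((\<lambda>i. card (scope S i)) ` {1..num S})"


subsection \<open>The algebra \<open>\<A>\<^bsub>a+comm\<^esub>(S,\<pi>)\<close>\<close>

definition weight_a ::
    "nat \<Rightarrow> 'v::linorder constraint_system \<Rightarrow> (nat \<Rightarrow> real) \<Rightarrow> 'v star_poly set \<Rightarrow> real"
  where "weight_a k S \<pi> = (let A = free_cyclic_algebra k (vars S); u = free_cyclic_gen k (vars S) in
    listed_weight (SIGMA i:{1..num S}. (scope S i \<rightarrow>\<^sub>E {..<k}) - allowed S i)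
      (\<lambda>(i, \<phi>). assignment_proj A k u (scope S i) \<phi>)
      (\<lambda>(i, \<phi>). \<pi> i))"

definition weight_comm ::
    "nat \<Rightarrow> 'v::linorder constraint_system \<Rightarrow> (nat \<Rightarrow> real) \<Rightarrow> 'v star_poly set \<Rightarrow> real"
  where "weight_comm k S \<pi> = (let A = free_cyclic_algebra k (vars S); u = free_cyclic_gen k (vars S) in
    listed_weight ({..<k} \<times> {..<k} \<times> vars S \<times> vars S)
      (\<lambda>(a, b, x, y). commutator A (spectral_proj A k (u x) a) (spectral_proj A k (u y) b))
      (\<lambda>(a, b, x, y). \<Sum>i\<in>{i \<in> {1..num S}. x \<in> scope S i \<and> y \<in> scope S i}. \<pi> i))"

definition algebra_a_comm ::
    "nat \<Rightarrow> 'v::linorder constraint_system \<Rightarrow> (nat \<Rightarrow> real) \<Rightarrow> 'v star_poly set weighted_star_algebra"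
  where "algebra_a_comm k S \<pi> =
    (free_cyclic_algebra k (vars S), \<lambda>a. weight_a k S \<pi> a + weight_comm k S \<pi> a)"


subsection \<open>The algebra \<open>\<A>\<^bsub>c-v\<^esub>(S,\<pi>)\<close>\<close>

text \<open>The ideal divided out in \<open>\<A>(V,C)\<close>. Its generators are self-adjoint, so that it is also the
  two-sided ideal which they generate.\<close>

definition constraint_ideal ::
    "nat \<Rightarrow> 'v::linorder set \<Rightarrow> ('v \<Rightarrow> nat) set \<Rightarrow> 'v star_poly set set"
  where "constraint_ideal k V C = star_ideal (abelian_cyclic_algebra k V)
    (assignment_proj (abelian_cyclic_algebra k V) k (abelian_cyclic_gen k V) V ` ((V \<rightarrow>\<^sub>E {..<k}) - C))"

definition constraint_algebra ::
    "nat \<Rightarrow> 'v::linorder set \<Rightarrow> ('v \<Rightarrow> nat) set \<Rightarrow> 'v star_poly set set star_algebra"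
  where "constraint_algebra k V C =
    quotient_algebra (abelian_cyclic_algebra k V) (constraint_ideal k V C)"

definition constraint_gen ::
    "nat \<Rightarrow> 'v::linorder set \<Rightarrow> ('v \<Rightarrow> nat) set \<Rightarrow> 'v \<Rightarrow> 'v star_poly set set"
  where "constraint_gen k V C x =
    constraint_ideal k V C +>\<^bsub>abelian_cyclic_algebra k V\<^esub> abelian_cyclic_gen k V x"

definition algebra_c_v ::
    "nat \<Rightarrow> 'v::linorder constraint_system \<Rightarrow> (nat \<Rightarrow> real) \<Rightarrow>
     (nat \<times> 'v star_poly set set + 'v star_poly set) star_poly set weighted_star_algebra"
  where "algebra_c_v k S \<pi> =
    (let I = {1..num S};
         A = (\<lambda>i. constraint_algebra k (scope S i) (allowed S i));
         B = free_cyclic_algebra k (vars S);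
         P = free_product I A B;
         \<Phi> = (\<lambda>i \<phi>. family_incl I A B i
                (assignment_proj (A i) k (constraint_gen k (scope S i) (allowed S i)) (scope S i) \<phi>));
         v = (\<lambda>x. extra_incl I A B (free_cyclic_gen k (vars S) x))
     in (P, listed_weight (SIGMA i:I. scope S i \<times> allowed S i)
              (\<lambda>(i, x, \<phi>). \<Phi> i \<phi> \<otimes>\<^bsub>P\<^esub> (\<one>\<^bsub>P\<^esub> \<ominus>\<^bsub>P\<^esub> spectral_proj P k (v x) (\<phi> x)))
              (\<lambda>(i, x, \<phi>). \<pi> i / real (card (scope S i)))))"

end

theory Submission
  imports Defs
begin

text \<open>The homomorphism is the inclusion of \<open>\<complex>\<int>\<^sub>k\<^sup>*\<^sup>X\<close> into the free product. In the
  free product there are, for each constraint \<open>i\<close> and \<open>x \<in> V\<^sub>i\<close>, two projective measurements: \<open>p\<close>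
  from \<open>\<A>(V\<^sub>i, C\<^sub>i)\<close> and \<open>q\<close> from \<open>\<complex>\<int>\<^sub>k\<^sup>*\<^sup>X\<close>. All weighted sums are compared with
  \<open>\<delta>(x) = \<Sum>\<^sub>a (p\<^sub>x\<^sub>,\<^sub>a - q\<^sub>x\<^sub>,\<^sub>a)\<^sup>2\<close>, up to cyclic equality. The part of constraint \<open>i\<close> in the sum
  for \<open>\<A>\<^bsub>c-v\<^esub>\<close> is \<open>1/(2|V\<^sub>i|)\<close> times the sum of \<open>\<delta>(x)\<close> over \<open>x \<in> V\<^sub>i\<close>. Since the \<open>p\<close> commute, each
  commutator \<open>[q\<^sub>x\<^sub>,\<^sub>a, q\<^sub>y\<^sub>,\<^sub>b]\<close> is a sum of two commutators with differences \<open>p - q\<close>, so that the commutator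
  part for \<open>x, y\<close> is at most \<open>4(\<delta>(x) + \<delta>(y))\<close>. For \<open>\<phi> \<notin> C\<^sub>i\<close> the product of the \<open>p\<^sub>x\<^sub>,\<^sub>\<phi>\<^sub>(\<^sub>x\<^sub>)\<close> vanishes, so
  telescoping from the product of the \<open>q\<close> to that of the \<open>p\<close> bounds the remaining part by
  \<open>(|V\<^sub>i| + 1)\<close> times the sum of \<open>\<delta>(x)\<close>.\<close>

text \<open>No states or norms stand behind the order, so every inequality has to be exhibited by
  squares and commutators. Completeness of a measurement takes their place: the sum of the squares
  of \<open>p b \<otimes> h\<close> over all outcomes \<open>b\<close> is the square of
  \<open>h\<close>, and that of \<open>h \<otimes> p b\<close> is so up to commutators. Sums over
  outcomes and assignments thus collapse without a factor that depends on \<open>k\<close>. The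
  constant: let n be the size of the scope and D the sum of \<delta>(x) over it. Each \<delta>(x)
  enters the ordered pairs 2n times, so the commutator part is at most 8nD. With (n + 1)D for the
  forbidden assignments the total is (9n + 1)D, at most 10nD when n \<ge> 1. Up to commutators D is
  twice the sum of squares of the constraint without its weight, which gives 20n = 20n^2/n. Here 1/n
  is the weight in the target and n \<le> L; so one factor L comes from the estimate and the other
  from the weight.\<close>

lemma complex_ring_simps [simp]:
  "carrier complex_ring = UNIV" "mult complex_ring = (*)" "one complex_ring = 1"
  "zero complex_ring = 0" "add complex_ring = (+)"
  by (simp_all add: complex_ring_def)

lemma cring_complex_ring: "cring complex_ring"
proof (rule cringI)
  show "abelian_group complex_ring"
    by (rule abelian_groupI) (auto intro: exI[of _ "- x" for x])
  show "comm_monoid complex_ring"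
    by (rule comm_monoidI) auto
qed (auto simp: algebra_simps)

text \<open>The locale \<open>star_algebra\<close> also brings the ring facts of \<^const>\<open>complex_ring\<close> into scope, where
  they hide those of the algebra. The following equivalent locale avoids this.\<close>

locale star_ring = ring A for A (structure) +
  assumes scale_closed [simp, intro]: "a \<in> carrier A \<Longrightarrow> c \<odot> a \<in> carrier A"
    and scale_add_left: "a \<in> carrier A \<Longrightarrow> (c + d) \<odot> a = c \<odot> a \<oplus> d \<odot> a"
    and scale_add_right:
      "\<lbrakk>a \<in> carrier A; b \<in> carrier A\<rbrakk> \<Longrightarrow> c \<odot> (a \<oplus> b) = c \<odot> a \<oplus> c \<odot> b"
    and scale_mult: "a \<in> carrier A \<Longrightarrow> (c * d) \<odot> a = c \<odot> (d \<odot> a)"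
    and scale_one [simp]: "a \<in> carrier A \<Longrightarrow> (1::complex) \<odot> a = a"
    and scale_mult_left:
      "\<lbrakk>a \<in> carrier A; b \<in> carrier A\<rbrakk> \<Longrightarrow> (c \<odot> a) \<otimes> b = c \<odot> (a \<otimes> b)"
    and scale_mult_right:
      "\<lbrakk>a \<in> carrier A; b \<in> carrier A\<rbrakk> \<Longrightarrow> a \<otimes> (c \<odot> b) = c \<odot> (a \<otimes> b)"
    and adj_closed [simp, intro]: "a \<in> carrier A \<Longrightarrow> adj a \<in> carrier A"
    and adj_add: "\<lbrakk>a \<in> carrier A; b \<in> carrier A\<rbrakk> \<Longrightarrow> adj (a \<oplus> b) = adj a \<oplus> adj b"
    and adj_scale: "a \<in> carrier A \<Longrightarrow> adj (c \<odot> a) = cnj c \<odot> adj a"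
    and adj_mult: "\<lbrakk>a \<in> carrier A; b \<in> carrier A\<rbrakk> \<Longrightarrow> adj (a \<otimes> b) = adj b \<otimes> adj a"
    and adj_adj: "a \<in> carrier A \<Longrightarrow> adj (adj a) = a"

lemma star_algebra_iff: "star_algebra A \<longleftrightarrow> star_ring A"
proof
  assume "star_algebra A"
  then interpret star_algebra A .
  show "star_ring A"
    by (intro star_ring.intro star_ring_axioms.intro)
      (use star_algebra.axioms(1)[OF \<open>star_algebra A\<close>] smult_closed smult_l_distr smult_r_distr
        smult_assoc1 smult_one smult_mult_left smult_mult_right adj_closed adj_add adj_smult adj_mult
        adj_adj in auto)
next
  assume "star_ring A"
  then interpret star_ring A .
  show "star_algebra A"
    by (intro star_algebra.intro moduleI star_algebra_axioms.intro ring_axioms is_abelian_group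
        cring_complex_ring)
      (simp_all add: scale_add_left scale_add_right scale_mult scale_mult_left scale_mult_right
        adj_add adj_scale adj_mult adj_adj)
qed

subsection \<open>Free *-algebras\<close>

lemma adj_word_adj_word [simp]: "adj_word (adj_word w) = w"
  by (cases w) (auto simp: adj_word_def rev_map comp_def split_def)

lemma adj_word_eq_iff: "adj_word v = w \<longleftrightarrow> v = adj_word w"
  by auto

lemma adj_word_plus: "adj_word (u + v) = adj_word v + adj_word u"
  by (simp add: adj_word_def plus_word_def)

lemma adj_word_zero [simp]: "adj_word 0 = 0"
  by (simp add: adj_word_def zero_word_def)

lemma letters_plus [simp]: "letters (u + v) = letters u @ letters v"
  by (simp add: plus_word_def)

lemma letters_zero [simp]: "letters 0 = []"
  by (simp add: zero_word_def)

lemma letters_adj_word: "fst ` set (letters (adj_word w)) = fst ` set (letters w)"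
  by (force simp: adj_word_def)

text \<open>Taking adjoint words is an involution, so exactly one word contributes to each
  coefficient and the defining sum collapses. Additivity and involutivity are then checked
  coefficient by coefficient, without following how key sets change.\<close>

lemma lookup_adj_free:
  "Poly_Mapping.lookup (adj\<^bsub>free_star_algebra G\<^esub> p) w = cnj (Poly_Mapping.lookup p (adj_word w))"
proof -
  have "Poly_Mapping.lookup (adj\<^bsub>free_star_algebra G\<^esub> p) w =
      (\<Sum>v\<in>Poly_Mapping.keys p. if v = adj_word w then cnj (Poly_Mapping.lookup p v) else 0)"
    unfolding free_star_algebra_def
    by (simp add: lookup_sum lookup_single when_def adj_word_eq_iff if_distrib cong: if_cong)
  also have "\<dots> = cnj (Poly_Mapping.lookup p (adj_word w))"
    by (auto simp: in_keys_iff)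
  finally show ?thesis .
qed

lemma keys_adj_free: "Poly_Mapping.keys (adj\<^bsub>free_star_algebra G\<^esub> p) = adj_word ` Poly_Mapping.keys p"
  by (auto simp: in_keys_iff lookup_adj_free image_iff intro: adj_word_adj_word[symmetric])

lemma free_adj_add:
  "adj\<^bsub>free_star_algebra G\<^esub> (p + q) = adj\<^bsub>free_star_algebra G\<^esub> p + adj\<^bsub>free_star_algebra G\<^esub> q"
  by (rule poly_mapping_eqI) (simp add: lookup_adj_free lookup_add)

lemma free_adj_single:
  "adj\<^bsub>free_star_algebra G\<^esub> (Poly_Mapping.single w c) = Poly_Mapping.single (adj_word w) (cnj c)"
  by (rule poly_mapping_eqI) (auto simp: lookup_adj_free lookup_single when_def)

text \<open>Reduces an identity that is additive in \<open>p\<close> to monomials. Updating at a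
  fresh key is the same as adding a monomial, which turns the induction by updates into this
  one.\<close>

lemma poly_mapping_additive_induct [case_names single add]:
  assumes "\<And>w c. P (Poly_Mapping.single w c)" "\<And>p q. P p \<Longrightarrow> P q \<Longrightarrow> P (p + q)"
  shows "P (p :: 'a \<Rightarrow>\<^sub>0 'b::comm_monoid_add)"
proof (induction p rule: update_induct)
  case const
  \<comment> \<open>The zero polynomial is a monomial with coefficient 0.\<close>
  show ?case using assms(1)[of undefined 0] by simp
next
  case (update f a b)
  have "Poly_Mapping.update a b f = Poly_Mapping.single a b + f"
    by (rule poly_mapping_eqI) (use update in \<open>auto simp: lookup_update lookup_add lookup_single when_def in_keys_iff\<close>)
  then show ?case using assms update by simp
qed

lemma free_adj_mult:
  "adj\<^bsub>free_star_algebra G\<^esub> (p * q) = adj\<^bsub>free_star_algebra G\<^esub> q * adj\<^bsub>free_star_algebra G\<^esub> p"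
proof (induction p rule: poly_mapping_additive_induct)
  case (single w c)
  show ?case
    by (induction q rule: poly_mapping_additive_induct)
      (simp_all add: mult_single free_adj_single free_adj_add adj_word_plus algebra_simps)
qed (simp add: free_adj_add algebra_simps)

text \<open>Constants live on the empty word, the unit of concatenation, hence are central. Scalar
  multiplication, defined by a constant on the left, can therefore be moved past any factor.\<close>

lemma single_0_commute:
  "p * Poly_Mapping.single 0 (c::complex) = Poly_Mapping.single 0 c * (p :: 'g star_poly)"
  by (induction p rule: poly_mapping_additive_induct) (simp_all add: mult_single algebra_simps)

lemma free_star_algebra_simps:
  "one (free_star_algebra G) = 1" "mult (free_star_algebra G) = (*)"
  "zero (free_star_algebra G) = 0" "add (free_star_algebra G) = (+)"
  "smult (free_star_algebra G) c p = Poly_Mapping.single 0 c * p"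
  by (simp_all add: free_star_algebra_def)

lemma free_carrier_iff:
  "p \<in> carrier (free_star_algebra G) \<longleftrightarrow> (\<forall>w\<in>Poly_Mapping.keys p. fst ` set (letters w) \<subseteq> G)"
  by (simp add: free_star_algebra_def)

lemma ring_free_star_algebra: "ring (free_star_algebra G)"
proof (rule ringI)
  show "abelian_group (free_star_algebra G)"
  proof (rule abelian_groupI, goal_cases)
    case (1 x y)
    then show ?case using keys_add[of x y] by (auto simp: free_star_algebra_simps free_carrier_iff)
  next
    case (6 x)
    then have "- x \<in> carrier (free_star_algebra G)"
      by (auto simp: free_carrier_iff in_keys_iff)
    then show ?case by (intro bexI[of _ "- x"]) (auto simp: free_star_algebra_simps)
  qed (auto simp: free_star_algebra_simps free_carrier_iff algebra_simps)
  show "monoid (free_star_algebra G)"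
  proof (rule monoidI, goal_cases)
    case (1 x y)
    show ?case
      unfolding free_carrier_iff free_star_algebra_simps
    proof
      fix w assume "w \<in> Poly_Mapping.keys (x * y)"
      then obtain u v where "w = u + v" "u \<in> Poly_Mapping.keys x" "v \<in> Poly_Mapping.keys y"
        using keys_mult[of x y] by blast
      then show "fst ` set (letters w) \<subseteq> G"
        using 1 by (auto simp: free_carrier_iff)
    qed
  qed (auto simp: free_star_algebra_simps free_carrier_iff algebra_simps)
qed (auto simp: free_star_algebra_simps algebra_simps)

lemma star_ring_free: "star_ring (free_star_algebra G)"
proof -
  interpret ring "free_star_algebra G" by (rule ring_free_star_algebra)
  have s: "Poly_Mapping.single 0 c \<in> carrier (free_star_algebra G)" for c
    by (auto simp: free_carrier_iff)
  have comm: "x * (Poly_Mapping.single 0 c * y) = Poly_Mapping.single 0 c * (x * y)"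
    for c and x y :: "'a star_poly"
    by (metis mult.assoc single_0_commute)
  show ?thesis
  \<comment> \<open>Goal 1 is the ring, goals 2 to 13 are the axioms of \<open>star_ring\<close> in
    order: 2 is closure under scalars, 5 associativity of scalars, 9 closure under adjoints, 11
    conjugate linearity, 13 involutivity.\<close>
  proof (intro star_ring.intro star_ring_axioms.intro, goal_cases)
    case (2 a c)
    show ?case using m_closed[OF s 2] by (simp add: free_star_algebra_simps)
  next
    case (5 a c d)
    have "Poly_Mapping.single 0 (c * d) = Poly_Mapping.single (0 :: 'a word) c * Poly_Mapping.single 0 d"
      by (simp add: mult_single)
    then show ?case by (simp add: free_star_algebra_simps mult.assoc)
  next
    case (9 a)
    then show ?case by (auto simp: free_carrier_iff keys_adj_free letters_adj_word)
  next
    case (11 a c)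
    show ?case
      by (simp add: free_star_algebra_simps free_adj_mult free_adj_single single_0_commute)
  next
    case (13 a)
    show ?case by (rule poly_mapping_eqI) (simp add: lookup_adj_free)
  qed (simp_all add: free_star_algebra_simps single_add distrib_left distrib_right comm mult.assoc
      free_adj_add free_adj_mult ring_free_star_algebra)
qed

lemma free_gen_closed: "x \<in> G \<Longrightarrow> free_gen x \<in> carrier (free_star_algebra G)"
  by (auto simp: free_gen_def free_carrier_iff)

section \<open>Scalars, adjoints and ideals of a *-algebra\<close>

context star_ring
begin

lemma scale_zero_left [simp]:
  assumes "a \<in> carrier A" shows "0 \<odot> a = \<zero>"
proof -
  have "0 \<odot> a \<oplus> 0 \<odot> a = 0 \<odot> a" using scale_add_left[OF assms, of 0 0] by simp
  then show ?thesis using assms by (simp add: add.r_cancel_one')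
qed

lemma scale_minus_left: "a \<in> carrier A \<Longrightarrow> (- c) \<odot> a = \<ominus> (c \<odot> a)"
  by (rule minus_equality[symmetric]) (simp_all flip: scale_add_left)

lemma scale_zero_right [simp]: "c \<odot> \<zero> = \<zero>"
  using scale_mult[of \<zero> c 0] by simp

lemma scale_minus_right: "a \<in> carrier A \<Longrightarrow> c \<odot> (\<ominus> a) = \<ominus> (c \<odot> a)"
  by (rule minus_equality[symmetric]) (simp_all flip: scale_add_right add: l_neg)

lemma scale_finsum:
  "f \<in> I \<rightarrow> carrier A \<Longrightarrow> c \<odot> (\<Oplus>i\<in>I. f i) = (\<Oplus>i\<in>I. c \<odot> f i)"
  by (induction I rule: infinite_finite_induct) (auto simp: scale_add_right Pi_iff finsum_infinite)

lemma adj_zero [simp]: "adj \<zero> = \<zero>"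
  using adj_scale[of \<zero> 0] by simp

lemma adj_one [simp]: "adj \<one> = \<one>"
proof -
  have "adj \<one> = adj (adj \<one>) \<otimes> adj \<one>" by (simp add: adj_adj)
  also have "\<dots> = adj (\<one> \<otimes> adj \<one>)" by (rule adj_mult[symmetric]) auto
  also have "\<dots> = \<one>" by (simp add: adj_adj)
  finally show ?thesis .
qed

lemma adj_minus: "a \<in> carrier A \<Longrightarrow> adj (\<ominus> a) = \<ominus> adj a"
  using adj_scale[of a "-1"] scale_minus_left[of a 1] scale_minus_left[of "adj a" 1] by simp

lemma adj_diff: "\<lbrakk>a \<in> carrier A; b \<in> carrier A\<rbrakk> \<Longrightarrow> adj (a \<ominus> b) = adj a \<ominus> adj b"
  by (simp add: a_minus_def adj_add adj_minus)

lemma adj_finsum: "f \<in> I \<rightarrow> carrier A \<Longrightarrow> adj (\<Oplus>i\<in>I. f i) = (\<Oplus>i\<in>I. adj (f i))"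
  by (induction I rule: infinite_finite_induct) (auto simp: adj_add Pi_iff finsum_infinite)

lemma commutator_closed [simp, intro]:
  "\<lbrakk>a \<in> carrier A; b \<in> carrier A\<rbrakk> \<Longrightarrow> commutator A a b \<in> carrier A"
  by (simp add: commutator_def)

text \<open>A ring ideal absorbs scalars because scaling by \<open>c\<close> is multiplication by
  \<open>c \<odot> \<one>\<close>.\<close>

lemma ideal_scale_closed:
  assumes "ideal I A" "a \<in> I"
  shows "c \<odot> a \<in> I"
proof -
  interpret I: ideal I A by fact
  have a: "a \<in> carrier A" using assms I.Icarr by auto
  have "(c \<odot> \<one>) \<otimes> a \<in> I" by (rule I.I_l_closed) (use assms in auto)
  then show ?thesis using a by (simp add: scale_mult_left)
qed

lemma coset_adj:
  assumes I: "ideal I A" and adj: "\<And>a. a \<in> I \<Longrightarrow> adj a \<in> I" and a: "a \<in> carrier A"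
  shows "(\<Union>x\<in>I +> a. I +> adj x) = I +> adj a"
proof -
  interpret I: ideal I A by fact
  have "I +> adj x = I +> adj a" if x: "x \<in> I +> a" for x
  proof -
    obtain h where h: "h \<in> I" "x = h \<oplus> a"
      using x unfolding a_r_coset_def' by blast
    have hc: "h \<in> carrier A" using h I.Icarr by auto
    have "adj x \<ominus> adj a = adj h"
      using hc a by (simp add: h adj_add minus_eq a_assoc r_neg)
    then have "adj x \<ominus> adj a \<in> I" using adj h by simp
    then show ?thesis
      using quotient_eq_iff_same_a_r_cos[OF I, of "adj x" "adj a"] hc a h by auto
  qed
  moreover have "a \<in> I +> a" using I.a_rcos_self a by auto
  ultimately show ?thesis by blast
qed

lemma coset_scale:
  assumes I: "ideal I A" and a: "a \<in> carrier A"
  shows "(\<Union>x\<in>I +> a. I +> (c \<odot> x)) = I +> (c \<odot> a)"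
proof -
  interpret I: ideal I A by fact
  have "I +> (c \<odot> x) = I +> (c \<odot> a)" if x: "x \<in> I +> a" for x
  proof -
    obtain h where h: "h \<in> I" "x = h \<oplus> a"
      using x unfolding a_r_coset_def' by blast
    have hc: "h \<in> carrier A" using h I.Icarr by auto
    have "c \<odot> x \<ominus> c \<odot> a = c \<odot> h"
      using hc a by (simp add: h scale_add_right minus_eq a_assoc r_neg)
    then have "c \<odot> x \<ominus> c \<odot> a \<in> I" using ideal_scale_closed[OF I] h by simp
    then show ?thesis
      using quotient_eq_iff_same_a_r_cos[OF I, of "c \<odot> x" "c \<odot> a"] hc a h by auto
  qed
  moreover have "a \<in> I +> a" using I.a_rcos_self a by auto
  ultimately show ?thesis by blast
qed

lemma star_ideal_ideal:
  assumes "R \<subseteq> carrier A"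
  shows "ideal (star_ideal A R) A"
  unfolding star_ideal_def by (rule genideal_ideal) (use assms in auto)

lemma star_ideal_incl:
  assumes "R \<subseteq> carrier A"
  shows "R \<subseteq> star_ideal A R"
  using genideal_self[of "R \<union> adj ` R"] assms unfolding star_ideal_def by auto

text \<open>The elements whose adjoint lies in the ideal form an ideal themselves, since
  \<open>adj\<close> exchanges left and right multiplication. That ideal contains the generators and
  their adjoints, so minimality applies.\<close>

lemma star_ideal_adj:
  assumes R: "R \<subseteq> carrier A" and a: "a \<in> star_ideal A R"
  shows "adj a \<in> star_ideal A R"
proof -
  let ?J = "star_ideal A R"
  interpret J: ideal ?J A by (rule star_ideal_ideal[OF R])
  have "ideal {x \<in> carrier A. adj x \<in> ?J} A"
  proof (rule idealI[OF ring_axioms])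
    show "subgroup {x \<in> carrier A. adj x \<in> ?J} (add_monoid A)"
    proof (rule add.subgroupI)
      show "{x \<in> carrier A. adj x \<in> ?J} \<noteq> {}"
        using J.zero_closed by (force intro: exI[of _ \<zero>])
    next
      fix x assume "x \<in> {x \<in> carrier A. adj x \<in> ?J}"
      then show "\<ominus> x \<in> {x \<in> carrier A. adj x \<in> ?J}"
        using J.a_inv_closed by (auto simp: adj_minus)
    next
      fix x y assume "x \<in> {x \<in> carrier A. adj x \<in> ?J}" "y \<in> {x \<in> carrier A. adj x \<in> ?J}"
      then show "x \<oplus> y \<in> {x \<in> carrier A. adj x \<in> ?J}"
        using J.a_closed by (auto simp: adj_add)
    qed auto
  qed (auto simp: adj_mult J.I_l_closed J.I_r_closed)
  moreover have "R \<union> adj ` R \<subseteq> ?J"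
    unfolding star_ideal_def by (rule genideal_self) (use R in auto)
  then have "R \<union> adj ` R \<subseteq> {x \<in> carrier A. adj x \<in> ?J}"
    using R by (auto simp: adj_adj)
  ultimately have "Idl (R \<union> adj ` R) \<subseteq> {x \<in> carrier A. adj x \<in> ?J}"
    by (rule genideal_minimal)
  then show ?thesis using a unfolding star_ideal_def by auto
qed

end

subsection \<open>Quotients and *-homomorphisms\<close>

lemma star_homI:
  assumes "h \<in> ring_hom A B"
    and "\<And>c a. a \<in> carrier A \<Longrightarrow> h (c \<odot>\<^bsub>A\<^esub> a) = c \<odot>\<^bsub>B\<^esub> h a"
    and "\<And>a. a \<in> carrier A \<Longrightarrow> h (adj\<^bsub>A\<^esub> a) = adj\<^bsub>B\<^esub> (h a)"
  shows "h \<in> star_hom A B"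
  using assms by (auto simp: star_hom_def)

lemma star_homD:
  assumes "h \<in> star_hom A B"
  shows "h \<in> ring_hom A B"
    and "a \<in> carrier A \<Longrightarrow> h a \<in> carrier B"
    and "a \<in> carrier A \<Longrightarrow> h (c \<odot>\<^bsub>A\<^esub> a) = c \<odot>\<^bsub>B\<^esub> h a"
    and "a \<in> carrier A \<Longrightarrow> h (adj\<^bsub>A\<^esub> a) = adj\<^bsub>B\<^esub> (h a)"
    and "\<lbrakk>a \<in> carrier A; b \<in> carrier A\<rbrakk> \<Longrightarrow> h (a \<otimes>\<^bsub>A\<^esub> b) = h a \<otimes>\<^bsub>B\<^esub> h b"
    and "\<lbrakk>a \<in> carrier A; b \<in> carrier A\<rbrakk> \<Longrightarrow> h (a \<oplus>\<^bsub>A\<^esub> b) = h a \<oplus>\<^bsub>B\<^esub> h b"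
    and "h \<one>\<^bsub>A\<^esub> = \<one>\<^bsub>B\<^esub>"
  using assms by (auto simp: star_hom_def ring_hom_def)

locale star_ring_hom = A: star_ring A + B: star_ring B
  for A (structure) and B (structure) and h +
  assumes star_hom: "h \<in> star_hom A B"
begin

sublocale ring_hom_ring A B h
  by (rule ring_hom_ringI2) (use A.ring_axioms B.ring_axioms star_homD[OF star_hom] in auto)

lemmas hom_scale = star_homD(3)[OF star_hom]
lemmas hom_adj = star_homD(4)[OF star_hom]

lemma hom_diff: "\<lbrakk>a \<in> carrier A; b \<in> carrier A\<rbrakk> \<Longrightarrow> h (a \<ominus>\<^bsub>A\<^esub> b) = h a \<ominus>\<^bsub>B\<^esub> h b"
  by (simp add: a_minus_def)

lemma hom_finsum':
  "f \<in> I \<rightarrow> carrier A \<Longrightarrow> h (\<Oplus>\<^bsub>A\<^esub>i\<in>I. f i) = (\<Oplus>\<^bsub>B\<^esub>i\<in>I. h (f i))"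
proof (induction I rule: infinite_finite_induct)
  case (insert x F)
  moreover from this have "(\<lambda>i. h (f i)) \<in> F \<rightarrow> carrier B" by (auto simp: Pi_iff)
  ultimately show ?case by (simp add: Pi_iff)
qed (auto simp: A.finsum_infinite B.finsum_infinite)

text \<open>Made for pushing \<open>h\<close> through nested sums by repeated introduction:
  membership of \<open>g i\<close> in the carrier of \<open>B\<close> follows from that of
  \<open>f i\<close>, so it leaves no extra goal.\<close>

lemma hom_finsum_cong:
  assumes "f \<in> I \<rightarrow> carrier A" "\<And>i. i \<in> I \<Longrightarrow> h (f i) = g i"
  shows "h (\<Oplus>\<^bsub>A\<^esub>i\<in>I. f i) = (\<Oplus>\<^bsub>B\<^esub>i\<in>I. g i)"
proof -
  have "g i \<in> carrier B" if "i \<in> I" for i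
    using assms hom_closed[of "f i"] that by auto
  then show ?thesis
    unfolding hom_finsum'[OF assms(1)] using assms(2) by (intro B.finsum_cong') auto
qed

lemma hom_commutator:
  "\<lbrakk>a \<in> carrier A; b \<in> carrier A\<rbrakk> \<Longrightarrow> h (commutator A a b) = commutator B (h a) (h b)"
  by (simp add: commutator_def hom_diff)

lemma hom_spectral_proj:
  assumes "u \<in> carrier A"
  shows "h (spectral_proj A k u a) = spectral_proj B k (h u) a"
proof -
  have "(\<lambda>n. (root_of_unity k powi (- int (n * a))) \<odot>\<^bsub>A\<^esub> u [^]\<^bsub>A\<^esub> n) \<in> {..<k} \<rightarrow> carrier A"
    using assms by auto
  then show ?thesis
    unfolding spectral_proj_def
    by (simp add: hom_scale hom_finsum' hom_nat_pow assms)
qed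

end

lemma (in star_ring) spectral_proj_closed [simp, intro]:
  "u \<in> carrier A \<Longrightarrow> spectral_proj A k u a \<in> carrier A"
  unfolding spectral_proj_def by (intro scale_closed finsum_closed) auto

lemma (in star_ring) assignment_proj_closed [simp, intro]:
  assumes "finite V" "\<And>x. x \<in> V \<Longrightarrow> u x \<in> carrier A"
  shows "assignment_proj A k u V \<phi> \<in> carrier A"
proof -
  have "foldr (\<lambda>x p. spectral_proj A k (u x) (\<phi> x) \<otimes> p) xs \<one> \<in> carrier A"
    if "\<forall>x\<in>set xs. u x \<in> carrier A" for xs
    using that by (induction xs) auto
  then show ?thesis unfolding assignment_proj_def using assms by simp
qed

lemma (in star_ring_hom) hom_assignment_proj:
  assumes "finite V" "\<And>x. x \<in> V \<Longrightarrow> u x \<in> carrier A"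
  shows "h (assignment_proj A k u V \<phi>) = assignment_proj B k (\<lambda>x. h (u x)) V \<phi>"
proof -
  have "foldr (\<lambda>x p. spectral_proj A k (u x) (\<phi> x) \<otimes>\<^bsub>A\<^esub> p) xs \<one>\<^bsub>A\<^esub> \<in> carrier A \<and>
    h (foldr (\<lambda>x p. spectral_proj A k (u x) (\<phi> x) \<otimes>\<^bsub>A\<^esub> p) xs \<one>\<^bsub>A\<^esub>) =
      foldr (\<lambda>x p. spectral_proj B k (h (u x)) (\<phi> x) \<otimes>\<^bsub>B\<^esub> p) xs \<one>\<^bsub>B\<^esub>"
    if "\<forall>x\<in>set xs. u x \<in> carrier A" for xs
    using that by (induction xs) (auto simp: hom_spectral_proj)
  then show ?thesis unfolding assignment_proj_def using assms by simp
qed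

lemma quotient_algebra_simps:
  "carrier (quotient_algebra A I) = carrier (A Quot I)"
  "mult (quotient_algebra A I) = mult (A Quot I)"
  "one (quotient_algebra A I) = one (A Quot I)"
  "zero (quotient_algebra A I) = zero (A Quot I)"
  "add (quotient_algebra A I) = add (A Quot I)"
  by (simp_all add: quotient_algebra_def)

lemma ring_hom_quotient_iff:
  "h \<in> ring_hom A (quotient_algebra B I) \<longleftrightarrow> h \<in> ring_hom A (B Quot I)"
  by (simp add: ring_hom_def quotient_algebra_simps)

lemma star_ring_hom_quotient:
  assumes "star_ring A" and R: "R \<subseteq> carrier A"
  defines "I \<equiv> star_ideal A R"
  shows "star_ring_hom A (quotient_algebra A I) (\<lambda>a. I +>\<^bsub>A\<^esub> a)"
proof -
  let ?Q = "quotient_algebra A I"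
  let ?h = "\<lambda>a. I +>\<^bsub>A\<^esub> a"
  interpret A: star_ring A by fact
  have I: "ideal I A" unfolding I_def by (rule A.star_ideal_ideal[OF R])
  interpret I: ideal I A by fact
  have "ring (A Quot I)" by (rule I.quotient_is_ring)
  then interpret Q: ring "A Quot I" .
  \<comment> \<open>\<open>quotient_algebra\<close> copies the operations of \<open>A Quot I\<close>
    into a larger record, so the ring laws have to be transferred field by field.\<close>
  have ring: "ring ?Q"
    by (rule ringI; (rule abelian_groupI monoidI)?)
      (simp_all add: quotient_algebra_simps Q.a_ac Q.m_assoc Q.l_distr Q.r_distr Q.add.l_inv_ex)
  have hom: "?h \<in> ring_hom A ?Q"
    using I.rcos_ring_hom by (simp add: ring_hom_quotient_iff)
  have scale: "c \<odot>\<^bsub>?Q\<^esub> ?h a = ?h (c \<odot>\<^bsub>A\<^esub> a)" if "a \<in> carrier A" for c a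
    using A.coset_scale[OF I that] by (simp add: quotient_algebra_def)
  have adj: "adj\<^bsub>?Q\<^esub> (?h a) = ?h (adj\<^bsub>A\<^esub> a)" if "a \<in> carrier A" for a
    using A.coset_adj[OF I _ that] A.star_ideal_adj[OF R] by (simp add: quotient_algebra_def I_def)
  \<comment> \<open>Every element of the quotient is the class of some \<open>a\<close>; after
    choosing representatives, each axiom is the image of the same axiom of \<open>A\<close>.\<close>
  have rep: thesis if "P \<in> carrier ?Q" "\<And>a. a \<in> carrier A \<Longrightarrow> P = ?h a \<Longrightarrow> thesis" for P thesis
    using that by (auto simp: quotient_algebra_simps FactRing_def A_RCOSETS_def')
  note h = ring_hom_closed[OF hom] ring_hom_mult[OF hom, symmetric] ring_hom_add[OF hom, symmetric]
    ring_hom_one[OF hom, symmetric]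
  have "star_ring ?Q"
    by (intro star_ring.intro star_ring_axioms.intro ring; (elim rep)?)
      (simp_all add: scale adj h A.scale_add_left A.scale_add_right A.scale_mult
        A.scale_mult_left A.scale_mult_right A.adj_add A.adj_mult A.adj_scale A.adj_adj)
  moreover have "?h \<in> star_hom A ?Q"
    by (rule star_homI[OF hom]) (simp_all add: scale adj)
  ultimately show ?thesis
    by (intro star_ring_hom.intro star_ring_hom_axioms.intro assms(1))
qed

lemma quotient_relation:
  assumes "star_ring A" and R: "R \<subseteq> carrier A"
    and ab: "a \<in> carrier A" "b \<in> carrier A" "a \<ominus>\<^bsub>A\<^esub> b \<in> R"
  shows "star_ideal A R +>\<^bsub>A\<^esub> a = star_ideal A R +>\<^bsub>A\<^esub> b"
proof -
  interpret star_ring A by fact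
  show ?thesis
    using quotient_eq_iff_same_a_r_cos[OF star_ideal_ideal[OF R] ab(1,2)] star_ideal_incl[OF R] ab(3)
    by auto
qed

lemma quotient_relation_zero:
  assumes "star_ring A" and R: "R \<subseteq> carrier A" and a: "a \<in> R"
  shows "star_ideal A R +>\<^bsub>A\<^esub> a = \<zero>\<^bsub>quotient_algebra A (star_ideal A R)\<^esub>"
proof -
  interpret star_ring A by fact
  interpret star_ring_hom A "quotient_algebra A (star_ideal A R)" "\<lambda>a. star_ideal A R +>\<^bsub>A\<^esub> a"
    by (rule star_ring_hom_quotient) fact+
  have "a \<ominus>\<^bsub>A\<^esub> \<zero>\<^bsub>A\<^esub> \<in> R" using R a by (auto simp: minus_eq)
  then show ?thesis using quotient_relation[OF assms(1) R, of a "\<zero>\<^bsub>A\<^esub>"] R a hom_zero by auto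
qed

lemma star_ring_hom_presented:
  assumes "R \<subseteq> carrier (free_star_algebra G)"
  shows "star_ring_hom (free_star_algebra G) (presented_algebra G R)
    (\<lambda>p. star_ideal (free_star_algebra G) R +>\<^bsub>free_star_algebra G\<^esub> p)"
  unfolding presented_algebra_def by (rule star_ring_hom_quotient[OF star_ring_free assms])

subsection \<open>Free products\<close>

lemma (in star_ring) hom_relators_closed:
  assumes "star_ring B" "\<And>b. b \<in> carrier B \<Longrightarrow> j b \<in> carrier A"
  shows "hom_relators B A j \<subseteq> carrier A"
proof -
  interpret B: star_ring B by fact
  show ?thesis unfolding hom_relators_def using assms(2) by auto
qed

lemma hom_relatorsI:
  "\<lbrakk>a \<in> carrier A; b \<in> carrier A\<rbrakk> \<Longrightarrow> j (a \<oplus>\<^bsub>A\<^esub> b) \<ominus>\<^bsub>F\<^esub> (j a \<oplus>\<^bsub>F\<^esub> j b) \<in> hom_relators A F j"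
  "\<lbrakk>a \<in> carrier A; b \<in> carrier A\<rbrakk> \<Longrightarrow> j (a \<otimes>\<^bsub>A\<^esub> b) \<ominus>\<^bsub>F\<^esub> (j a \<otimes>\<^bsub>F\<^esub> j b) \<in> hom_relators A F j"
  "a \<in> carrier A \<Longrightarrow> j (c \<odot>\<^bsub>A\<^esub> a) \<ominus>\<^bsub>F\<^esub> (c \<odot>\<^bsub>F\<^esub> j a) \<in> hom_relators A F j"
  "a \<in> carrier A \<Longrightarrow> j (adj\<^bsub>A\<^esub> a) \<ominus>\<^bsub>F\<^esub> adj\<^bsub>F\<^esub> (j a) \<in> hom_relators A F j"
  "j \<one>\<^bsub>A\<^esub> \<ominus>\<^bsub>F\<^esub> \<one>\<^bsub>F\<^esub> \<in> hom_relators A F j"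
  unfolding hom_relators_def by blast+

text \<open>The relators measure how far \<open>j\<close> is from a unital *-homomorphism, so
  dividing them out makes the composite one. \<open>R\<close> is allowed to be larger than this set:
  one quotient by all the relators then serves every inclusion into the free product.\<close>

lemma star_hom_of_hom_relators:
  assumes "star_ring B" "star_ring F" and R: "R \<subseteq> carrier F"
    and j: "\<And>b. b \<in> carrier B \<Longrightarrow> j b \<in> carrier F" and sub: "hom_relators B F j \<subseteq> R"
  defines "I \<equiv> star_ideal F R"
  shows "star_ring_hom B (quotient_algebra F I) (\<lambda>b. I +>\<^bsub>F\<^esub> j b)"
proof -
  interpret B: star_ring B by fact
  interpret F: star_ring F by fact
  interpret q: star_ring_hom F "quotient_algebra F I" "\<lambda>a. I +>\<^bsub>F\<^esub> a"
    unfolding I_def by (rule star_ring_hom_quotient) fact+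
  note rel = quotient_relation[OF \<open>star_ring F\<close> R, folded I_def]
  have rel': "a \<ominus>\<^bsub>F\<^esub> b \<in> hom_relators B F j \<Longrightarrow> a \<in> carrier F \<Longrightarrow> b \<in> carrier F \<Longrightarrow>
      I +>\<^bsub>F\<^esub> a = I +>\<^bsub>F\<^esub> b" for a b
    using rel sub by blast
  have "(\<lambda>b. I +>\<^bsub>F\<^esub> j b) \<in> ring_hom B (quotient_algebra F I)"
  proof (rule ring_hom_memI)
    fix x assume x: "x \<in> carrier B"
    then show "I +>\<^bsub>F\<^esub> j x \<in> carrier (quotient_algebra F I)" using j by auto
    fix y assume y: "y \<in> carrier B"
    have "I +>\<^bsub>F\<^esub> j (x \<otimes>\<^bsub>B\<^esub> y) = I +>\<^bsub>F\<^esub> (j x \<otimes>\<^bsub>F\<^esub> j y)"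
      by (rule rel'[OF hom_relatorsI(2)]) (simp_all add: x y j)
    then show "I +>\<^bsub>F\<^esub> j (x \<otimes>\<^bsub>B\<^esub> y) =
        (I +>\<^bsub>F\<^esub> j x) \<otimes>\<^bsub>quotient_algebra F I\<^esub> (I +>\<^bsub>F\<^esub> j y)"
      using x y j by simp
    have "I +>\<^bsub>F\<^esub> j (x \<oplus>\<^bsub>B\<^esub> y) = I +>\<^bsub>F\<^esub> (j x \<oplus>\<^bsub>F\<^esub> j y)"
      by (rule rel'[OF hom_relatorsI(1)]) (simp_all add: x y j)
    then show "I +>\<^bsub>F\<^esub> j (x \<oplus>\<^bsub>B\<^esub> y) =
        (I +>\<^bsub>F\<^esub> j x) \<oplus>\<^bsub>quotient_algebra F I\<^esub> (I +>\<^bsub>F\<^esub> j y)"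
      using x y j by simp
  next
    have "I +>\<^bsub>F\<^esub> j \<one>\<^bsub>B\<^esub> = I +>\<^bsub>F\<^esub> \<one>\<^bsub>F\<^esub>"
      by (rule rel'[OF hom_relatorsI(5)]) (simp_all add: j)
    then show "I +>\<^bsub>F\<^esub> j \<one>\<^bsub>B\<^esub> = \<one>\<^bsub>quotient_algebra F I\<^esub>"
      by simp
  qed
  moreover have "I +>\<^bsub>F\<^esub> j (c \<odot>\<^bsub>B\<^esub> x) = c \<odot>\<^bsub>quotient_algebra F I\<^esub> (I +>\<^bsub>F\<^esub> j x)"
    if x: "x \<in> carrier B" for c x
  proof -
    have "I +>\<^bsub>F\<^esub> j (c \<odot>\<^bsub>B\<^esub> x) = I +>\<^bsub>F\<^esub> (c \<odot>\<^bsub>F\<^esub> j x)"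
      by (rule rel'[OF hom_relatorsI(3)]) (simp_all add: x j)
    then show ?thesis using x j by (simp add: q.hom_scale)
  qed
  moreover have "I +>\<^bsub>F\<^esub> j (adj\<^bsub>B\<^esub> x) = adj\<^bsub>quotient_algebra F I\<^esub> (I +>\<^bsub>F\<^esub> j x)"
    if x: "x \<in> carrier B" for x
  proof -
    have "I +>\<^bsub>F\<^esub> j (adj\<^bsub>B\<^esub> x) = I +>\<^bsub>F\<^esub> (adj\<^bsub>F\<^esub> (j x))"
      by (rule rel'[OF hom_relatorsI(4)]) (simp_all add: x j)
    then show ?thesis using x j by (simp add: q.hom_adj)
  qed
  ultimately show ?thesis
    by (intro star_ring_hom.intro star_ring_hom_axioms.intro star_homI
        B.star_ring_axioms q.B.star_ring_axioms)
qed

lemma free_product_relators_closed: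
  assumes "\<And>i. i \<in> I \<Longrightarrow> star_ring (A i)" "star_ring B"
  shows "free_product_relators I A B \<subseteq> carrier (free_star_algebra (free_product_gens I A B))"
  unfolding free_product_relators_def Let_def
  by (intro Un_least UN_least star_ring.hom_relators_closed star_ring_free assms free_gen_closed)
    (auto simp: free_product_gens_def)

lemma star_ring_hom_family_incl:
  assumes "\<And>i. i \<in> I \<Longrightarrow> star_ring (A i)" "star_ring B" "i \<in> I"
  shows "star_ring_hom (A i) (free_product I A B) (family_incl I A B i)"
  unfolding free_product_def presented_algebra_def family_incl_def[abs_def] presented_gen_def
proof (rule star_hom_of_hom_relators[OF _ star_ring_free free_product_relators_closed])
  show "hom_relators (A i) (free_star_algebra (free_product_gens I A B)) (\<lambda>a. free_gen (Inl (i, a)))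
      \<subseteq> free_product_relators I A B"
    unfolding free_product_relators_def Let_def using assms(3) by blast
qed (use assms in \<open>auto intro!: free_gen_closed simp: free_product_gens_def\<close>)

lemma star_ring_hom_extra_incl:
  assumes "\<And>i. i \<in> I \<Longrightarrow> star_ring (A i)" "star_ring B"
  shows "star_ring_hom B (free_product I A B) (extra_incl I A B)"
  unfolding free_product_def presented_algebra_def extra_incl_def[abs_def] presented_gen_def
proof (rule star_hom_of_hom_relators[OF _ star_ring_free free_product_relators_closed])
  show "hom_relators B (free_star_algebra (free_product_gens I A B)) (\<lambda>b. free_gen (Inr b))
      \<subseteq> free_product_relators I A B"
    unfolding free_product_relators_def Let_def by blast
qed (use assms in \<open>auto intro!: free_gen_closed simp: free_product_gens_def\<close>)

subsection \<open>Finite sums\<close>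

context abelian_monoid
begin

lemma finsum_Sigma:
  assumes "finite I" "\<And>i. i \<in> I \<Longrightarrow> finite (J i)"
    and "\<And>i j. \<lbrakk>i \<in> I; j \<in> J i\<rbrakk> \<Longrightarrow> f i j \<in> carrier G"
  shows "finsum G (\<lambda>(i, j). f i j) (Sigma I J) = (\<Oplus>i\<in>I. \<Oplus>j\<in>J i. f i j)"
  using assms
proof (induction I rule: finite_induct)
  case (insert x I)
  have "finsum G (\<lambda>(i, j). f i j) (Sigma (insert x I) J) =
      finsum G (\<lambda>(i, j). f i j) (Pair x ` J x) \<oplus> finsum G (\<lambda>(i, j). f i j) (Sigma I J)"
  proof -
    have "Sigma (insert x I) J = Pair x ` J x \<union> Sigma I J" by auto
    then show ?thesis
      by (simp only:) (rule finsum_Un_disjoint, use insert.hyps insert.prems in auto)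
  qed
  also have "finsum G (\<lambda>(i, j). f i j) (Pair x ` J x) = (\<Oplus>j\<in>J x. f x j)"
    by (subst finsum_reindex) (use insert in \<open>auto simp: inj_on_def\<close>)
  also have "finsum G (\<lambda>(i, j). f i j) (Sigma I J) = (\<Oplus>i\<in>I. \<Oplus>j\<in>J i. f i j)"
    by (rule insert.IH) (use insert in auto)
  also have "(\<Oplus>j\<in>J x. f x j) \<oplus> \<dots> = (\<Oplus>i\<in>insert x I. \<Oplus>j\<in>J i. f i j)"
    by (rule finsum_insert[symmetric]) (use insert in \<open>auto intro!: finsum_closed\<close>)
  finally show ?case .
qed simp

lemma finsum_swap:
  assumes "finite I" "finite J" "\<And>i j. \<lbrakk>i \<in> I; j \<in> J\<rbrakk> \<Longrightarrow> f i j \<in> carrier G"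
  shows "(\<Oplus>i\<in>I. \<Oplus>j\<in>J. f i j) = (\<Oplus>j\<in>J. \<Oplus>i\<in>I. f i j)"
proof -
  have "(\<Oplus>i\<in>I. \<Oplus>j\<in>J. f i j) = finsum G (\<lambda>(i, j). f i j) (I \<times> J)"
    by (rule finsum_Sigma[symmetric]) (use assms in auto)
  also have "\<dots> = finsum G (\<lambda>(i, j). f i j) ((\<lambda>(j, i). (i, j)) ` (J \<times> I))"
    by (rule finsum_cong') (use assms in auto)
  also have "\<dots> = finsum G (\<lambda>(j, i). f i j) (J \<times> I)"
    by (subst finsum_reindex)
      (use assms in \<open>auto simp: inj_on_def split_def intro!: finsum_cong'\<close>)
  also have "\<dots> = (\<Oplus>j\<in>J. \<Oplus>i\<in>I. f i j)"
    by (rule finsum_Sigma) (use assms in auto)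
  finally show ?thesis .
qed

text \<open>An assignment on \<open>insert x V\<close> is a value at \<open>x\<close> together with
  an assignment on \<open>V\<close>, uniquely so because \<open>x\<close> is new. This is the step
  of the inductions over the variables of a constraint.\<close>

lemma finsum_PiE_insert:
  assumes "finite K" "finite V" "x \<notin> V"
    and "\<And>\<phi>. \<phi> \<in> insert x V \<rightarrow>\<^sub>E K \<Longrightarrow> f \<phi> \<in> carrier G"
  shows "(\<Oplus>\<phi>\<in>insert x V \<rightarrow>\<^sub>E K. f \<phi>) = (\<Oplus>a\<in>K. \<Oplus>\<phi>\<in>V \<rightarrow>\<^sub>E K. f (\<phi>(x := a)))"
proof -
  have "(\<Oplus>\<phi>\<in>insert x V \<rightarrow>\<^sub>E K. f \<phi>) = (\<Oplus>\<phi>\<in>(\<lambda>(a, \<phi>). \<phi>(x := a)) ` (K \<times> (V \<rightarrow>\<^sub>E K)). f \<phi>)"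
    by (rule finsum_cong') (use assms in \<open>auto simp: PiE_insert_eq\<close>)
  also have "\<dots> = finsum G (\<lambda>(a, \<phi>). f (\<phi>(x := a))) (K \<times> (V \<rightarrow>\<^sub>E K))"
    by (subst finsum_reindex)
      (use assms inj_combinator[of x V "\<lambda>_. K"] in
        \<open>auto simp: split_def PiE_insert_eq intro!: finsum_cong'\<close>)
  also have "\<dots> = (\<Oplus>a\<in>K. \<Oplus>\<phi>\<in>V \<rightarrow>\<^sub>E K. f (\<phi>(x := a)))"
    by (rule finsum_Sigma) (use assms in \<open>auto intro!: finite_PiE assms(4) PiE_fun_upd\<close>)
  finally show ?thesis .
qed

end

subsection \<open>The tracial order\<close>

text \<open>The differences allowed by \<open>cyclic_le\<close>, built by adding one square or one
  commutator at a time. Closure under sums and scaling becomes an induction instead of a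
  manipulation of two indexed families; \<open>tracial_cone_iff\<close> connects the two
  forms.\<close>

inductive tracial_cone :: "('a, 'c) star_algebra_scheme \<Rightarrow> 'a \<Rightarrow> bool" for A (structure) where
  zero: "tracial_cone A \<zero>"
| square: "\<lbrakk>tracial_cone A x; c \<in> carrier A\<rbrakk> \<Longrightarrow> tracial_cone A (x \<oplus> adj c \<otimes> c)"
| comm: "\<lbrakk>tracial_cone A x; f \<in> carrier A; g \<in> carrier A\<rbrakk> \<Longrightarrow> tracial_cone A (x \<oplus> commutator A f g)"

text \<open>Plays the role of equality under a trace: exchanging the arguments of a commutator
  changes its sign, so commutators lie in the cone with both signs.\<close>

definition cyclic_eq :: "('a, 'c) star_algebra_scheme \<Rightarrow> 'a \<Rightarrow> 'a \<Rightarrow> bool" where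
  "cyclic_eq A a b \<longleftrightarrow> cyclic_le A a b \<and> cyclic_le A b a"

context star_ring
begin

abbreviation cle (infix "\<lesssim>" 50) where "a \<lesssim> b \<equiv> cyclic_le A a b"
abbreviation ceq (infix "\<approx>" 50) where "a \<approx> b \<equiv> cyclic_eq A a b"
abbreviation sq where "sq a \<equiv> adj a \<otimes> a"

lemma tracial_cone_closed: "tracial_cone A x \<Longrightarrow> x \<in> carrier A"
  by (induction rule: tracial_cone.induct) auto

lemma tracial_cone_add: "tracial_cone A y \<Longrightarrow> tracial_cone A x \<Longrightarrow> tracial_cone A (x \<oplus> y)"
  by (induction rule: tracial_cone.induct)
    (auto simp: tracial_cone_closed a_assoc[symmetric] intro: tracial_cone.intros)

text \<open>The generators absorb the factor: a square takes \<open>sqrt r\<close> into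
  \<open>c\<close>, a commutator takes \<open>r\<close> into its first argument.\<close>

lemma tracial_cone_scale:
  assumes "tracial_cone A x" "0 \<le> r" shows "tracial_cone A (complex_of_real r \<odot> x)"
  using assms
proof (induction rule: tracial_cone.induct)
  case (square x c)
  have "sq (complex_of_real (sqrt r) \<odot> c) = complex_of_real r \<odot> sq c"
    using square by (simp add: adj_scale scale_mult_left scale_mult_right flip: scale_mult of_real_mult)
  then show ?case
    using square tracial_cone.square[of A "complex_of_real r \<odot> x" "complex_of_real (sqrt r) \<odot> c"]
    by (simp add: tracial_cone_closed scale_add_right)
next
  case (comm x f g)
  have "commutator A (complex_of_real r \<odot> f) g = complex_of_real r \<odot> commutator A f g"
    using comm by (simp add: commutator_def minus_eq scale_add_right scale_minus_right
        scale_mult_left scale_mult_right)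
  then show ?case
    using comm tracial_cone.comm[of A "complex_of_real r \<odot> x" "complex_of_real r \<odot> f" g]
    by (simp add: tracial_cone_closed scale_add_right)
qed (simp add: tracial_cone.zero)

lemma tracial_cone_square: "c \<in> carrier A \<Longrightarrow> tracial_cone A (sq c)"
  using tracial_cone.square[OF tracial_cone.zero, of c A] by simp

lemma tracial_cone_comm: "f \<in> carrier A \<Longrightarrow> g \<in> carrier A \<Longrightarrow> tracial_cone A (commutator A f g)"
  using tracial_cone.comm[OF tracial_cone.zero, of f A g] by simp

text \<open>From left to right, a new generator is stored at the first free index, \<open>p\<close>
  or \<open>q\<close>, which leaves the earlier terms unchanged. From right to left, the cone
  contains the generators and is closed under finite sums.\<close>

lemma tracial_cone_iff:
  "tracial_cone A x \<longleftrightarrow> (\<exists>(p::nat) (q::nat) c f g.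
       c \<in> {..<p} \<rightarrow> carrier A \<and> f \<in> {..<q} \<rightarrow> carrier A \<and> g \<in> {..<q} \<rightarrow> carrier A \<and>
       x = (\<Oplus>j\<in>{..<p}. sq (c j)) \<oplus> (\<Oplus>l\<in>{..<q}. commutator A (f l) (g l)))"
    (is "_ \<longleftrightarrow> ?R x")
proof
  show "?R x" if "tracial_cone A x"
    using that
  proof (induction rule: tracial_cone.induct)
    case zero
    show ?case
      by (rule exI[of _ 0], rule exI[of _ 0], rule exI[of _ "\<lambda>_. \<zero>"], rule exI[of _ "\<lambda>_. \<zero>"],
          rule exI[of _ "\<lambda>_. \<zero>"]) simp
  next
    case (square x d)
    then obtain p q :: nat and c f g where *: "c \<in> {..<p} \<rightarrow> carrier A" "f \<in> {..<q} \<rightarrow> carrier A"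
      "g \<in> {..<q} \<rightarrow> carrier A"
      "x = (\<Oplus>j\<in>{..<p}. sq (c j)) \<oplus> (\<Oplus>l\<in>{..<q}. commutator A (f l) (g l))" by blast
    have "(\<Oplus>j\<in>{..<p}. sq ((c(p := d)) j)) = (\<Oplus>j\<in>{..<p}. sq (c j))"
      by (rule finsum_cong') (use *(1-3) in \<open>auto simp: Pi_iff\<close>)
    moreover have "(\<Oplus>j\<in>{..<Suc p}. sq ((c(p := d)) j)) = sq d \<oplus> (\<Oplus>j\<in>{..<p}. sq ((c(p := d)) j))"
      unfolding lessThan_Suc using *(1) square.hyps(2) by (subst finsum_insert) (auto simp: Pi_iff)
    ultimately have "x \<oplus> sq d =
        (\<Oplus>j\<in>{..<Suc p}. sq ((c(p := d)) j)) \<oplus> (\<Oplus>l\<in>{..<q}. commutator A (f l) (g l))"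
      using *(1-3) square.hyps(2) unfolding *(4) by (simp add: Pi_iff a_ac)
    moreover have "c(p := d) \<in> {..<Suc p} \<rightarrow> carrier A"
      using *(1) square.hyps(2) by (auto simp: Pi_iff less_Suc_eq)
    ultimately show ?case using *(2,3) by blast
  next
    case (comm x y z)
    then obtain p q :: nat and c f g where *: "c \<in> {..<p} \<rightarrow> carrier A" "f \<in> {..<q} \<rightarrow> carrier A"
      "g \<in> {..<q} \<rightarrow> carrier A"
      "x = (\<Oplus>j\<in>{..<p}. sq (c j)) \<oplus> (\<Oplus>l\<in>{..<q}. commutator A (f l) (g l))" by blast
    let ?t = "\<lambda>l. commutator A ((f(q := y)) l) ((g(q := z)) l)"
    have "(\<Oplus>l\<in>{..<q}. ?t l) = (\<Oplus>l\<in>{..<q}. commutator A (f l) (g l))"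
      by (rule finsum_cong') (use *(1-3) in \<open>auto simp: Pi_iff\<close>)
    moreover have "(\<Oplus>l\<in>{..<Suc q}. ?t l) = commutator A y z \<oplus> (\<Oplus>l\<in>{..<q}. ?t l)"
      unfolding lessThan_Suc using *(2,3) comm.hyps(2,3) by (subst finsum_insert) (auto simp: Pi_iff)
    ultimately have "x \<oplus> commutator A y z = (\<Oplus>j\<in>{..<p}. sq (c j)) \<oplus> (\<Oplus>l\<in>{..<Suc q}. ?t l)"
      using *(1-3) comm.hyps(2,3) unfolding *(4) by (simp add: Pi_iff a_ac)
    moreover have "f(q := y) \<in> {..<Suc q} \<rightarrow> carrier A" "g(q := z) \<in> {..<Suc q} \<rightarrow> carrier A"
      using *(2,3) comm.hyps(2,3) by (auto simp: Pi_iff less_Suc_eq)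
    ultimately show ?case using *(1) by blast
  qed
next
  have sum: "tracial_cone A (\<Oplus>j\<in>I. h j)" if "finite I" "\<And>j. j \<in> I \<Longrightarrow> tracial_cone A (h j)" for I :: "nat set" and h
    using that
  proof (induction rule: finite_induct)
    case (insert i I)
    then have "(\<Oplus>j\<in>insert i I. h j) = h i \<oplus> (\<Oplus>j\<in>I. h j)"
      by (intro finsum_insert) (auto intro: tracial_cone_closed)
    then show ?case using insert by (auto intro!: tracial_cone_add)
  qed (auto intro: tracial_cone.zero)
  show "tracial_cone A x" if "?R x"
    using that
    by (auto simp: Pi_iff intro!: tracial_cone_add sum tracial_cone_square tracial_cone_comm)
qed

lemma cle_iff: "a \<lesssim> b \<longleftrightarrow> a \<in> carrier A \<and> b \<in> carrier A \<and> tracial_cone A (b \<ominus> a)"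
  unfolding cyclic_le_def tracial_cone_iff ..

lemma add_diff_cancel_left [simp]: "\<lbrakk>a \<in> carrier A; x \<in> carrier A\<rbrakk> \<Longrightarrow> a \<oplus> x \<ominus> a = x"
  by (simp add: minus_eq a_comm[of a x] a_assoc r_neg)

lemma add_diff_cancel_right: "\<lbrakk>a \<in> carrier A; b \<in> carrier A\<rbrakk> \<Longrightarrow> a \<oplus> (b \<ominus> a) = b"
  by (simp add: minus_eq a_comm[of b] r_neg2)

lemma cleI: "\<lbrakk>a \<in> carrier A; tracial_cone A x; b = a \<oplus> x\<rbrakk> \<Longrightarrow> a \<lesssim> b"
  unfolding cle_iff using tracial_cone_closed[of x] by simp

lemma cleE:
  assumes "a \<lesssim> b"
  obtains x where "a \<in> carrier A" "tracial_cone A x" "x \<in> carrier A" "b = a \<oplus> x"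
  using assms that[of "b \<ominus> a"] unfolding cle_iff by (simp add: add_diff_cancel_right)

lemma cle_closed: "a \<lesssim> b \<Longrightarrow> a \<in> carrier A" "a \<lesssim> b \<Longrightarrow> b \<in> carrier A"
  by (simp_all add: cle_iff)

lemma cle_refl [simp]: "a \<in> carrier A \<Longrightarrow> a \<lesssim> a"
  by (rule cleI[OF _ tracial_cone.zero]) auto

lemma cle_trans [trans]:
  assumes "a \<lesssim> b" "b \<lesssim> c" shows "a \<lesssim> c"
proof -
  obtain x where x: "a \<in> carrier A" "tracial_cone A x" "x \<in> carrier A" "b = a \<oplus> x"
    using assms(1) by (rule cleE)
  obtain y where y: "tracial_cone A y" "y \<in> carrier A" "c = b \<oplus> y"
    using assms(2) by (rule cleE)
  show ?thesis
    by (rule cleI[OF x(1) tracial_cone_add[OF y(1) x(2)]]) (simp add: x y a_assoc)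
qed

lemma cle_add:
  assumes "a \<lesssim> b" "c \<lesssim> d" shows "a \<oplus> c \<lesssim> b \<oplus> d"
proof -
  obtain x where x: "a \<in> carrier A" "tracial_cone A x" "x \<in> carrier A" "b = a \<oplus> x"
    using assms(1) by (rule cleE)
  obtain y where y: "c \<in> carrier A" "tracial_cone A y" "y \<in> carrier A" "d = c \<oplus> y"
    using assms(2) by (rule cleE)
  show ?thesis
    by (rule cleI[OF _ tracial_cone_add[OF y(2) x(2)]]) (simp_all add: x y a_ac)
qed

lemma cle_scale: "a \<lesssim> b \<Longrightarrow> 0 \<le> r \<Longrightarrow> complex_of_real r \<odot> a \<lesssim> complex_of_real r \<odot> b"
  by (elim cleE, rule cleI, simp, rule tracial_cone_scale) (auto simp: scale_add_right)

lemma cle_minus: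
  assumes "a \<lesssim> b" shows "\<ominus> b \<lesssim> \<ominus> a"
proof -
  obtain x where x: "a \<in> carrier A" "tracial_cone A x" "x \<in> carrier A" "b = a \<oplus> x"
    using assms(1) by (rule cleE)
  show ?thesis
    by (rule cleI[OF _ x(2)]) (simp_all add: x minus_add a_assoc l_neg)
qed

lemma zero_cle_sq: "c \<in> carrier A \<Longrightarrow> \<zero> \<lesssim> sq c"
  by (rule cleI[OF _ tracial_cone_square]) auto

lemma cle_add_nonneg: "\<zero> \<lesssim> b \<Longrightarrow> a \<in> carrier A \<Longrightarrow> a \<lesssim> a \<oplus> b"
  using cle_add[of a a \<zero> b] by simp

lemma cle_finsum:
  assumes "\<And>i. i \<in> I \<Longrightarrow> f i \<lesssim> g i"
  shows "(\<Oplus>i\<in>I. f i) \<lesssim> (\<Oplus>i\<in>I. g i)"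
  using assms
proof (induction I rule: infinite_finite_induct)
  case (insert x F)
  then have "f x \<oplus> (\<Oplus>i\<in>F. f i) \<lesssim> g x \<oplus> (\<Oplus>i\<in>F. g i)" by (intro cle_add) auto
  then show ?case using insert cle_closed
    by (subst (1 2) finsum_insert) (auto simp: Pi_iff intro: cle_closed)
qed (auto simp: finsum_infinite)

lemma cle_scale_mono:
  assumes "\<zero> \<lesssim> a" "r \<le> s"
  shows "complex_of_real r \<odot> a \<lesssim> complex_of_real s \<odot> a"
proof -
  have a: "a \<in> carrier A" using assms(1) by (rule cle_closed)
  have "\<zero> \<lesssim> complex_of_real (s - r) \<odot> a" using cle_scale[OF assms(1), of "s - r"] assms(2) by simp
  then have "complex_of_real r \<odot> a \<lesssim> complex_of_real r \<odot> a \<oplus> complex_of_real (s - r) \<odot> a"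
    using a by (intro cle_add_nonneg) auto
  then show ?thesis using a by (simp flip: scale_add_left of_real_add)
qed

lemma cle_finsum_nonneg:
  assumes "\<And>i. i \<in> I \<Longrightarrow> \<zero> \<lesssim> f i"
  shows "\<zero> \<lesssim> (\<Oplus>i\<in>I. f i)"
  using cle_finsum[of I "\<lambda>_. \<zero>" f] assms by simp

lemma cle_finsum_subset:
  assumes "finite J" "I \<subseteq> J" "\<And>i. i \<in> J \<Longrightarrow> \<zero> \<lesssim> f i"
  shows "(\<Oplus>i\<in>I. f i) \<lesssim> (\<Oplus>i\<in>J. f i)"
proof -
  have c: "f i \<in> carrier A" if "i \<in> J" for i using assms(3)[OF that] by (rule cle_closed)
  have "(\<Oplus>i\<in>J. f i) = (\<Oplus>i\<in>I \<union> (J - I). f i)" using assms(2) by (simp add: Un_absorb1)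
  also have "\<dots> = (\<Oplus>i\<in>I. f i) \<oplus> (\<Oplus>i\<in>J - I. f i)"
    by (rule finsum_Un_disjoint) (use assms c finite_subset in auto)
  finally show ?thesis
    using assms c by (auto intro!: cle_add_nonneg cle_finsum_nonneg finsum_closed)
qed

lemma ceq_refl [simp]: "a \<in> carrier A \<Longrightarrow> a \<approx> a"
  by (simp add: cyclic_eq_def)

lemma ceq_sym: "a \<approx> b \<Longrightarrow> b \<approx> a"
  by (simp add: cyclic_eq_def)

lemma ceq_closed: "a \<approx> b \<Longrightarrow> a \<in> carrier A" "a \<approx> b \<Longrightarrow> b \<in> carrier A"
  by (auto simp: cyclic_eq_def cle_iff)

lemma ceq_trans [trans]: "a \<approx> b \<Longrightarrow> b \<approx> c \<Longrightarrow> a \<approx> c"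
  by (auto simp: cyclic_eq_def intro: cle_trans)

lemma ceq_cle_trans [trans]: "a \<approx> b \<Longrightarrow> b \<lesssim> c \<Longrightarrow> a \<lesssim> c"
  by (auto simp: cyclic_eq_def intro: cle_trans)

lemma cle_ceq_trans [trans]: "a \<lesssim> b \<Longrightarrow> b \<approx> c \<Longrightarrow> a \<lesssim> c"
  by (auto simp: cyclic_eq_def intro: cle_trans)

text \<open>Without these instances, calculations with large sums fall back on the general substitution
  rules, whose higher-order unification is very slow.\<close>

lemma eq_cle_trans [trans]: "a = b \<Longrightarrow> b \<lesssim> c \<Longrightarrow> a \<lesssim> c"
  and cle_eq_trans [trans]: "a \<lesssim> b \<Longrightarrow> b = c \<Longrightarrow> a \<lesssim> c"
  and eq_ceq_trans [trans]: "a = b \<Longrightarrow> b \<approx> c \<Longrightarrow> a \<approx> c"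
  and ceq_eq_trans [trans]: "a \<approx> b \<Longrightarrow> b = c \<Longrightarrow> a \<approx> c"
  by simp_all

lemma ceq_add: "a \<approx> b \<Longrightarrow> c \<approx> d \<Longrightarrow> a \<oplus> c \<approx> b \<oplus> d"
  by (auto simp: cyclic_eq_def intro: cle_add)

lemma ceq_minus: "a \<approx> b \<Longrightarrow> \<ominus> a \<approx> \<ominus> b"
  by (auto simp: cyclic_eq_def intro: cle_minus)

lemma ceq_diff: "a \<approx> b \<Longrightarrow> c \<approx> d \<Longrightarrow> a \<ominus> c \<approx> b \<ominus> d"
  unfolding minus_eq by (intro ceq_add ceq_minus)

lemma ceq_finsum: "(\<And>i. i \<in> I \<Longrightarrow> f i \<approx> g i) \<Longrightarrow> (\<Oplus>i\<in>I. f i) \<approx> (\<Oplus>i\<in>I. g i)"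
  by (auto simp: cyclic_eq_def intro: cle_finsum)

text \<open>The difference is itself a commutator. All later uses of cyclicity rest on this exchange
  of two factors.\<close>

lemma ceq_mult:
  assumes "a \<in> carrier A" "b \<in> carrier A" shows "a \<otimes> b \<approx> b \<otimes> a"
proof -
  have "a \<otimes> b \<lesssim> b \<otimes> a" if "a \<in> carrier A" "b \<in> carrier A" for a b
    by (rule cleI[OF _ tracial_cone_comm[of b a]])
      (use that in \<open>auto simp: commutator_def add_diff_cancel_right\<close>)
  then show ?thesis using assms by (simp add: cyclic_eq_def)
qed

end

section \<open>Projections, projective measurements and the distance of two measurements\<close>

definition projection :: "('a, 'c) star_algebra_scheme \<Rightarrow> 'a \<Rightarrow> bool" where
  "projection A p \<longleftrightarrow> p \<in> carrier A \<and> adj\<^bsub>A\<^esub> p = p \<and> p \<otimes>\<^bsub>A\<^esub> p = p"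

text \<open>Stated through the two properties that drive the estimates: the square of each member is
  the member itself, and the members sum to one.\<close>

definition pvm :: "('a, 'c) star_algebra_scheme \<Rightarrow> 'i set \<Rightarrow> ('i \<Rightarrow> 'a) \<Rightarrow> bool" where
  "pvm A K p \<longleftrightarrow> finite K \<and> (\<forall>a\<in>K. projection A (p a)) \<and> (\<Oplus>\<^bsub>A\<^esub>a\<in>K. p a) = \<one>\<^bsub>A\<^esub>"

context star_ring
begin

lemma projectionD:
  assumes "projection A p"
  shows "p \<in> carrier A" "adj p = p" "p \<otimes> p = p" "x \<in> carrier A \<Longrightarrow> p \<otimes> (p \<otimes> x) = p \<otimes> x"
  using assms by (auto simp: projection_def simp flip: m_assoc)

lemma pvmD:
  assumes "pvm A K p"
  shows "finite K" "a \<in> K \<Longrightarrow> projection A (p a)" "a \<in> K \<Longrightarrow> p a \<in> carrier A"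
    "(\<Oplus>a\<in>K. p a) = \<one>"
  using assms by (auto simp: pvm_def projection_def)

lemma sq_closed [simp, intro]: "a \<in> carrier A \<Longrightarrow> sq a \<in> carrier A"
  by auto

lemma sq_minus: "a \<in> carrier A \<Longrightarrow> sq (\<ominus> a) = sq a"
  by (simp add: adj_minus l_minus r_minus)

lemma sq_mult: "\<lbrakk>a \<in> carrier A; b \<in> carrier A\<rbrakk> \<Longrightarrow> sq (a \<otimes> b) = adj b \<otimes> (sq a \<otimes> b)"
  by (simp add: adj_mult m_assoc)

lemma sq_projection_mult:
  "\<lbrakk>projection A p; b \<in> carrier A\<rbrakk> \<Longrightarrow> sq (p \<otimes> b) = adj b \<otimes> (p \<otimes> b)"
  by (simp add: projectionD sq_mult)

text \<open>The square is \<open>p \<otimes> (sq b \<otimes> p)\<close>; cyclicity brings the two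
  outer factors together, where they merge.\<close>

lemma sq_mult_projection:
  assumes "projection A p" "b \<in> carrier A" shows "sq (b \<otimes> p) \<approx> sq b \<otimes> p"
proof -
  note p = projectionD[OF assms(1)]
  have "sq (b \<otimes> p) = p \<otimes> (sq b \<otimes> p)" using p assms(2) by (simp add: sq_mult)
  also have "\<dots> \<approx> (sq b \<otimes> p) \<otimes> p" using p assms(2) by (intro ceq_mult) auto
  also have "\<dots> = sq b \<otimes> p" using p assms(2) by (simp add: m_assoc)
  finally show ?thesis .
qed

text \<open>The square of \<open>p b \<otimes> h\<close> is
  \<open>adj h \<otimes> (p b \<otimes> h)\<close>, linear in \<open>p b\<close>, so completeness
  can be applied inside. With the measurement on the right the same needs
  \<open>sq_mult_projection\<close>, hence only \<approx> in
  \<open>finsum_sq_pvm_right\<close>.\<close>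

lemma finsum_sq_pvm_left:
  assumes "pvm A K p" "h \<in> carrier A"
  shows "(\<Oplus>b\<in>K. sq (p b \<otimes> h)) = sq h"
proof -
  note p = pvmD[OF assms(1)]
  have "(\<Oplus>b\<in>K. sq (p b \<otimes> h)) = (\<Oplus>b\<in>K. adj h \<otimes> (p b \<otimes> h))"
    by (rule finsum_cong') (use p assms(2) in \<open>auto simp: sq_projection_mult\<close>)
  also have "\<dots> = adj h \<otimes> (\<Oplus>b\<in>K. p b \<otimes> h)"
    by (rule finsum_rdistr[symmetric]) (use p assms(2) in auto)
  also have "(\<Oplus>b\<in>K. p b \<otimes> h) = (\<Oplus>b\<in>K. p b) \<otimes> h"
    by (rule finsum_ldistr[symmetric]) (use p assms(2) in auto)
  finally show ?thesis using p assms(2) by simp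
qed

lemma finsum_sq_pvm_right:
  assumes "pvm A K p" "h \<in> carrier A"
  shows "(\<Oplus>b\<in>K. sq (h \<otimes> p b)) \<approx> sq h"
proof -
  note p = pvmD[OF assms(1)]
  have "(\<Oplus>b\<in>K. sq (h \<otimes> p b)) \<approx> (\<Oplus>b\<in>K. sq h \<otimes> p b)"
    by (rule ceq_finsum) (use p assms(2) in \<open>auto intro: sq_mult_projection\<close>)
  also have "\<dots> = sq h \<otimes> (\<Oplus>b\<in>K. p b)"
    by (rule finsum_rdistr[symmetric]) (use p assms(2) in auto)
  finally show ?thesis using p assms(2) by simp
qed

text \<open>Expanding, the cross terms of \<open>[h, b]\<^sup>*[h, b]\<close> are each cyclically equal to minus the square of
  \<open>b h b\<close>.\<close>

lemma sq_commutator_projection: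
  assumes b: "projection A b" and h: "h \<in> carrier A" "adj h = h"
  shows "sq (commutator A h b) \<lesssim> sq (h \<otimes> b) \<oplus> sq (b \<otimes> h)"
proof -
  note p = projectionD[OF b]
  let ?y = "b \<otimes> h \<otimes> b" and ?z = "h \<otimes> (b \<otimes> (h \<otimes> b))" and ?w = "b \<otimes> (h \<otimes> (b \<otimes> h))"
  have y: "sq ?y = b \<otimes> (h \<otimes> (b \<otimes> (h \<otimes> b)))"
    using p h by (simp add: adj_mult m_assoc)
  have "?z = (h \<otimes> (b \<otimes> (h \<otimes> b))) \<otimes> b" using p h by (simp add: m_assoc)
  also have "\<dots> \<approx> b \<otimes> (h \<otimes> (b \<otimes> (h \<otimes> b)))" by (rule ceq_mult) (use p h in auto)
  finally have z: "?z \<approx> sq ?y" unfolding y .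
  have "?w = b \<otimes> (b \<otimes> (h \<otimes> (b \<otimes> h)))" using p h by simp
  also have "\<dots> \<approx> (b \<otimes> (h \<otimes> (b \<otimes> h))) \<otimes> b" by (rule ceq_mult) (use p h in auto)
  finally have w: "?w \<approx> sq ?y" unfolding y using p h by (simp add: m_assoc)
  have "\<zero> \<lesssim> sq ?y" using p h by (intro zero_cle_sq) auto
  then have nonneg: "\<zero> \<lesssim> ?z" "\<zero> \<lesssim> ?w"
    using z w by (auto intro: cle_ceq_trans dest: ceq_sym)
  \<comment> \<open>Adding \<open>?z\<close> and \<open>?w\<close> cancels the cross terms exactly,
    so discarding them is the only loss in this estimate.\<close>
  have "sq (commutator A h b) \<lesssim> sq (commutator A h b) \<oplus> (?z \<oplus> ?w)"
    using cle_add[OF nonneg] p h by (intro cle_add_nonneg) auto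
  also have "\<dots> = sq (h \<otimes> b) \<oplus> sq (b \<otimes> h)"
    using p h
    by (simp add: commutator_def adj_add adj_minus adj_mult minus_eq l_distr r_distr l_minus r_minus minus_add
        m_assoc a_ac r_neg1 r_neg2 r_neg)
  finally show ?thesis .
qed

text \<open>Each of the two squares from \<open>sq_commutator_projection\<close> sums to
  \<open>sq h\<close>. Bounding the two halves of the commutator by \<open>sq_add_le\<close> with
  \<open>s = 1\<close> instead would give four copies of \<open>sq h\<close> in place of
  two.\<close>

lemma finsum_sq_commutator:
  assumes p: "pvm A K p" and h: "h \<in> carrier A" "adj h = h"
  shows "(\<Oplus>b\<in>K. sq (commutator A h (p b))) \<lesssim> sq h \<oplus> sq h"
proof -
  note p' = pvmD[OF p]
  have "(\<Oplus>b\<in>K. sq (commutator A h (p b))) \<lesssim> (\<Oplus>b\<in>K. sq (h \<otimes> p b) \<oplus> sq (p b \<otimes> h))"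
    by (intro cle_finsum sq_commutator_projection) (use p' h in auto)
  also have "\<dots> = (\<Oplus>b\<in>K. sq (h \<otimes> p b)) \<oplus> (\<Oplus>b\<in>K. sq (p b \<otimes> h))"
    by (rule finsum_addf) (use p' h in auto)
  also have "\<dots> \<approx> sq h \<oplus> sq h"
    using finsum_sq_pvm_left[OF p h(1)] finsum_sq_pvm_right[OF p h(1)] h by (auto intro: ceq_add)
  finally show ?thesis .
qed

text \<open>Young's inequality: the slack is the square of \<open>sqrt s\<close> times
  \<open>u\<close> minus \<open>1 / sqrt s\<close> times \<open>v\<close>, whose cross terms cancel
  those of \<open>u \<oplus> v\<close>. The parameter \<open>s\<close> stays free because the
  telescoping needs unequal weights.\<close>

lemma sq_add_le:
  assumes u: "u \<in> carrier A" and v: "v \<in> carrier A" and s: "s > 0"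
  shows "sq (u \<oplus> v) \<lesssim> complex_of_real (1 + s) \<odot> sq u \<oplus> complex_of_real (1 + 1 / s) \<odot> sq v"
proof -
  let ?r = "complex_of_real (sqrt s)"
  let ?w = "?r \<odot> u" and ?z = "(1 / ?r) \<odot> v"
  have r: "?r * ?r = complex_of_real s" "?r \<noteq> 0" "cnj ?r = ?r"
    using s by (auto simp flip: of_real_mult)
  have w: "sq ?w = complex_of_real s \<odot> sq u" "sq ?z = complex_of_real (1 / s) \<odot> sq v"
    "adj ?w \<otimes> ?z = adj u \<otimes> v" "adj ?z \<otimes> ?w = adj v \<otimes> u"
    using u v r by (simp_all add: adj_scale scale_mult_left scale_mult_right flip: scale_mult r(1))
  have "sq (u \<oplus> v) \<lesssim> sq (u \<oplus> v) \<oplus> sq (?w \<ominus> ?z)"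
    using u v by (intro cle_add_nonneg zero_cle_sq) auto
  also have "sq (?w \<ominus> ?z) = (sq ?w \<oplus> sq ?z) \<ominus> (adj u \<otimes> v \<oplus> adj v \<otimes> u)"
    unfolding w(3,4)[symmetric] using u v
    by (simp add: adj_add adj_minus minus_eq l_distr r_distr l_minus r_minus minus_add a_ac)
  also have "sq (u \<oplus> v) \<oplus> \<dots> = (sq u \<oplus> sq ?w) \<oplus> (sq v \<oplus> sq ?z)"
  proof -
    have "sq (u \<oplus> v) = (sq u \<oplus> sq v) \<oplus> (adj u \<otimes> v \<oplus> adj v \<otimes> u)"
      using u v by (simp add: adj_add l_distr r_distr a_ac)
    moreover have "((a \<oplus> b) \<oplus> m) \<oplus> ((c \<oplus> d) \<ominus> m) = (a \<oplus> c) \<oplus> (b \<oplus> d)"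
      if "a \<in> carrier A" "b \<in> carrier A" "c \<in> carrier A" "d \<in> carrier A" "m \<in> carrier A"
      for a b c d m
      using that by algebra
    ultimately show ?thesis using u v by simp
  qed
  also have "\<dots> = complex_of_real (1 + s) \<odot> sq u \<oplus> complex_of_real (1 + 1 / s) \<odot> sq v"
    unfolding w using u v by (simp add: scale_add_left)
  finally show ?thesis .
qed

definition sq_dist :: "'i set \<Rightarrow> ('i \<Rightarrow> 'a) \<Rightarrow> ('i \<Rightarrow> 'a) \<Rightarrow> 'a" where
  "sq_dist K p q = (\<Oplus>a\<in>K. sq (p a \<ominus> q a))"

lemma sq_dist_nonneg:
  assumes "pvm A K p" "pvm A K q" shows "\<zero> \<lesssim> sq_dist K p q"
  unfolding sq_dist_def
  by (intro cle_finsum_nonneg zero_cle_sq minus_closed) (use assms in \<open>auto dest: pvmD\<close>)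

lemma sq_dist_commute:
  assumes "pvm A K p" "pvm A K q" shows "sq_dist K p q = sq_dist K q p"
  unfolding sq_dist_def
proof (rule finsum_cong')
  fix a assume "a \<in> K"
  then have "p a \<in> carrier A" "q a \<in> carrier A" using assms by (auto dest: pvmD)
  then show "sq (p a \<ominus> q a) = sq (q a \<ominus> p a)"
    using sq_minus[of "q a \<ominus> p a"] by (simp add: minus_eq minus_add a_comm)
qed (use assms in \<open>auto dest: pvmD\<close>)

lemma finsum_minus:
  "f \<in> I \<rightarrow> carrier A \<Longrightarrow> (\<Oplus>i\<in>I. \<ominus> f i) = \<ominus> (\<Oplus>i\<in>I. f i)"
  by (induction I rule: infinite_finite_induct) (auto simp: Pi_iff minus_add finsum_infinite)

lemma scale_two: "x \<in> carrier A \<Longrightarrow> (2::complex) \<odot> x = x \<oplus> x"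
  using scale_add_left[of x 1 1] by simp

text \<open>Both sides reduce to one minus the sum of the \<open>p a \<otimes> q a\<close>. On the
  left this arises once, from completeness of \<open>p\<close>. In the distance it arises twice,
  from completeness of \<open>p\<close> and of \<open>q\<close>, which explains the factor
  2.\<close>

lemma finsum_sq_mult_complement:
  assumes p: "pvm A K p" and q: "pvm A K q"
  shows "(2::complex) \<odot> (\<Oplus>a\<in>K. sq (p a \<otimes> (\<one> \<ominus> q a))) \<approx> sq_dist K p q"
proof -
  note p' = pvmD[OF p] and q' = pvmD[OF q]
  have c: "p a \<in> carrier A" "q a \<in> carrier A" "adj (p a) = p a" "adj (q a) = q a"
    "p a \<otimes> p a = p a" "q a \<otimes> q a = q a" "x \<in> carrier A \<Longrightarrow> p a \<otimes> (p a \<otimes> x) = p a \<otimes> x"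
    if "a \<in> K" for a x
    using projectionD[OF p'(2)[OF that]] projectionD[OF q'(2)[OF that]] by auto
  let ?pq = "\<Oplus>a\<in>K. p a \<otimes> q a"
  have pq: "?pq \<in> carrier A" using c by auto
  have "sq (p a \<otimes> (\<one> \<ominus> q a)) \<approx> p a \<ominus> p a \<otimes> q a" if "a \<in> K" for a
  proof -
    have "sq (p a \<otimes> (\<one> \<ominus> q a)) = (\<one> \<ominus> q a) \<otimes> (p a \<otimes> (\<one> \<ominus> q a))"
      using c[OF that] by (simp add: adj_mult adj_diff m_assoc)
    also have "\<dots> \<approx> (p a \<otimes> (\<one> \<ominus> q a)) \<otimes> (\<one> \<ominus> q a)"
      using c[OF that] by (intro ceq_mult) auto
    also have "\<dots> = p a \<ominus> p a \<otimes> q a"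
      using c[OF that]
      by (simp add: minus_eq l_distr r_distr l_minus r_minus minus_add m_assoc a_ac r_neg)
    finally show ?thesis .
  qed
  then have "(\<Oplus>a\<in>K. sq (p a \<otimes> (\<one> \<ominus> q a))) \<approx> (\<Oplus>a\<in>K. p a \<ominus> p a \<otimes> q a)"
    by (rule ceq_finsum)
  also have "\<dots> = (\<Oplus>a\<in>K. p a) \<oplus> (\<Oplus>a\<in>K. \<ominus> (p a \<otimes> q a))"
    unfolding minus_eq by (rule finsum_addf) (use c in auto)
  also have "(\<Oplus>a\<in>K. \<ominus> (p a \<otimes> q a)) = \<ominus> ?pq"
    by (rule finsum_minus) (use c in auto)
  finally have L: "(\<Oplus>a\<in>K. sq (p a \<otimes> (\<one> \<ominus> q a))) \<approx> \<one> \<ominus> ?pq"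
    using p' by (simp add: minus_eq)
  have "sq (p a \<ominus> q a) \<approx> (p a \<ominus> p a \<otimes> q a) \<oplus> (q a \<ominus> p a \<otimes> q a)" if "a \<in> K" for a
  proof -
    have "sq (p a \<ominus> q a) = (p a \<ominus> p a \<otimes> q a) \<oplus> (q a \<ominus> q a \<otimes> p a)"
      using c[OF that]
      by (simp add: adj_add adj_minus minus_eq l_distr r_distr l_minus r_minus minus_add a_ac)
    also have "\<dots> \<approx> (p a \<ominus> p a \<otimes> q a) \<oplus> (q a \<ominus> p a \<otimes> q a)"
      using c[OF that] by (intro ceq_add ceq_diff ceq_mult) auto
    finally show ?thesis .
  qed
  then have "sq_dist K p q \<approx> (\<Oplus>a\<in>K. (p a \<ominus> p a \<otimes> q a) \<oplus> (q a \<ominus> p a \<otimes> q a))"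
    unfolding sq_dist_def by (rule ceq_finsum)
  also have "\<dots> = ((\<Oplus>a\<in>K. p a) \<oplus> (\<Oplus>a\<in>K. \<ominus> (p a \<otimes> q a))) \<oplus> ((\<Oplus>a\<in>K. q a) \<oplus> (\<Oplus>a\<in>K. \<ominus> (p a \<otimes> q a)))"
    unfolding minus_eq using c by (simp add: Pi_iff)
  also have "\<dots> = (\<one> \<ominus> ?pq) \<oplus> (\<one> \<ominus> ?pq)"
    unfolding \<open>(\<Oplus>a\<in>K. \<ominus> (p a \<otimes> q a)) = \<ominus> ?pq\<close> using p' q' by (simp add: minus_eq)
  finally have R: "sq_dist K p q \<approx> (\<one> \<ominus> ?pq) \<oplus> (\<one> \<ominus> ?pq)" .
  show ?thesis
    unfolding scale_two[OF ceq_closed(1)[OF L]]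
    by (rule ceq_trans[OF ceq_add[OF L L] ceq_sym[OF R]])
qed

text \<open>Replace \<open>p\<close> by \<open>p'\<close> and then \<open>q\<close> by
  \<open>q'\<close>; what remains is the commutator of \<open>p'\<close> and \<open>q'\<close>,
  which vanishes. The second term is written with a sign so that both terms are commutators of a
  difference with a projection, the form required by \<open>finsum_sq_commutator\<close>.\<close>

lemma commutator_split:
  assumes "p \<in> carrier A" "q \<in> carrier A" "p' \<in> carrier A" "q' \<in> carrier A"
    and comm: "p' \<otimes> q' = q' \<otimes> p'"
  shows "commutator A p q = commutator A (p \<ominus> p') q \<oplus> \<ominus> commutator A (q \<ominus> q') p'"
proof -
  have "p \<otimes> q \<ominus> q \<otimes> p = ((p \<ominus> p') \<otimes> q \<ominus> q \<otimes> (p \<ominus> p')) \<oplus>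
      \<ominus> ((q \<ominus> q') \<otimes> p' \<ominus> p' \<otimes> (q \<ominus> q')) \<oplus> (p' \<otimes> q' \<ominus> q' \<otimes> p')"
    using assms(1-4) by algebra
  then show ?thesis using assms(1-4) unfolding commutator_def comm by (simp add: minus_eq r_neg)
qed

text \<open>The factor 4 is 2 from splitting the square of a two-term sum times 2 from
  \<open>finsum_sq_commutator\<close>.\<close>

lemma finsum_sq_commutator_pvm:
  assumes pvm: "pvm A K p" "pvm A K p'" "pvm A K q" "pvm A K q'"
    and comm: "\<And>a b. \<lbrakk>a \<in> K; b \<in> K\<rbrakk> \<Longrightarrow> p' a \<otimes> q' b = q' b \<otimes> p' a"
  shows "(\<Oplus>a\<in>K. \<Oplus>b\<in>K. sq (commutator A (p a) (q b))) \<lesssim>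
    (4::complex) \<odot> (sq_dist K p p' \<oplus> sq_dist K q q')"
proof -
  have c: "p a \<in> carrier A" "q a \<in> carrier A" "p' a \<in> carrier A" "q' a \<in> carrier A"
    "adj (p a) = p a" "adj (q a) = q a" "adj (p' a) = p' a" "adj (q' a) = q' a"
    if "a \<in> K" for a
    using that pvm by (auto dest!: pvmD(2) dest: projectionD)
  have fin: "finite K" using pvm(1) by (rule pvmD)
  have dist: "sq_dist K p p' \<in> carrier A" "sq_dist K q q' \<in> carrier A"
    using sq_dist_nonneg pvm cle_closed by blast+
  let ?P = "\<Oplus>a\<in>K. \<Oplus>b\<in>K. sq (commutator A (p a \<ominus> p' a) (q b))"
  let ?Q = "\<Oplus>a\<in>K. \<Oplus>b\<in>K. sq (commutator A (q b \<ominus> q' b) (p' a))"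
  have PQ: "?P \<in> carrier A" "?Q \<in> carrier A" using c by (auto intro!: finsum_closed)
  have "sq (commutator A (p a) (q b)) \<lesssim> (2::complex) \<odot> (sq (commutator A (p a \<ominus> p' a) (q b))
      \<oplus> sq (commutator A (q b \<ominus> q' b) (p' a)))" if "a \<in> K" "b \<in> K" for a b
  proof -
    let ?u = "commutator A (p a \<ominus> p' a) (q b)" and ?v = "commutator A (q b \<ominus> q' b) (p' a)"
    have "commutator A (p a) (q b) = ?u \<oplus> \<ominus> ?v"
      by (rule commutator_split) (use c that comm in auto)
    then show ?thesis
      using sq_add_le[of ?u "\<ominus> ?v" 1] c that by (simp add: sq_minus scale_add_right)
  qed
  then have "(\<Oplus>a\<in>K. \<Oplus>b\<in>K. sq (commutator A (p a) (q b))) \<lesssim>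
      (\<Oplus>a\<in>K. \<Oplus>b\<in>K. (2::complex) \<odot> (sq (commutator A (p a \<ominus> p' a) (q b))
      \<oplus> sq (commutator A (q b \<ominus> q' b) (p' a))))"
    by (intro cle_finsum)
  also have "\<dots> = (2::complex) \<odot> (?P \<oplus> ?Q)"
  proof -
    have "(\<Oplus>a\<in>K. \<Oplus>b\<in>K. (2::complex) \<odot> (sq (commutator A (p a \<ominus> p' a) (q b))
      \<oplus> sq (commutator A (q b \<ominus> q' b) (p' a)))) =
      (\<Oplus>a\<in>K. (2::complex) \<odot> ((\<Oplus>b\<in>K. sq (commutator A (p a \<ominus> p' a) (q b)))
      \<oplus> (\<Oplus>b\<in>K. sq (commutator A (q b \<ominus> q' b) (p' a)))))"
      by (rule finsum_cong')
        (use c in \<open>simp_all add: scale_finsum[symmetric] Pi_iff\<close>)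
    also have "\<dots> = (2::complex) \<odot> (?P \<oplus> ?Q)"
      using c by (simp add: scale_finsum[symmetric] Pi_iff)
    finally show ?thesis .
  qed
  also have "\<dots> \<lesssim> (2::complex) \<odot>
      ((2::complex) \<odot> sq_dist K p p' \<oplus> (2::complex) \<odot> sq_dist K q q')"
  proof -
    have "?P \<lesssim> (\<Oplus>a\<in>K. (2::complex) \<odot> sq (p a \<ominus> p' a))"
      by (intro cle_finsum) (use finsum_sq_commutator[OF pvm(3)] c in \<open>simp add: scale_two adj_diff\<close>)
    also have "\<dots> = (2::complex) \<odot> sq_dist K p p'"
      unfolding sq_dist_def by (rule scale_finsum[symmetric]) (use c in auto)
    finally have P: "?P \<lesssim> (2::complex) \<odot> sq_dist K p p'" .
    \<comment> \<open>In this half the complete measurement is \<open>p'\<close>, indexed by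
      \<open>a\<close>, so its sum has to become the inner one.\<close>
    have "?Q = (\<Oplus>b\<in>K. \<Oplus>a\<in>K. sq (commutator A (q b \<ominus> q' b) (p' a)))"
      by (rule finsum_swap) (use c fin in auto)
    also have "\<dots> \<lesssim> (\<Oplus>a\<in>K. (2::complex) \<odot> sq (q a \<ominus> q' a))"
      by (intro cle_finsum) (use finsum_sq_commutator[OF pvm(2)] c in \<open>simp add: scale_two adj_diff\<close>)
    also have "\<dots> = (2::complex) \<odot> sq_dist K q q'"
      unfolding sq_dist_def by (rule scale_finsum[symmetric]) (use c in auto)
    finally have Q: "?Q \<lesssim> (2::complex) \<odot> sq_dist K q q'" .
    show ?thesis using cle_scale[OF cle_add[OF P Q], of 2] by simp
  qed
  also have "\<dots> = (4::complex) \<odot> (sq_dist K p p' \<oplus> sq_dist K q q')"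
    using dist by (simp flip: scale_add_right scale_mult)
  finally show ?thesis .
qed

end

section \<open>Ordered products of measurements along a list of variables\<close>

text \<open>Abstracts \<open>assignment_proj\<close> from unitaries to arbitrary measurements and
  from a set to a list. The same lemmas then apply to \<open>p\<close> and \<open>q\<close>, by
  induction over the list.\<close>

definition ordered_prod ::
    "('a, 'c) star_algebra_scheme \<Rightarrow> ('v \<Rightarrow> 'i \<Rightarrow> 'a) \<Rightarrow> 'v list \<Rightarrow> ('v \<Rightarrow> 'i) \<Rightarrow> 'a" where
  "ordered_prod A p xs \<phi> = foldr (\<lambda>x r. p x (\<phi> x) \<otimes>\<^bsub>A\<^esub> r) xs \<one>\<^bsub>A\<^esub>"

lemma ordered_prod_simps [simp]:
  "ordered_prod A p [] \<phi> = \<one>\<^bsub>A\<^esub>"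
  "ordered_prod A p (x # xs) \<phi> = p x (\<phi> x) \<otimes>\<^bsub>A\<^esub> ordered_prod A p xs \<phi>"
  by (simp_all add: ordered_prod_def)

lemma ordered_prod_upd [simp]:
  "x \<notin> set xs \<Longrightarrow> ordered_prod A p xs (\<phi>(x := a)) = ordered_prod A p xs \<phi>"
  by (induction xs) auto

context star_ring
begin

lemma ordered_prod_closed:
  "\<lbrakk>\<phi> \<in> V \<rightarrow>\<^sub>E K; set xs \<subseteq> V; \<And>x. x \<in> set xs \<Longrightarrow> pvm A K (p x)\<rbrakk> \<Longrightarrow> ordered_prod A p xs \<phi> \<in> carrier A"
  by (induction xs) (auto dest!: pvmD(3))

lemma ordered_prod_commute:
  assumes "\<phi> \<in> V \<rightarrow>\<^sub>E K" "set xs \<subseteq> V" "\<And>x. x \<in> set xs \<Longrightarrow> pvm A K (p x)"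
    and y: "y \<in> carrier A" "\<And>x a. x \<in> set xs \<Longrightarrow> a \<in> K \<Longrightarrow> y \<otimes> p x a = p x a \<otimes> y"
  shows "y \<otimes> ordered_prod A p xs \<phi> = ordered_prod A p xs \<phi> \<otimes> y"
  using assms(2,3) y(2)
proof (induction xs)
  case (Cons x xs)
  have c: "p x (\<phi> x) \<in> carrier A" "ordered_prod A p xs \<phi> \<in> carrier A"
    using Cons.prems assms(1) ordered_prod_closed[OF assms(1), of xs p]
    by (auto intro: pvmD(3)[of K])
  have "\<phi> x \<in> K" using Cons.prems(1) assms(1) by auto
  then have "y \<otimes> p x (\<phi> x) = p x (\<phi> x) \<otimes> y" using Cons.prems(3) by simp
  then have "y \<otimes> (p x (\<phi> x) \<otimes> ordered_prod A p xs \<phi>) = p x (\<phi> x) \<otimes> (y \<otimes> ordered_prod A p xs \<phi>)"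
    using c y(1) by (simp flip: m_assoc)
  also have "y \<otimes> ordered_prod A p xs \<phi> = ordered_prod A p xs \<phi> \<otimes> y"
    using Cons by auto
  finally show ?case using c y(1) by (simp add: m_assoc)
qed (use y(1) in auto)

text \<open>The first variable contributes the leftmost factor. After the sums are exchanged,
  summing over its value removes that factor exactly, and the rest is the induction
  hypothesis.\<close>

lemma finsum_sq_ordered_prod_left:
  assumes "distinct xs" "\<And>x. x \<in> set xs \<Longrightarrow> pvm A K (p x)" "finite K" "h \<in> carrier A"
  shows "(\<Oplus>\<phi>\<in>set xs \<rightarrow>\<^sub>E K. sq (ordered_prod A p xs \<phi> \<otimes> h)) = sq h"
  using assms(1,2)
proof (induction xs)
  case Nil
  then show ?case using assms(4) by (simp add: finsum_singleton)
next
  case (Cons x xs)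
  note c = ordered_prod_closed[of _ _ K _ p]
  have px: "a \<in> K \<Longrightarrow> p x a \<in> carrier A" for a using Cons.prems by (auto intro: pvmD(3)[of K])
  have cl: "ordered_prod A p xs \<phi> \<in> carrier A" if "\<phi> \<in> set xs \<rightarrow>\<^sub>E K" for \<phi>
    using that Cons.prems by (intro c) auto
  have "(\<Oplus>\<phi>\<in>set (x # xs) \<rightarrow>\<^sub>E K. sq (ordered_prod A p (x # xs) \<phi> \<otimes> h)) =
      (\<Oplus>a\<in>K. \<Oplus>\<phi>\<in>set xs \<rightarrow>\<^sub>E K. sq (ordered_prod A p (x # xs) (\<phi>(x := a)) \<otimes> h))"
    unfolding list.set
  proof (rule finsum_PiE_insert)
    fix \<phi> assume "\<phi> \<in> insert x (set xs) \<rightarrow>\<^sub>E K"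
    then have "ordered_prod A p (x # xs) \<phi> \<in> carrier A"
      using Cons.prems(2) by (intro c) auto
    then show "sq (ordered_prod A p (x # xs) \<phi> \<otimes> h) \<in> carrier A"
      using assms(4) by (intro sq_closed m_closed)
  qed (use Cons.prems assms(3) in auto)
  also have "\<dots> = (\<Oplus>a\<in>K. \<Oplus>\<phi>\<in>set xs \<rightarrow>\<^sub>E K. sq (p x a \<otimes> (ordered_prod A p xs \<phi> \<otimes> h)))"
    using Cons.prems px cl assms(4)
    by (intro finsum_cong') (auto simp: m_assoc intro!: finsum_closed)
  also have "\<dots> = (\<Oplus>\<phi>\<in>set xs \<rightarrow>\<^sub>E K. \<Oplus>a\<in>K. sq (p x a \<otimes> (ordered_prod A p xs \<phi> \<otimes> h)))"
    by (rule finsum_swap) (use assms(3,4) px cl in \<open>auto intro!: finite_PiE\<close>)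
  also have "\<dots> = (\<Oplus>\<phi>\<in>set xs \<rightarrow>\<^sub>E K. sq (ordered_prod A p xs \<phi> \<otimes> h))"
    by (rule finsum_cong')
      (use Cons.prems cl assms(4) in \<open>auto intro!: finsum_sq_pvm_left\<close>)
  also have "\<dots> = sq h" using Cons by auto
  finally show ?case .
qed

text \<open>Here the first factor stands next to \<open>h\<close>. The induction therefore
  generalises \<open>h\<close>, which absorbs this factor while the later variables are summed away;
  the factor itself goes last.\<close>

lemma finsum_sq_ordered_prod_right:
  assumes "distinct xs" "\<And>x. x \<in> set xs \<Longrightarrow> pvm A K (p x)" "finite K" "h \<in> carrier A"
  shows "(\<Oplus>\<phi>\<in>set xs \<rightarrow>\<^sub>E K. sq (h \<otimes> ordered_prod A p xs \<phi>)) \<approx> sq h"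
  using assms(1,2,4)
proof (induction xs arbitrary: h)
  case Nil
  then show ?case by (simp add: finsum_singleton)
next
  case (Cons x xs)
  note c = ordered_prod_closed[of _ _ K _ p]
  have px: "a \<in> K \<Longrightarrow> p x a \<in> carrier A" for a using Cons.prems by (auto intro: pvmD(3)[of K])
  have cl: "ordered_prod A p xs \<phi> \<in> carrier A" if "\<phi> \<in> set xs \<rightarrow>\<^sub>E K" for \<phi>
    using that Cons.prems by (intro c) auto
  have "(\<Oplus>\<phi>\<in>set (x # xs) \<rightarrow>\<^sub>E K. sq (h \<otimes> ordered_prod A p (x # xs) \<phi>)) =
      (\<Oplus>a\<in>K. \<Oplus>\<phi>\<in>set xs \<rightarrow>\<^sub>E K. sq (h \<otimes> ordered_prod A p (x # xs) (\<phi>(x := a))))"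
    unfolding list.set
  proof (rule finsum_PiE_insert)
    fix \<phi> assume "\<phi> \<in> insert x (set xs) \<rightarrow>\<^sub>E K"
    then have "ordered_prod A p (x # xs) \<phi> \<in> carrier A"
      using Cons.prems(2) by (intro c) auto
    then show "sq (h \<otimes> ordered_prod A p (x # xs) \<phi>) \<in> carrier A"
      using Cons.prems(3) by (intro sq_closed m_closed)
  qed (use Cons.prems assms(3) in auto)
  also have "\<dots> = (\<Oplus>a\<in>K. \<Oplus>\<phi>\<in>set xs \<rightarrow>\<^sub>E K. sq ((h \<otimes> p x a) \<otimes> ordered_prod A p xs \<phi>))"
    using Cons.prems px cl
    by (intro finsum_cong') (auto simp: m_assoc intro!: finsum_closed)
  also have "\<dots> \<approx> (\<Oplus>a\<in>K. sq (h \<otimes> p x a))"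
    by (rule ceq_finsum, rule Cons.IH) (use Cons.prems px in auto)
  also have "\<dots> \<approx> sq h"
    by (rule finsum_sq_pvm_right) (use Cons.prems in auto)
  finally show ?case .
qed

text \<open>Summing over the values of the variables other than \<open>x\<close> removes their
  factors. Those before \<open>x\<close> are leftmost in turn. At \<open>x\<close>, commutation
  moves \<open>p x a\<close> to the right end, next to \<open>z a\<close>, so that the factors after
  it become leftmost. This turns a sum over assignments into one over the values of a single
  variable.\<close>

lemma finsum_sq_ordered_prod_marginal:
  assumes "distinct xs" "\<And>x. x \<in> set xs \<Longrightarrow> pvm A K (p x)" "finite K"
    and comm: "\<And>x y a b. \<lbrakk>x \<in> set xs; y \<in> set xs; a \<in> K; b \<in> K\<rbrakk> \<Longrightarrow> p x a \<otimes> p y b = p y b \<otimes> p x a"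
    and x: "x \<in> set xs" and z: "\<And>a. a \<in> K \<Longrightarrow> z a \<in> carrier A"
  shows "(\<Oplus>\<phi>\<in>set xs \<rightarrow>\<^sub>E K. sq (ordered_prod A p xs \<phi> \<otimes> z (\<phi> x))) = (\<Oplus>a\<in>K. sq (p x a \<otimes> z a))"
  using assms(1,2) comm x
proof (induction xs)
  case (Cons y xs)
  note c = ordered_prod_closed[of _ _ K _ p]
  have py: "a \<in> K \<Longrightarrow> p y a \<in> carrier A" for a using Cons.prems by (auto intro: pvmD(3)[of K])
  have cl: "ordered_prod A p xs \<phi> \<in> carrier A" if "\<phi> \<in> set xs \<rightarrow>\<^sub>E K" for \<phi>
    using that Cons.prems by (intro c) auto
  have zx: "z (\<phi> x) \<in> carrier A" if "\<phi> \<in> V \<rightarrow>\<^sub>E K" "x \<in> V" for \<phi> V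
    using that by (auto intro: z)
  have "(\<Oplus>\<phi>\<in>set (y # xs) \<rightarrow>\<^sub>E K. sq (ordered_prod A p (y # xs) \<phi> \<otimes> z (\<phi> x))) =
      (\<Oplus>a\<in>K. \<Oplus>\<phi>\<in>set xs \<rightarrow>\<^sub>E K. sq (ordered_prod A p (y # xs) (\<phi>(y := a)) \<otimes> z ((\<phi>(y := a)) x)))"
    unfolding list.set
  proof (rule finsum_PiE_insert)
    fix \<phi> assume \<phi>: "\<phi> \<in> insert y (set xs) \<rightarrow>\<^sub>E K"
    then have "ordered_prod A p (y # xs) \<phi> \<in> carrier A"
      using Cons.prems(2) by (intro c) auto
    then show "sq (ordered_prod A p (y # xs) \<phi> \<otimes> z (\<phi> x)) \<in> carrier A"
      using zx[OF \<phi>] Cons.prems(4) by (intro sq_closed m_closed) auto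
  qed (use Cons.prems assms(3) in auto)
  also have "\<dots> = (\<Oplus>a\<in>K. sq (p x a \<otimes> z a))"
  proof (cases "y = x")
    case True
    have "(\<Oplus>a\<in>K. \<Oplus>\<phi>\<in>set xs \<rightarrow>\<^sub>E K. sq (ordered_prod A p (y # xs) (\<phi>(y := a)) \<otimes> z ((\<phi>(y := a)) x))) =
        (\<Oplus>a\<in>K. \<Oplus>\<phi>\<in>set xs \<rightarrow>\<^sub>E K. sq (ordered_prod A p xs \<phi> \<otimes> (p x a \<otimes> z a)))"
    proof (intro finsum_cong' refl Pi_I finsum_closed sq_closed m_closed)
      fix a \<phi> assume a: "a \<in> K" and \<phi>: "\<phi> \<in> set xs \<rightarrow>\<^sub>E K"
      have "p x a \<otimes> ordered_prod A p xs \<phi> = ordered_prod A p xs \<phi> \<otimes> p x a"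
        by (rule ordered_prod_commute[OF \<phi>]) (use Cons.prems True a py in auto)
      then show "sq (ordered_prod A p (y # xs) (\<phi>(y := a)) \<otimes> z ((\<phi>(y := a)) x)) =
          sq (ordered_prod A p xs \<phi> \<otimes> (p x a \<otimes> z a))"
        using True Cons.prems a py cl[OF \<phi>] z by (simp add: m_assoc)
    qed (use True py cl z in auto)
    also have "\<dots> = (\<Oplus>a\<in>K. sq (p x a \<otimes> z a))"
      by (intro finsum_cong' refl finsum_sq_ordered_prod_left)
        (use Cons.prems assms(3) True py z in auto)
    finally show ?thesis .
  next
    case False
    then have x: "x \<in> set xs" using Cons.prems by auto
    have "(\<Oplus>a\<in>K. \<Oplus>\<phi>\<in>set xs \<rightarrow>\<^sub>E K. sq (ordered_prod A p (y # xs) (\<phi>(y := a)) \<otimes> z ((\<phi>(y := a)) x))) =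
        (\<Oplus>a\<in>K. \<Oplus>\<phi>\<in>set xs \<rightarrow>\<^sub>E K. sq (p y a \<otimes> (ordered_prod A p xs \<phi> \<otimes> z (\<phi> x))))"
      using Cons.prems False py cl zx[OF _ x]
      by (intro finsum_cong' refl Pi_I finsum_closed sq_closed m_closed) (simp_all add: m_assoc)
    also have "\<dots> = (\<Oplus>\<phi>\<in>set xs \<rightarrow>\<^sub>E K. \<Oplus>a\<in>K. sq (p y a \<otimes> (ordered_prod A p xs \<phi> \<otimes> z (\<phi> x))))"
      by (rule finsum_swap) (use assms(3) py cl zx[OF _ x] in \<open>auto intro!: finite_PiE\<close>)
    also have "\<dots> = (\<Oplus>\<phi>\<in>set xs \<rightarrow>\<^sub>E K. sq (ordered_prod A p xs \<phi> \<otimes> z (\<phi> x)))"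
      by (intro finsum_cong' refl finsum_sq_pvm_left Pi_I)
        (use Cons.prems cl zx[OF _ x] in auto)
    also have "\<dots> = (\<Oplus>a\<in>K. sq (p x a \<otimes> z a))"
      by (rule Cons.IH) (use Cons.prems x in auto)
    finally show ?thesis .
  qed
  finally show ?case .
qed simp

lemma finsum_scale_add:
  assumes "f \<in> I \<rightarrow> carrier A" "g \<in> I \<rightarrow> carrier A"
  shows "(\<Oplus>i\<in>I. c \<odot> f i \<oplus> d \<odot> g i) = c \<odot> (\<Oplus>i\<in>I. f i) \<oplus> d \<odot> (\<Oplus>i\<in>I. g i)"
proof -
  have "(\<Oplus>i\<in>I. c \<odot> f i \<oplus> d \<odot> g i) = (\<Oplus>i\<in>I. c \<odot> f i) \<oplus> (\<Oplus>i\<in>I. d \<odot> g i)"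
    by (rule finsum_addf) (use assms in \<open>auto simp: Pi_iff\<close>)
  then show ?thesis using assms by (simp only: scale_finsum)
qed

text \<open>Telescoping one factor at a time; weighting the two parts of step \<open>n\<close> by \<open>1 + 1/(n + 1)\<close> and
  \<open>n + 2\<close> keeps the constant linear in the number of factors.\<close>

lemma finsum_sq_ordered_prod_diff:
  assumes "distinct xs" "\<And>x. x \<in> set xs \<Longrightarrow> pvm A K (p x)" "\<And>x. x \<in> set xs \<Longrightarrow> pvm A K (q x)"
    and "finite K"
  shows "(\<Oplus>\<phi>\<in>set xs \<rightarrow>\<^sub>E K. sq (ordered_prod A q xs \<phi> \<ominus> ordered_prod A p xs \<phi>)) \<lesssim>
    complex_of_real (real (length xs) + 1) \<odot> (\<Oplus>x\<in>set xs. sq_dist K (q x) (p x))"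
  using assms(1-3)
proof (induction xs)
  case Nil
  then show ?case by (simp add: finsum_singleton minus_eq r_neg)
next
  case (Cons x xs)
  let ?F = "set xs \<rightarrow>\<^sub>E K"
  let ?P = "ordered_prod A p xs" and ?Q = "ordered_prod A q xs"
  let ?n = "real (length xs)"
  \<comment> \<open>Chosen so that the induction hypothesis scaled by \<open>1 + s\<close> and the
    new term scaled by \<open>1 + 1 / s\<close> both get the factor \<open>?n + 2\<close>, the
    constant claimed for the longer list.\<close>
  define s where "s = 1 / (?n + 1)"
  have s: "s > 0" "1 + 1 / s = ?n + 2" "(1 + s) * (?n + 1) = ?n + 2"
    by (auto simp: s_def field_simps)
  have px: "p x a \<in> carrier A" "q x a \<in> carrier A" if "a \<in> K" for a
    using that Cons.prems(2,3) by (auto intro: pvmD(3)[of K])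
  have cl: "?P \<phi> \<in> carrier A" "?Q \<phi> \<in> carrier A" if "\<phi> \<in> ?F" for \<phi>
    by (rule ordered_prod_closed[OF that]; use Cons.prems in auto)+
  have fin: "finite ?F" using assms(4) by (auto intro: finite_PiE)
  have dist: "sq_dist K (q y) (p y) \<in> carrier A" if "y \<in> set (x # xs)" for y
    using sq_dist_nonneg[OF Cons.prems(3)[OF that] Cons.prems(2)[OF that]] by (rule cle_closed)
  let ?E = "\<Oplus>\<phi>\<in>?F. sq (?Q \<phi> \<ominus> ?P \<phi>)" and ?D = "\<Oplus>y\<in>set xs. sq_dist K (q y) (p y)"
  have D: "?D \<in> carrier A" using dist by auto
  have "(\<Oplus>\<phi>\<in>set (x # xs) \<rightarrow>\<^sub>E K. sq (ordered_prod A q (x # xs) \<phi> \<ominus> ordered_prod A p (x # xs) \<phi>)) =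
      (\<Oplus>a\<in>K. \<Oplus>\<phi>\<in>?F. sq (ordered_prod A q (x # xs) (\<phi>(x := a)) \<ominus> ordered_prod A p (x # xs) (\<phi>(x := a))))"
    unfolding list.set
  proof (rule finsum_PiE_insert)
    fix \<phi> assume "\<phi> \<in> insert x (set xs) \<rightarrow>\<^sub>E K"
    then have "ordered_prod A p (x # xs) \<phi> \<in> carrier A" "ordered_prod A q (x # xs) \<phi> \<in> carrier A"
      by (rule ordered_prod_closed; use Cons.prems(2,3) in auto)+
    then show "sq (ordered_prod A q (x # xs) \<phi> \<ominus> ordered_prod A p (x # xs) \<phi>) \<in> carrier A"
      by (intro sq_closed minus_closed)
  qed (use Cons.prems assms(4) in auto)
  also have "\<dots> \<lesssim> (\<Oplus>a\<in>K. \<Oplus>\<phi>\<in>?F. complex_of_real (1 + s) \<odot> sq (q x a \<otimes> (?Q \<phi> \<ominus> ?P \<phi>))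
      \<oplus> complex_of_real (?n + 2) \<odot> sq ((q x a \<ominus> p x a) \<otimes> ?P \<phi>))"
  proof (intro cle_finsum)
    fix a \<phi> assume a: "a \<in> K" and \<phi>: "\<phi> \<in> ?F"
    have "ordered_prod A q (x # xs) (\<phi>(x := a)) \<ominus> ordered_prod A p (x # xs) (\<phi>(x := a)) =
        q x a \<otimes> ?Q \<phi> \<ominus> p x a \<otimes> ?P \<phi>"
      using Cons.prems(1) by simp
    \<comment> \<open>With this order of replacement, \<open>q x a\<close> is leftmost in the first
      term and disappears on summing over \<open>a\<close>, while \<open>?P \<phi>\<close> is
      rightmost in the second and disappears on summing over \<open>\<phi>\<close>.\<close>
    also have "\<dots> = q x a \<otimes> (?Q \<phi> \<ominus> ?P \<phi>) \<oplus> (q x a \<ominus> p x a) \<otimes> ?P \<phi>"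
    proof -
      have "u \<otimes> v \<ominus> w \<otimes> z = u \<otimes> (v \<ominus> z) \<oplus> (u \<ominus> w) \<otimes> z"
        if "u \<in> carrier A" "v \<in> carrier A" "w \<in> carrier A" "z \<in> carrier A" for u v w z
        using that by algebra
      then show ?thesis using px[OF a] cl[OF \<phi>] by simp
    qed
    finally have eq: "ordered_prod A q (x # xs) (\<phi>(x := a)) \<ominus> ordered_prod A p (x # xs) (\<phi>(x := a)) =
        q x a \<otimes> (?Q \<phi> \<ominus> ?P \<phi>) \<oplus> (q x a \<ominus> p x a) \<otimes> ?P \<phi>" .
    show "sq (ordered_prod A q (x # xs) (\<phi>(x := a)) \<ominus> ordered_prod A p (x # xs) (\<phi>(x := a))) \<lesssim>
        complex_of_real (1 + s) \<odot> sq (q x a \<otimes> (?Q \<phi> \<ominus> ?P \<phi>))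
        \<oplus> complex_of_real (?n + 2) \<odot> sq ((q x a \<ominus> p x a) \<otimes> ?P \<phi>)"
      unfolding eq using sq_add_le[OF m_closed[OF px(2)[OF a] minus_closed[OF cl(2)[OF \<phi>] cl(1)[OF \<phi>]]]
          m_closed[OF minus_closed[OF px(2)[OF a] px(1)[OF a]] cl(1)[OF \<phi>]] s(1), unfolded s(2)] .
  qed
  also have "\<dots> = complex_of_real (1 + s) \<odot> (\<Oplus>a\<in>K. \<Oplus>\<phi>\<in>?F. sq (q x a \<otimes> (?Q \<phi> \<ominus> ?P \<phi>)))
      \<oplus> complex_of_real (?n + 2) \<odot> (\<Oplus>a\<in>K. \<Oplus>\<phi>\<in>?F. sq ((q x a \<ominus> p x a) \<otimes> ?P \<phi>))"
  proof -
    have f: "sq (q x a \<otimes> (?Q \<phi> \<ominus> ?P \<phi>)) \<in> carrier A"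
      and g: "sq ((q x a \<ominus> p x a) \<otimes> ?P \<phi>) \<in> carrier A" if "a \<in> K" "\<phi> \<in> ?F" for a \<phi>
      using px[OF that(1)] cl[OF that(2)] by auto
    have "(\<Oplus>a\<in>K. \<Oplus>\<phi>\<in>?F. complex_of_real (1 + s) \<odot> sq (q x a \<otimes> (?Q \<phi> \<ominus> ?P \<phi>))
        \<oplus> complex_of_real (?n + 2) \<odot> sq ((q x a \<ominus> p x a) \<otimes> ?P \<phi>)) =
      (\<Oplus>a\<in>K. complex_of_real (1 + s) \<odot> (\<Oplus>\<phi>\<in>?F. sq (q x a \<otimes> (?Q \<phi> \<ominus> ?P \<phi>)))
        \<oplus> complex_of_real (?n + 2) \<odot> (\<Oplus>\<phi>\<in>?F. sq ((q x a \<ominus> p x a) \<otimes> ?P \<phi>)))"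
      using f g by (intro finsum_cong' refl finsum_scale_add) auto
    also have "\<dots> = complex_of_real (1 + s) \<odot> (\<Oplus>a\<in>K. \<Oplus>\<phi>\<in>?F. sq (q x a \<otimes> (?Q \<phi> \<ominus> ?P \<phi>)))
      \<oplus> complex_of_real (?n + 2) \<odot> (\<Oplus>a\<in>K. \<Oplus>\<phi>\<in>?F. sq ((q x a \<ominus> p x a) \<otimes> ?P \<phi>))"
      using f g by (intro finsum_scale_add) auto
    finally show ?thesis .
  qed
  also have "(\<Oplus>a\<in>K. \<Oplus>\<phi>\<in>?F. sq (q x a \<otimes> (?Q \<phi> \<ominus> ?P \<phi>))) =
      (\<Oplus>\<phi>\<in>?F. \<Oplus>a\<in>K. sq (q x a \<otimes> (?Q \<phi> \<ominus> ?P \<phi>)))"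
    by (rule finsum_swap) (use assms(4) fin px cl in auto)
  also have "\<dots> = ?E"
    by (intro finsum_cong' refl finsum_sq_pvm_left Pi_I) (use Cons.prems cl in auto)
  also have "complex_of_real (1 + s) \<odot> ?E \<oplus>
        complex_of_real (?n + 2) \<odot> (\<Oplus>a\<in>K. \<Oplus>\<phi>\<in>?F. sq ((q x a \<ominus> p x a) \<otimes> ?P \<phi>)) \<lesssim>
      complex_of_real (1 + s) \<odot> (complex_of_real (?n + 1) \<odot> ?D) \<oplus>
        complex_of_real (?n + 2) \<odot> sq_dist K (q x) (p x)"
  proof (intro cle_add cle_scale)
    show "?E \<lesssim> complex_of_real (?n + 1) \<odot> ?D" by (rule Cons.IH) (use Cons.prems in auto)
    have "(\<Oplus>a\<in>K. \<Oplus>\<phi>\<in>?F. sq ((q x a \<ominus> p x a) \<otimes> ?P \<phi>)) \<approx> sq_dist K (q x) (p x)"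
      unfolding sq_dist_def
      by (intro ceq_finsum finsum_sq_ordered_prod_right) (use Cons.prems assms(4) px in auto)
    then show "(\<Oplus>a\<in>K. \<Oplus>\<phi>\<in>?F. sq ((q x a \<ominus> p x a) \<otimes> ?P \<phi>)) \<lesssim> sq_dist K (q x) (p x)"
      by (simp add: cyclic_eq_def)
  qed (use s(1) in auto)
  also have "complex_of_real (1 + s) \<odot> (complex_of_real (?n + 1) \<odot> ?D) = complex_of_real (?n + 2) \<odot> ?D"
    by (simp only: scale_mult[OF D, symmetric] of_real_mult[symmetric] s(3))
  also have "\<dots> \<oplus> complex_of_real (?n + 2) \<odot> sq_dist K (q x) (p x) =
      complex_of_real (?n + 2) \<odot> (?D \<oplus> sq_dist K (q x) (p x))"
    using D dist[of x] by (intro scale_add_right[symmetric]) auto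
  also have "?D \<oplus> sq_dist K (q x) (p x) = (\<Oplus>y\<in>set (x # xs). sq_dist K (q y) (p y))"
    using Cons.prems(1) D dist unfolding list.set by (subst finsum_insert) (auto intro: a_comm)
  also have "?n + 2 = real (length (x # xs)) + 1" by simp
  finally show ?case .
qed

text \<open>Division by the length in the constant anticipates the weight of the constraint in the
  target, where each square carries the factor \<open>1 / card (scope S i)\<close>.\<close>

lemma constraint_bound:
  assumes xs: "distinct xs"
    and p: "\<And>x. x \<in> set xs \<Longrightarrow> pvm A K (p x)" and q: "\<And>x. x \<in> set xs \<Longrightarrow> pvm A K (q x)"
    and fin: "finite K"
    and comm: "\<And>x y a b. \<lbrakk>x \<in> set xs; y \<in> set xs; a \<in> K; b \<in> K\<rbrakk> \<Longrightarrow> p x a \<otimes> p y b = p y b \<otimes> p x a"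
    and C: "C \<subseteq> set xs \<rightarrow>\<^sub>E K"
    and zero: "\<And>\<phi>. \<phi> \<in> (set xs \<rightarrow>\<^sub>E K) - C \<Longrightarrow> ordered_prod A p xs \<phi> = \<zero>"
    and L: "real (length xs) \<le> L"
  shows "(\<Oplus>\<phi>\<in>(set xs \<rightarrow>\<^sub>E K) - C. sq (ordered_prod A q xs \<phi>)) \<oplus>
      (\<Oplus>x\<in>set xs. \<Oplus>y\<in>set xs. \<Oplus>a\<in>K. \<Oplus>b\<in>K. sq (commutator A (q x a) (q y b))) \<lesssim>
    complex_of_real (20 * L\<^sup>2 / real (length xs)) \<odot>
      (\<Oplus>x\<in>set xs. \<Oplus>\<phi>\<in>C. sq (ordered_prod A p xs \<phi> \<otimes> (\<one> \<ominus> q x (\<phi> x))))"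
proof -
  let ?All = "set xs \<rightarrow>\<^sub>E K" and ?P = "ordered_prod A p xs" and ?Q = "ordered_prod A q xs"
  let ?n = "real (length xs)"
  let ?\<delta> = "\<lambda>x. sq_dist K (q x) (p x)"
  let ?\<Delta> = "\<Oplus>x\<in>set xs. ?\<delta> x"
  have finA: "finite ?All" using fin by (auto intro: finite_PiE)
  have P: "?P \<phi> \<in> carrier A" and Q: "?Q \<phi> \<in> carrier A" if "\<phi> \<in> ?All" for \<phi>
    by (rule ordered_prod_closed[OF that]; use p q in auto)+
  have \<delta>: "\<zero> \<lesssim> ?\<delta> x" "?\<delta> x \<in> carrier A" if "x \<in> set xs" for x
    using sq_dist_nonneg[OF q[OF that] p[OF that]] cle_closed(2) by blast+
  have \<Delta>: "\<zero> \<lesssim> ?\<Delta>" by (rule cle_finsum_nonneg) (rule \<delta>(1))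
  have \<Delta>c: "?\<Delta> \<in> carrier A" using \<Delta> by (rule cle_closed)
  have qc: "q x a \<in> carrier A" "p x a \<in> carrier A" if "x \<in> set xs" "a \<in> K" for x a
    using pvmD(3)[OF q] pvmD(3)[OF p] that by auto
  \<comment> \<open>Outside \<open>C\<close> the product of the \<open>p\<close> is zero and can be
    subtracted for free. The sum of differences is then enlarged to all assignments, where
    telescoping has complete sums to collapse.\<close>
  have "(\<Oplus>\<phi>\<in>?All - C. sq (?Q \<phi>)) = (\<Oplus>\<phi>\<in>?All - C. sq (?Q \<phi> \<ominus> ?P \<phi>))"
    by (rule finsum_cong') (use P Q zero in \<open>auto simp: minus_eq\<close>)
  also have "\<dots> \<lesssim> (\<Oplus>\<phi>\<in>?All. sq (?Q \<phi> \<ominus> ?P \<phi>))"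
    by (rule cle_finsum_subset[OF finA]) (use P Q in \<open>auto intro!: zero_cle_sq\<close>)
  also have "\<dots> \<lesssim> complex_of_real (?n + 1) \<odot> ?\<Delta>"
    by (rule finsum_sq_ordered_prod_diff[OF xs p q fin])
  finally have 1: "(\<Oplus>\<phi>\<in>?All - C. sq (?Q \<phi>)) \<lesssim> complex_of_real (?n + 1) \<odot> ?\<Delta>" .
  have const: "(\<Oplus>x\<in>set xs. c) = complex_of_real ?n \<odot> c" if "c \<in> carrier A" for c
    using xs
  proof (induction xs)
    case (Cons y ys)
    then show ?case using that scale_add_left[OF that, of 1 "complex_of_real (real (length ys))"] by simp
  qed (use that in simp)
  have "(\<Oplus>x\<in>set xs. \<Oplus>y\<in>set xs. \<Oplus>a\<in>K. \<Oplus>b\<in>K. sq (commutator A (q x a) (q y b))) \<lesssim>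
      (\<Oplus>x\<in>set xs. \<Oplus>y\<in>set xs. (4::complex) \<odot> (?\<delta> x \<oplus> ?\<delta> y))"
    by (intro cle_finsum finsum_sq_commutator_pvm) (use p q comm in auto)
  also have "\<dots> = (\<Oplus>x\<in>set xs. (4::complex) \<odot> (complex_of_real ?n \<odot> ?\<delta> x \<oplus> ?\<Delta>))"
    by (rule finsum_cong') (use \<delta>(2) \<Delta>c in \<open>simp_all add: scale_finsum[symmetric] const Pi_iff\<close>)
  also have "\<dots> = (4::complex) \<odot> (complex_of_real ?n \<odot> ?\<Delta> \<oplus> complex_of_real ?n \<odot> ?\<Delta>)"
    using \<delta>(2) \<Delta>c by (simp add: scale_finsum[symmetric] const Pi_iff)
  also have "\<dots> = complex_of_real (8 * ?n) \<odot> ?\<Delta>"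
    using \<Delta>c by (simp flip: scale_add_left scale_mult)
  finally have 2: "(\<Oplus>x\<in>set xs. \<Oplus>y\<in>set xs. \<Oplus>a\<in>K. \<Oplus>b\<in>K. sq (commutator A (q x a) (q y b))) \<lesssim>
    complex_of_real (8 * ?n) \<odot> ?\<Delta>" .
  let ?Y = "\<lambda>x. \<Oplus>\<phi>\<in>C. sq (?P \<phi> \<otimes> (\<one> \<ominus> q x (\<phi> x)))"
  have Yt: "?P \<phi> \<otimes> (\<one> \<ominus> q x (\<phi> x)) \<in> carrier A" if "x \<in> set xs" "\<phi> \<in> ?All" for x \<phi>
    using P[OF that(2)] qc(1)[OF that(1), of "\<phi> x"] that by (auto dest: PiE_mem)
  have Yc: "?Y x \<in> carrier A" if "x \<in> set xs" for x
    using Yt[OF that] C by (intro finsum_closed) auto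
  have Y: "(2::complex) \<odot> ?Y x \<approx> ?\<delta> x" if x: "x \<in> set xs" for x
  proof -
    \<comment> \<open>The terms outside \<open>C\<close> vanish as well, so the sum extends to all
      assignments, as the marginal computation requires.\<close>
    have "?Y x = (\<Oplus>\<phi>\<in>?All. sq (?P \<phi> \<otimes> (\<one> \<ominus> q x (\<phi> x))))"
    proof (rule add.finprod_mono_neutral_cong_left[OF finA C])
      show "sq (?P \<phi> \<otimes> (\<one> \<ominus> q x (\<phi> x))) = \<zero>" if "\<phi> \<in> ?All - C" for \<phi>
        using zero[OF that] qc(1)[OF x, of "\<phi> x"] x that by (auto dest: PiE_mem)
    qed (use Yt x in auto)
    also have "\<dots> = (\<Oplus>a\<in>K. sq (p x a \<otimes> (\<one> \<ominus> q x a)))"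
      by (rule finsum_sq_ordered_prod_marginal[OF xs p fin comm x]) (use qc x in auto)
    finally show ?thesis
      using finsum_sq_mult_complement[OF p[OF x] q[OF x]] sq_dist_commute[OF p[OF x] q[OF x]] by simp
  qed
  let ?YY = "\<Oplus>x\<in>set xs. ?Y x"
  have YY: "?YY \<in> carrier A" using Yc by auto
  have "(\<Oplus>x\<in>set xs. (2::complex) \<odot> ?Y x) \<approx> ?\<Delta>" using Y by (rule ceq_finsum)
  then have 3: "?\<Delta> \<lesssim> (2::complex) \<odot> ?YY"
    using scale_finsum[of ?Y "set xs" 2] Yc by (simp add: Pi_iff cyclic_eq_def)
  have "(\<Oplus>\<phi>\<in>?All - C. sq (?Q \<phi>)) \<oplus>
      (\<Oplus>x\<in>set xs. \<Oplus>y\<in>set xs. \<Oplus>a\<in>K. \<Oplus>b\<in>K. sq (commutator A (q x a) (q y b))) \<lesssim>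
    complex_of_real (?n + 1) \<odot> ?\<Delta> \<oplus> complex_of_real (8 * ?n) \<odot> ?\<Delta>"
    by (rule cle_add[OF 1 2])
  also have "\<dots> = complex_of_real (9 * ?n + 1) \<odot> ?\<Delta>"
    using \<Delta>c by (simp flip: scale_add_left)
  also have "\<dots> \<lesssim> complex_of_real (10 * L\<^sup>2 / ?n) \<odot> ?\<Delta>"
  \<comment> \<open>For the empty list \<open>?\<Delta>\<close> is an empty sum, so both sides are
    zero and the value of the division by zero does not matter.\<close>
  proof (cases "xs = []")
    case False
    then have n: "?n \<ge> 1" by (cases xs) auto
    have "(9 * ?n + 1) * ?n \<le> 10 * (?n * ?n)" using mult_right_mono[OF n, of ?n] by (simp add: distrib_right)
    also have "\<dots> \<le> 10 * L\<^sup>2" using L n by (simp add: power2_eq_square mult_mono)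
    finally have "9 * ?n + 1 \<le> 10 * L\<^sup>2 / ?n"
      by (subst pos_le_divide_eq) (use n in linarith)
    then show ?thesis by (rule cle_scale_mono[OF \<Delta>])
  qed simp
  also have "\<dots> \<lesssim> complex_of_real (10 * L\<^sup>2 / ?n) \<odot> ((2::complex) \<odot> ?YY)"
    by (rule cle_scale[OF 3]) auto
  also have "\<dots> = complex_of_real (20 * L\<^sup>2 / ?n) \<odot> ?YY"
    by (simp only: scale_mult[OF YY, symmetric]) simp
  finally show ?thesis .
qed

end

subsection \<open>Spectral projections\<close>

text \<open>The defining relations of a generator as a property of an element; *-homomorphisms
  preserve it, which carries it from the presentations into the free product.\<close>

definition order_unitary :: "('a, 'c) star_algebra_scheme \<Rightarrow> nat \<Rightarrow> 'a \<Rightarrow> bool" where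
  "order_unitary A k u \<longleftrightarrow> u \<in> carrier A \<and> adj\<^bsub>A\<^esub> u \<otimes>\<^bsub>A\<^esub> u = \<one>\<^bsub>A\<^esub> \<and>
    u \<otimes>\<^bsub>A\<^esub> adj\<^bsub>A\<^esub> u = \<one>\<^bsub>A\<^esub> \<and> u [^]\<^bsub>A\<^esub> k = \<one>\<^bsub>A\<^esub>"

lemma (in star_ring_hom) order_unitary_hom:
  assumes "order_unitary A k u" shows "order_unitary B k (h u)"
proof -
  have u: "u \<in> carrier A" using assms by (simp add: order_unitary_def)
  have "adj\<^bsub>B\<^esub> (h u) \<otimes>\<^bsub>B\<^esub> h u = h (adj\<^bsub>A\<^esub> u \<otimes>\<^bsub>A\<^esub> u)"
    "h u \<otimes>\<^bsub>B\<^esub> adj\<^bsub>B\<^esub> (h u) = h (u \<otimes>\<^bsub>A\<^esub> adj\<^bsub>A\<^esub> u)"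
    "h u [^]\<^bsub>B\<^esub> k = h (u [^]\<^bsub>A\<^esub> k)"
    using u by (simp_all add: hom_adj hom_nat_pow)
  then show ?thesis using assms by (simp add: order_unitary_def)
qed

lemma root_of_unity_power: "root_of_unity k ^ n = cis (2 * pi * real n / real k)"
proof -
  have "root_of_unity k = cis (2 * pi / real k)"
    by (simp add: root_of_unity_def cis_conv_exp mult_ac)
  then show ?thesis by (simp add: DeMoivre mult_ac)
qed

lemma root_of_unity_neq_1: "\<lbrakk>0 < n; n < k\<rbrakk> \<Longrightarrow> root_of_unity k ^ n \<noteq> 1"
  using bij_betw_roots_unity[of k] inj_onD[of "\<lambda>j. cis (2 * pi * real j / real k)" "{..<k}" n 0]
  by (auto simp: root_of_unity_power bij_betw_def)

lemma root_of_unity_order: "k > 0 \<Longrightarrow> root_of_unity k ^ k = 1"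
  by (simp add: root_of_unity_power)

lemma cnj_root_of_unity: "cnj (root_of_unity k) * root_of_unity k = 1"
  using root_of_unity_power[of k 1] by (simp add: cis_cnj cis_mult)

lemma root_of_unity_powi: "root_of_unity k powi (- int m) = inverse (root_of_unity k) ^ m"
  by (simp add: power_int_minus power_inverse)

text \<open>Orthogonality of characters: for \<open>n\<close> between 0 and \<open>k\<close> the sum
  is geometric, with a ratio different from 1 whose \<open>k\<close>-th power is 1.\<close>

lemma sum_root_of_unity_powers:
  assumes "n < k"
  shows "(\<Sum>a<k. root_of_unity k powi (- int (n * a))) = (if n = 0 then of_nat k else 0)"
proof (cases "n = 0")
  case False
  let ?z = "inverse (root_of_unity k ^ n)"
  have "?z \<noteq> 1" using root_of_unity_neq_1[of n k] assms False by simp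
  moreover have "root_of_unity k powi (- int (n * a)) = ?z ^ a" for a
    by (simp only: root_of_unity_powi power_mult power_inverse)
  moreover have "?z ^ k = 1"
    using root_of_unity_order[of k] assms
    by (simp add: power_inverse power_commuting_commutes flip: power_mult)
      (simp add: mult.commute[of n] power_mult)
  ultimately show ?thesis using False by (simp add: geometric_sum)
qed simp

context star_ring
begin

lemma finsum_const: "finite I \<Longrightarrow> c \<in> carrier A \<Longrightarrow> (\<Oplus>i\<in>I. c) = (of_nat (card I) :: complex) \<odot> c"
  by (induction I rule: finite_induct) (simp_all add: scale_add_left)

lemma scale_sum_left:
  "finite I \<Longrightarrow> c \<in> carrier A \<Longrightarrow> (\<Oplus>i\<in>I. f i \<odot> c) = (\<Sum>i\<in>I. f i) \<odot> c"
  by (induction I rule: finite_induct) (simp_all add: scale_add_left Pi_iff)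

lemma scale_nat_pow: "u \<in> carrier A \<Longrightarrow> (c \<odot> u) [^] (n::nat) = c ^ n \<odot> u [^] n"
  by (induction n) (simp_all add: scale_mult_left scale_mult_right mult.commute flip: scale_mult)

lemma adj_nat_pow_absorb:
  "\<lbrakk>w \<in> carrier A; x \<in> carrier A; adj w \<otimes> x = x\<rbrakk> \<Longrightarrow> adj (w [^] (n::nat)) \<otimes> x = x"
proof (induction n)
  case (Suc n)
  then have "adj (w [^] Suc n) \<otimes> x = adj w \<otimes> (adj (w [^] n) \<otimes> x)"
    by (simp add: adj_mult m_assoc)
  then show ?case using Suc by simp
qed simp

text \<open>Shifting exponents gives \<open>w \<otimes> P = P\<close>, and unitarity turns this into
  \<open>adj w \<otimes> P = P\<close>. Averaging over the powers yields
  \<open>adj P \<otimes> P = P\<close>. The left side is self-adjoint, so \<open>P\<close> is too,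
  and then it is idempotent.\<close>

lemma projection_average:
  assumes w: "order_unitary A k w" and k: "k > 0"
  shows "projection A ((1 / of_nat k) \<odot> (\<Oplus>n\<in>{..<k}. w [^] n))"
proof -
  have wc: "w \<in> carrier A" "adj w \<otimes> w = \<one>" "w [^] k = \<one>" using w by (auto simp: order_unitary_def)
  let ?S = "\<Oplus>n\<in>{..<k}. w [^] n"
  define P where "P = (1 / complex_of_nat k) \<odot> ?S"
  have S: "?S \<in> carrier A" using wc by auto
  have P: "P \<in> carrier A" unfolding P_def using S by auto
  have "w \<otimes> ?S = (\<Oplus>n\<in>{..<k}. w \<otimes> w [^] n)"
    by (rule finsum_rdistr) (use wc in auto)
  also have "\<dots> = (\<Oplus>n\<in>{..<k}. w [^] Suc n)"
    by (rule finsum_cong') (use wc in \<open>auto simp: nat_pow_comm[of w 1, simplified]\<close>)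
  also have "\<dots> = (\<Oplus>n\<in>Suc ` {..<k}. w [^] n)"
    by (rule finsum_reindex[symmetric]) (use wc in auto)
  \<comment> \<open>The shift moves only the exponent 0, to \<open>k\<close>; there the power is
    one, so it may be counted as exponent 0 again.\<close>
  also have "Suc ` {..<k} = insert k {1..<k}"
    using k by (auto simp: image_Suc_lessThan)
  also have "(\<Oplus>n\<in>insert k {1..<k}. w [^] n) = w [^] (0::nat) \<oplus> (\<Oplus>n\<in>{1..<k}. w [^] n)"
    using wc by (subst finsum_insert) auto
  also have "\<dots> = (\<Oplus>n\<in>insert 0 {1..<k}. w [^] n)"
    using wc by (subst finsum_insert) auto
  also have "insert 0 {1..<k} = {..<k}" using k by auto
  finally have "w \<otimes> P = P" using S wc by (simp add: P_def scale_mult_right)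
  then have "adj w \<otimes> (w \<otimes> P) = adj w \<otimes> P" by simp
  then have "adj w \<otimes> P = P" using wc P by (simp flip: m_assoc)
  then have absorb: "adj (w [^] n) \<otimes> P = P" for n :: nat
    using adj_nat_pow_absorb wc P by blast
  have "adj P = (1 / of_nat k) \<odot> (\<Oplus>n\<in>{..<k}. adj (w [^] n))"
    using wc S by (simp add: P_def adj_scale adj_finsum)
  then have "adj P \<otimes> P = (1 / of_nat k) \<odot> ((\<Oplus>n\<in>{..<k}. adj (w [^] n)) \<otimes> P)"
    using wc P by (simp add: scale_mult_left)
  also have "(\<Oplus>n\<in>{..<k}. adj (w [^] n)) \<otimes> P = (\<Oplus>n\<in>{..<k}. P)"
    using wc P by (simp add: finsum_ldistr absorb)
  also have "(1 / of_nat k) \<odot> \<dots> = P"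
    using P k by (simp add: finsum_const flip: scale_mult)
  finally have PP: "adj P \<otimes> P = P" .
  have "adj (adj P \<otimes> P) = adj P \<otimes> P" using P by (simp add: adj_mult adj_adj)
  then have "adj P = P" unfolding PP .
  then show ?thesis using P PP unfolding P_def[symmetric] projection_def by simp
qed

text \<open>The coefficients turn into powers of \<open>?z \<odot> u\<close>, where
  \<open>?z\<close> is a \<open>k\<close>-th root of unity of modulus one. This element is again a
  unitary of order dividing \<open>k\<close>, so the spectral projection is an average as in
  \<open>projection_average\<close>.\<close>

lemma projection_spectral_proj:
  assumes u: "order_unitary A k u" and k: "k > 0"
  shows "projection A (spectral_proj A k u a)"
proof -
  let ?z = "inverse (root_of_unity k) ^ a"
  have uc: "u \<in> carrier A" "adj u \<otimes> u = \<one>" "u \<otimes> adj u = \<one>" "u [^] k = \<one>"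
    using u by (auto simp: order_unitary_def)
  have "cnj ?z * ?z = inverse (cnj (root_of_unity k) * root_of_unity k) ^ a"
    by (simp add: power_mult_distrib)
  then have z: "cnj ?z * ?z = 1" by (simp add: cnj_root_of_unity)
  have "?z ^ k = inverse ((root_of_unity k ^ k) ^ a)"
    by (simp add: power_inverse mult.commute flip: power_mult)
  then have zk: "?z ^ k = 1" using root_of_unity_order[OF k] by simp
  have "adj (?z \<odot> u) \<otimes> (?z \<odot> u) = (cnj ?z * ?z) \<odot> (adj u \<otimes> u)"
    "(?z \<odot> u) \<otimes> adj (?z \<odot> u) = (cnj ?z * ?z) \<odot> (u \<otimes> adj u)"
    using uc(1) by (simp_all add: adj_scale scale_mult_left scale_mult_right mult.commute flip: scale_mult)
  then have "order_unitary A k (?z \<odot> u)"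
    using uc z zk by (simp add: order_unitary_def scale_nat_pow)
  then have "projection A ((1 / of_nat k) \<odot> (\<Oplus>n\<in>{..<k}. (?z \<odot> u) [^] n))"
    using k by (rule projection_average)
  moreover have "(\<Oplus>n\<in>{..<k}. (?z \<odot> u) [^] n) =
      (\<Oplus>n\<in>{..<k}. (root_of_unity k powi (- int (n * a))) \<odot> u [^] n)"
    by (rule finsum_cong')
      (use uc in \<open>simp_all add: scale_nat_pow root_of_unity_powi mult.commute del: of_nat_mult flip: power_mult\<close>)
  ultimately show ?thesis by (simp add: spectral_proj_def)
qed

text \<open>For completeness the sums over outcomes and exponents are exchanged; the character sums
  leave only the exponent 0, with coefficient \<open>k\<close> that cancels the
  normalisation.\<close>

lemma pvm_spectral_proj:
  assumes u: "order_unitary A k u" and k: "k > 0"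
  shows "pvm A {..<k} (spectral_proj A k u)"
proof -
  have uc: "u \<in> carrier A" using u by (auto simp: order_unitary_def)
  let ?c = "\<lambda>n a. root_of_unity k powi (- int (n * a))"
  have "(\<Oplus>a\<in>{..<k}. spectral_proj A k u a) =
      (1 / of_nat k) \<odot> (\<Oplus>a\<in>{..<k}. \<Oplus>n\<in>{..<k}. ?c n a \<odot> u [^] n)"
    unfolding spectral_proj_def by (rule scale_finsum[symmetric]) (use uc in auto)
  also have "(\<Oplus>a\<in>{..<k}. \<Oplus>n\<in>{..<k}. ?c n a \<odot> u [^] n) = (\<Oplus>n\<in>{..<k}. \<Oplus>a\<in>{..<k}. ?c n a \<odot> u [^] n)"
    by (rule finsum_swap) (use uc in auto)
  also have "\<dots> = (\<Oplus>n\<in>{..<k}. if 0 = n then of_nat k \<odot> \<one> else \<zero>)"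
    by (rule finsum_cong') (use uc in \<open>auto simp: scale_sum_left sum_root_of_unity_powers simp del: of_nat_mult\<close>)
  also have "\<dots> = of_nat k \<odot> \<one>"
    by (rule finsum_singleton) (use k in auto)
  finally have "(\<Oplus>a\<in>{..<k}. spectral_proj A k u a) = \<one>"
    using k by (simp flip: scale_mult)
  then show ?thesis using projection_spectral_proj[OF u k] by (simp add: pvm_def)
qed

lemma finsum_commute:
  assumes "finite I" "f \<in> I \<rightarrow> carrier A" "y \<in> carrier A" "\<And>i. i \<in> I \<Longrightarrow> f i \<otimes> y = y \<otimes> f i"
  shows "(\<Oplus>i\<in>I. f i) \<otimes> y = y \<otimes> (\<Oplus>i\<in>I. f i)"
  using assms by (auto simp: finsum_ldistr finsum_rdistr Pi_iff intro!: finsum_cong')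

lemma spectral_proj_commute_left:
  assumes "u \<in> carrier A" "v \<in> carrier A" "u \<otimes> v = v \<otimes> u"
  shows "spectral_proj A k u a \<otimes> v = v \<otimes> spectral_proj A k u a"
proof -
  have "(\<Oplus>n\<in>{..<k}. c n \<odot> u [^] n) \<otimes> v = v \<otimes> (\<Oplus>n\<in>{..<k}. c n \<odot> u [^] n)" for c
    by (rule finsum_commute)
      (use assms in \<open>auto simp: scale_mult_left scale_mult_right group_commutes_pow\<close>)
  then show ?thesis
    using assms unfolding spectral_proj_def by (simp add: scale_mult_left scale_mult_right)
qed

lemma spectral_proj_commute:
  assumes "u \<in> carrier A" "v \<in> carrier A" "u \<otimes> v = v \<otimes> u"
  shows "spectral_proj A k u a \<otimes> spectral_proj A k v b = spectral_proj A k v b \<otimes> spectral_proj A k u a"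
  using assms spectral_proj_commute_left[of v u k b]
  by (intro spectral_proj_commute_left) auto

end

lemma assignment_proj_eq_ordered_prod:
  "assignment_proj A k u V = ordered_prod A (\<lambda>x. spectral_proj A k (u x)) (sorted_list_of_set V)"
  by (simp add: assignment_proj_def ordered_prod_def fun_eq_iff)

subsection \<open>Generators of the presented algebras\<close>

lemma order_relators_closed: "order_relators k X \<subseteq> carrier (free_star_algebra X)"
proof -
  interpret star_ring "free_star_algebra X" by (rule star_ring_free)
  show ?thesis unfolding order_relators_def Let_def using free_gen_closed[of _ X] by auto
qed

lemma comm_relators_closed: "comm_relators X \<subseteq> carrier (free_star_algebra X)"
proof -
  interpret star_ring "free_star_algebra X" by (rule star_ring_free)
  show ?thesis unfolding comm_relators_def using free_gen_closed[of _ X] by auto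
qed

text \<open>\<open>R\<close> may contain further relators, so the lemma covers both the free and the
  abelian algebra.\<close>

lemma order_unitary_presented_gen:
  assumes R: "R \<subseteq> carrier (free_star_algebra X)" and sub: "order_relators k X \<subseteq> R" and x: "x \<in> X"
  shows "order_unitary (presented_algebra X R) k (presented_gen X R x)"
proof -
  let ?F = "free_star_algebra X" and ?P = "presented_algebra X R"
  define h where "h = (\<lambda>p. star_ideal ?F R +>\<^bsub>?F\<^esub> p)"
  interpret star_ring_hom ?F ?P h
    unfolding h_def by (rule star_ring_hom_presented[OF R])
  have g: "free_gen x \<in> carrier ?F" using x by (rule free_gen_closed)
  have rel: "h a = h b" if "a \<in> carrier ?F" "b \<in> carrier ?F" "a \<ominus>\<^bsub>?F\<^esub> b \<in> order_relators k X" for a b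
    unfolding h_def using quotient_relation[OF star_ring_free R that(1,2)] that(3) sub by blast
  have "h (adj\<^bsub>?F\<^esub> (free_gen x) \<otimes>\<^bsub>?F\<^esub> free_gen x) = h \<one>\<^bsub>?F\<^esub>"
    "h (free_gen x \<otimes>\<^bsub>?F\<^esub> adj\<^bsub>?F\<^esub> (free_gen x)) = h \<one>\<^bsub>?F\<^esub>"
    "h (free_gen x [^]\<^bsub>?F\<^esub> k) = h \<one>\<^bsub>?F\<^esub>"
    by (rule rel; use g x in \<open>auto simp: order_relators_def Let_def\<close>)+
  then show ?thesis
    using g unfolding presented_gen_def h_def[symmetric] order_unitary_def
    by (simp add: hom_adj hom_nat_pow)
qed

lemma commute_presented_gen:
  assumes R: "R \<subseteq> carrier (free_star_algebra X)" and sub: "comm_relators X \<subseteq> R" and xy: "x \<in> X" "y \<in> X"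
  shows "presented_gen X R x \<otimes>\<^bsub>presented_algebra X R\<^esub> presented_gen X R y =
    presented_gen X R y \<otimes>\<^bsub>presented_algebra X R\<^esub> presented_gen X R x"
proof -
  let ?F = "free_star_algebra X" and ?P = "presented_algebra X R"
  define h where "h = (\<lambda>p. star_ideal ?F R +>\<^bsub>?F\<^esub> p)"
  interpret star_ring_hom ?F ?P h
    unfolding h_def by (rule star_ring_hom_presented[OF R])
  have g: "free_gen x \<in> carrier ?F" "free_gen y \<in> carrier ?F" using xy by (auto intro: free_gen_closed)
  have "free_gen x \<otimes>\<^bsub>?F\<^esub> free_gen y \<ominus>\<^bsub>?F\<^esub> free_gen y \<otimes>\<^bsub>?F\<^esub> free_gen x \<in> R"
    using sub xy by (auto simp: comm_relators_def commutator_def)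
  then have "h (free_gen x \<otimes>\<^bsub>?F\<^esub> free_gen y) = h (free_gen y \<otimes>\<^bsub>?F\<^esub> free_gen x)"
    unfolding h_def using g by (intro quotient_relation[OF star_ring_free R]) auto
  then show ?thesis
    using g unfolding presented_gen_def by (simp flip: h_def)
qed

subsection \<open>Weighted sums of squares\<close>

context star_ring
begin

text \<open>Passes from a sum over elements of the algebra to a sum over the list, so that it never
  has to be decided which listed elements coincide in the quotient. Adding an index changes the
  weight at one element only.\<close>

lemma finsum_listed_weight:
  assumes "finite J" "finite S" "e \<in> J \<rightarrow> S" "g \<in> S \<rightarrow> carrier A"
  shows "(\<Oplus>a\<in>S. complex_of_real (listed_weight J e w a) \<odot> g a) =
    (\<Oplus>j\<in>J. complex_of_real (w j) \<odot> g (e j))"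
  using assms(1,3)
proof (induction J rule: finite_induct)
  case empty
  then show ?case using assms(4) by (auto simp: listed_weight_def Pi_iff intro!: add.finprod_one_eqI)
next
  case (insert j J)
  have lw: "listed_weight (insert j J) e w a = (if e j = a then w j else 0) + listed_weight J e w a" for a
  proof -
    have "{i \<in> insert j J. e i = a} = (if e j = a then insert j {i \<in> J. e i = a} else {i \<in> J. e i = a})"
      by auto
    then show ?thesis using insert.hyps by (simp add: listed_weight_def)
  qed
  have g: "a \<in> S \<Longrightarrow> g a \<in> carrier A" for a using assms(4) by auto
  have j: "e j \<in> S" using insert.prems by auto
  have "(\<Oplus>a\<in>S. complex_of_real (listed_weight (insert j J) e w a) \<odot> g a) =
      (\<Oplus>a\<in>S. (if e j = a then complex_of_real (w j) \<odot> g a else \<zero>) \<oplus>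
        complex_of_real (listed_weight J e w a) \<odot> g a)"
    by (rule finsum_cong') (use g in \<open>auto simp: lw scale_add_left\<close>)
  also have "\<dots> = (\<Oplus>a\<in>S. if e j = a then complex_of_real (w j) \<odot> g a else \<zero>) \<oplus>
      (\<Oplus>a\<in>S. complex_of_real (listed_weight J e w a) \<odot> g a)"
    by (rule finsum_addf) (use g in auto)
  also have "(\<Oplus>a\<in>S. if e j = a then complex_of_real (w j) \<odot> g a else \<zero>) =
      complex_of_real (w j) \<odot> g (e j)"
    by (rule finsum_singleton) (use g j assms(2) in auto)
  also have "(\<Oplus>a\<in>S. complex_of_real (listed_weight J e w a) \<odot> g a) =
      (\<Oplus>j\<in>J. complex_of_real (w j) \<odot> g (e j))"
    by (rule insert.IH) (use insert.prems in auto)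
  also have "complex_of_real (w j) \<odot> g (e j) \<oplus> \<dots> =
      (\<Oplus>j\<in>insert j J. complex_of_real (w j) \<odot> g (e j))"
    by (rule finsum_insert[symmetric]) (use insert g in auto)
  finally show ?case .
qed

text \<open>The weight of a pair of variables is a sum over the constraints containing both.
  Exchanging the sums regroups the commutator part by constraint, the form in which the two algebras
  can be compared.\<close>

lemma finsum_pairs_by_constraint:
  assumes fin: "finite I" "finite K" "finite X" and V: "\<And>i. i \<in> I \<Longrightarrow> V i \<subseteq> X"
    and T: "\<And>a b x y. \<lbrakk>a \<in> K; b \<in> K; x \<in> X; y \<in> X\<rbrakk> \<Longrightarrow> T a b x y \<in> carrier A"
  shows "finsum A (\<lambda>(a, b, x, y).
      complex_of_real (\<Sum>i\<in>{i \<in> I. x \<in> V i \<and> y \<in> V i}. \<pi> i) \<odot> T a b x y) (K \<times> K \<times> X \<times> X) =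
    (\<Oplus>i\<in>I. complex_of_real (\<pi> i) \<odot> (\<Oplus>x\<in>V i. \<Oplus>y\<in>V i. \<Oplus>a\<in>K. \<Oplus>b\<in>K. T a b x y))"
proof -
  let ?J = "K \<times> K \<times> X \<times> X"
  let ?T = "\<lambda>j. case j of (a, b, x, y) \<Rightarrow> T a b x y"
  let ?in = "\<lambda>i j. case j of (a, b, x, y) \<Rightarrow> x \<in> V i \<and> y \<in> V i"
  have Tj: "?T j \<in> carrier A" if "j \<in> ?J" for j using that T by auto
  have finJ: "finite ?J" using fin by auto
  \<comment> \<open>The filtered sum of weights is spread over all of \<open>I\<close> with zero
    coefficients: the range of \<open>i\<close> then no longer depends on \<open>j\<close>, and the
    sums can be exchanged.\<close>
  have "finsum A (\<lambda>(a, b, x, y).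
      complex_of_real (\<Sum>i\<in>{i \<in> I. x \<in> V i \<and> y \<in> V i}. \<pi> i) \<odot> T a b x y) ?J =
    (\<Oplus>j\<in>?J. \<Oplus>i\<in>I. complex_of_real (if ?in i j then \<pi> i else 0) \<odot> ?T j)"
  proof (rule finsum_cong')
    fix j assume j: "j \<in> ?J"
    obtain a b x y where j': "j = (a, b, x, y)" by (cases j)
    have "(\<Oplus>i\<in>I. complex_of_real (if ?in i j then \<pi> i else 0) \<odot> ?T j) =
        (\<Sum>i\<in>I. complex_of_real (if ?in i j then \<pi> i else 0)) \<odot> ?T j"
      by (rule scale_sum_left[OF fin(1) Tj[OF j]])
    also have "(\<Sum>i\<in>I. complex_of_real (if ?in i j then \<pi> i else 0)) =
        complex_of_real (\<Sum>i\<in>{i \<in> I. x \<in> V i \<and> y \<in> V i}. \<pi> i)"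
      using fin(1) by (simp add: j' sum.inter_filter)
    finally show "(case j of (a, b, x, y) \<Rightarrow>
        complex_of_real (\<Sum>i\<in>{i \<in> I. x \<in> V i \<and> y \<in> V i}. \<pi> i) \<odot> T a b x y) =
      (\<Oplus>i\<in>I. complex_of_real (if ?in i j then \<pi> i else 0) \<odot> ?T j)"
      by (simp add: j')
  qed (use Tj in auto)
  also have "\<dots> = (\<Oplus>i\<in>I. \<Oplus>j\<in>?J. complex_of_real (if ?in i j then \<pi> i else 0) \<odot> ?T j)"
    by (rule finsum_swap[OF finJ fin(1)]) (rule scale_closed[OF Tj])
  also have "\<dots> = (\<Oplus>i\<in>I. complex_of_real (\<pi> i) \<odot> (\<Oplus>x\<in>V i. \<Oplus>y\<in>V i. \<Oplus>a\<in>K. \<Oplus>b\<in>K. T a b x y))"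
  proof (rule finsum_cong'[OF refl])
    fix i assume i: "i \<in> I"
    let ?Ji = "K \<times> K \<times> V i \<times> V i"
    have Vi: "V i \<subseteq> X" "finite (V i)" using V[OF i] fin(3) by (auto intro: finite_subset)
    have Ti: "T a b x y \<in> carrier A" if "a \<in> K" "b \<in> K" "x \<in> V i" "y \<in> V i" for a b x y
      using that Vi by (intro T) auto
    have "(\<Oplus>j\<in>?J. complex_of_real (if ?in i j then \<pi> i else 0) \<odot> ?T j) =
        (\<Oplus>j\<in>?Ji. complex_of_real (\<pi> i) \<odot> ?T j)"
    proof (rule add.finprod_mono_neutral_cong_right)
      show "complex_of_real (if ?in i j then \<pi> i else 0) \<odot> ?T j = \<zero>" if "j \<in> ?J - ?Ji" for j
      proof -
        have "\<not> ?in i j" using that by auto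
        then show ?thesis using Tj[of j] that by simp
      qed
    qed (use finJ Vi Tj in \<open>auto simp: Pi_iff\<close>)
    also have "\<dots> = complex_of_real (\<pi> i) \<odot> (\<Oplus>j\<in>?Ji. ?T j)"
      by (rule scale_finsum[symmetric]) (use Ti in auto)
    \<comment> \<open>The tuples list outcomes before variables; the permutation puts the variables
      outermost.\<close>
    also have "(\<Oplus>j\<in>?Ji. ?T j) = (\<Oplus>j\<in>(\<lambda>(x, y, a, b). (a, b, x, y)) ` (V i \<times> V i \<times> K \<times> K). ?T j)"
      by (rule finsum_cong') (use Ti in \<open>auto simp: image_iff\<close>)
    also have "\<dots> = finsum A (\<lambda>(x, y, a, b). T a b x y) (V i \<times> V i \<times> K \<times> K)"
      by (subst finsum_reindex) (use Ti in \<open>auto simp: inj_on_def split_def intro!: finsum_cong'\<close>)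
    also have "\<dots> = (\<Oplus>x\<in>V i. finsum A (\<lambda>(y, a, b). T a b x y) (V i \<times> K \<times> K))"
      by (rule finsum_Sigma) (use fin Vi Ti in auto)
    also have "\<dots> = (\<Oplus>x\<in>V i. \<Oplus>y\<in>V i. finsum A (\<lambda>(a, b). T a b x y) (K \<times> K))"
      by (intro finsum_cong' refl finsum_Sigma) (use fin Vi Ti in \<open>auto intro!: finsum_closed\<close>)
    also have "\<dots> = (\<Oplus>x\<in>V i. \<Oplus>y\<in>V i. \<Oplus>a\<in>K. \<Oplus>b\<in>K. T a b x y)"
      by (intro finsum_cong' refl finsum_Sigma) (use fin Vi Ti in \<open>auto intro!: finsum_closed\<close>)
    finally show "(\<Oplus>j\<in>?J. complex_of_real (if ?in i j then \<pi> i else 0) \<odot> ?T j) =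
        complex_of_real (\<pi> i) \<odot> (\<Oplus>x\<in>V i. \<Oplus>y\<in>V i. \<Oplus>a\<in>K. \<Oplus>b\<in>K. T a b x y)" .
  next
    show "(\<lambda>i. complex_of_real (\<pi> i) \<odot> (\<Oplus>x\<in>V i. \<Oplus>y\<in>V i. \<Oplus>a\<in>K. \<Oplus>b\<in>K. T a b x y)) \<in> I \<rightarrow> carrier A"
      using V T by (intro Pi_I scale_closed finsum_closed) blast
  qed
  finally show ?thesis .
qed

end

lemma listed_weight_support: "{a. listed_weight J e w a \<noteq> 0} \<subseteq> e ` J"
proof
  fix a assume "a \<in> {a. listed_weight J e w a \<noteq> 0}"
  then have "{j \<in> J. e j = a} \<noteq> {}" by (auto simp: listed_weight_def simp del: Collect_empty_eq)
  then show "a \<in> e ` J" by auto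
qed

lemma listed_weight_nonneg: "(\<And>j. j \<in> J \<Longrightarrow> 0 \<le> w j) \<Longrightarrow> 0 \<le> listed_weight J e w a"
  by (auto simp: listed_weight_def intro: sum_nonneg)

text \<open>The exact support depends on coincidences and on zero weights. Any finite set around it
  gives the same sum, so the set of listed elements can be used.\<close>

lemma weighted_square_sum_superset:
  assumes "star_ring A" "finite S" "{a. \<mu> a \<noteq> 0} \<subseteq> S" "S \<subseteq> carrier A"
  shows "weighted_square_sum (A, \<mu>) = (\<Oplus>\<^bsub>A\<^esub>a\<in>S. complex_of_real (\<mu> a) \<odot>\<^bsub>A\<^esub> (adj\<^bsub>A\<^esub> a \<otimes>\<^bsub>A\<^esub> a))"
proof -
  interpret star_ring A by fact
  show ?thesis
    unfolding weighted_square_sum_def prod.case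
    by (rule add.finprod_mono_neutral_cong_left[OF assms(2,3)]) (use assms(4) in auto)
qed

lemma weighted_listed_weight:
  assumes "star_ring A" "finite J" "e \<in> J \<rightarrow> carrier A" "\<And>j. j \<in> J \<Longrightarrow> 0 \<le> w j"
  shows "weighted_star_algebra (A, listed_weight J e w)"
    and "weighted_square_sum (A, listed_weight J e w) =
      (\<Oplus>\<^bsub>A\<^esub>j\<in>J. complex_of_real (w j) \<odot>\<^bsub>A\<^esub> (adj\<^bsub>A\<^esub> (e j) \<otimes>\<^bsub>A\<^esub> e j))"
proof -
  interpret star_ring A by fact
  have e: "e ` J \<subseteq> carrier A" "finite (e ` J)" using assms by auto
  show "weighted_star_algebra (A, listed_weight J e w)"
    using listed_weight_support[of J e w] e assms(1,4) unfolding weighted_star_algebra_def star_algebra_iff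
    by (auto intro: finite_subset listed_weight_nonneg)
  show "weighted_square_sum (A, listed_weight J e w) =
      (\<Oplus>\<^bsub>A\<^esub>j\<in>J. complex_of_real (w j) \<odot>\<^bsub>A\<^esub> (adj\<^bsub>A\<^esub> (e j) \<otimes>\<^bsub>A\<^esub> e j))"
    unfolding weighted_square_sum_superset[OF assms(1) e(2) listed_weight_support e(1)]
    by (rule finsum_listed_weight) (use assms e in auto)
qed

lemma weighted_add:
  assumes "weighted_star_algebra (A, \<mu>)" "weighted_star_algebra (A, \<nu>)"
  shows "weighted_star_algebra (A, \<lambda>a. \<mu> a + \<nu> a)"
    and "weighted_square_sum (A, \<lambda>a. \<mu> a + \<nu> a) =
      weighted_square_sum (A, \<mu>) \<oplus>\<^bsub>A\<^esub> weighted_square_sum (A, \<nu>)"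
proof -
  have A: "star_ring A" using assms(1) by (simp add: weighted_star_algebra_def star_algebra_iff)
  interpret star_ring A by fact
  let ?S = "{a. \<mu> a \<noteq> 0} \<union> {a. \<nu> a \<noteq> 0}"
  have S: "finite ?S" "?S \<subseteq> carrier A" "{a. \<mu> a + \<nu> a \<noteq> 0} \<subseteq> ?S"
    and nonneg: "0 \<le> \<mu> a" "0 \<le> \<nu> a" for a
    using assms by (auto simp: weighted_star_algebra_def)
  show "weighted_star_algebra (A, \<lambda>a. \<mu> a + \<nu> a)"
    using A S finite_subset[OF S(3,1)] nonneg unfolding weighted_star_algebra_def star_algebra_iff
    by (auto intro: add_nonneg_nonneg)
  have "(\<Oplus>\<^bsub>A\<^esub>a\<in>?S. complex_of_real (\<mu> a + \<nu> a) \<odot>\<^bsub>A\<^esub> (adj\<^bsub>A\<^esub> a \<otimes>\<^bsub>A\<^esub> a)) =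
      (\<Oplus>\<^bsub>A\<^esub>a\<in>?S. complex_of_real (\<mu> a) \<odot>\<^bsub>A\<^esub> (adj\<^bsub>A\<^esub> a \<otimes>\<^bsub>A\<^esub> a) \<oplus>\<^bsub>A\<^esub>
        complex_of_real (\<nu> a) \<odot>\<^bsub>A\<^esub> (adj\<^bsub>A\<^esub> a \<otimes>\<^bsub>A\<^esub> a))"
    by (rule finsum_cong') (use S(2) in \<open>auto simp: scale_add_left\<close>)
  also have "\<dots> = (\<Oplus>\<^bsub>A\<^esub>a\<in>?S. complex_of_real (\<mu> a) \<odot>\<^bsub>A\<^esub> (adj\<^bsub>A\<^esub> a \<otimes>\<^bsub>A\<^esub> a)) \<oplus>\<^bsub>A\<^esub>
      (\<Oplus>\<^bsub>A\<^esub>a\<in>?S. complex_of_real (\<nu> a) \<odot>\<^bsub>A\<^esub> (adj\<^bsub>A\<^esub> a \<otimes>\<^bsub>A\<^esub> a))"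
    by (rule finsum_addf) (use S(2) in auto)
  finally show "weighted_square_sum (A, \<lambda>a. \<mu> a + \<nu> a) =
      weighted_square_sum (A, \<mu>) \<oplus>\<^bsub>A\<^esub> weighted_square_sum (A, \<nu>)"
    using weighted_square_sum_superset[OF A S(1) _ S(2)] S(3) by simp
qed

subsection \<open>The constraint algebras\<close>

lemma star_ring_hom_constraint:
  assumes "finite V"
  shows "star_ring_hom (abelian_cyclic_algebra k V) (constraint_algebra k V C)
    (\<lambda>a. constraint_ideal k V C +>\<^bsub>abelian_cyclic_algebra k V\<^esub> a)"
    and "assignment_proj (abelian_cyclic_algebra k V) k (abelian_cyclic_gen k V) V ` ((V \<rightarrow>\<^sub>E {..<k}) - C)
      \<subseteq> carrier (abelian_cyclic_algebra k V)"
    and "x \<in> V \<Longrightarrow> order_unitary (abelian_cyclic_algebra k V) k (abelian_cyclic_gen k V x)"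
    and "\<lbrakk>x \<in> V; y \<in> V\<rbrakk> \<Longrightarrow>
      abelian_cyclic_gen k V x \<otimes>\<^bsub>abelian_cyclic_algebra k V\<^esub> abelian_cyclic_gen k V y =
      abelian_cyclic_gen k V y \<otimes>\<^bsub>abelian_cyclic_algebra k V\<^esub> abelian_cyclic_gen k V x"
proof -
  let ?R = "order_relators k V \<union> comm_relators V" and ?A = "abelian_cyclic_algebra k V"
  have R: "?R \<subseteq> carrier (free_star_algebra V)"
    by (intro Un_least order_relators_closed comm_relators_closed)
  interpret A: star_ring ?A
    using star_ring_hom_presented[OF R] unfolding abelian_cyclic_algebra_def star_ring_hom_def by blast
  show unitary: "x \<in> V \<Longrightarrow> order_unitary ?A k (abelian_cyclic_gen k V x)" for x
    unfolding abelian_cyclic_algebra_def abelian_cyclic_gen_def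
    by (rule order_unitary_presented_gen[OF R]) auto
  show "\<lbrakk>x \<in> V; y \<in> V\<rbrakk> \<Longrightarrow> abelian_cyclic_gen k V x \<otimes>\<^bsub>?A\<^esub> abelian_cyclic_gen k V y =
      abelian_cyclic_gen k V y \<otimes>\<^bsub>?A\<^esub> abelian_cyclic_gen k V x"
    unfolding abelian_cyclic_algebra_def abelian_cyclic_gen_def
    by (rule commute_presented_gen[OF R]) auto
  show closed: "assignment_proj ?A k (abelian_cyclic_gen k V) V ` ((V \<rightarrow>\<^sub>E {..<k}) - C) \<subseteq> carrier ?A"
    using assms unitary by (auto simp: order_unitary_def intro!: A.assignment_proj_closed)
  show "star_ring_hom ?A (constraint_algebra k V C) (\<lambda>a. constraint_ideal k V C +>\<^bsub>?A\<^esub> a)"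
    unfolding constraint_algebra_def constraint_ideal_def
    by (rule star_ring_hom_quotient[OF A.star_ring_axioms closed])
qed

text \<open>Unitarity and commutation are images of the relations in the abelian algebra. The last
  fact holds because the quotient map carries the assignment projection of a forbidden
  \<open>\<phi>\<close>, which is a relator, to the one formed in the quotient.\<close>

lemma constraint_algebra_facts:
  assumes V: "finite V"
  shows "star_ring (constraint_algebra k V C)"
    and "x \<in> V \<Longrightarrow> order_unitary (constraint_algebra k V C) k (constraint_gen k V C x)"
    and "\<lbrakk>x \<in> V; y \<in> V\<rbrakk> \<Longrightarrow>
      constraint_gen k V C x \<otimes>\<^bsub>constraint_algebra k V C\<^esub> constraint_gen k V C y =
      constraint_gen k V C y \<otimes>\<^bsub>constraint_algebra k V C\<^esub> constraint_gen k V C x"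
    and "\<phi> \<in> (V \<rightarrow>\<^sub>E {..<k}) - C \<Longrightarrow>
      assignment_proj (constraint_algebra k V C) k (constraint_gen k V C) V \<phi> = \<zero>\<^bsub>constraint_algebra k V C\<^esub>"
proof -
  let ?A = "abelian_cyclic_algebra k V" and ?g = "abelian_cyclic_gen k V"
  define h where "h = (\<lambda>a. constraint_ideal k V C +>\<^bsub>?A\<^esub> a)"
  interpret star_ring_hom ?A "constraint_algebra k V C" h
    unfolding h_def by (rule star_ring_hom_constraint(1)[OF V])
  have gen: "constraint_gen k V C = (\<lambda>x. h (?g x))"
    by (simp add: fun_eq_iff constraint_gen_def h_def)
  note unitary = star_ring_hom_constraint(3)[OF V, where k = k]
  have g: "x \<in> V \<Longrightarrow> ?g x \<in> carrier ?A" for x using unitary by (simp add: order_unitary_def)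
  show "star_ring (constraint_algebra k V C)" ..
  show "x \<in> V \<Longrightarrow> order_unitary (constraint_algebra k V C) k (constraint_gen k V C x)"
    unfolding gen by (intro order_unitary_hom unitary)
  show "\<lbrakk>x \<in> V; y \<in> V\<rbrakk> \<Longrightarrow>
      constraint_gen k V C x \<otimes>\<^bsub>constraint_algebra k V C\<^esub> constraint_gen k V C y =
      constraint_gen k V C y \<otimes>\<^bsub>constraint_algebra k V C\<^esub> constraint_gen k V C x"
    unfolding gen using g star_ring_hom_constraint(4)[OF V, of x y k] by (simp flip: hom_mult)
  assume \<phi>: "\<phi> \<in> (V \<rightarrow>\<^sub>E {..<k}) - C"
  have "assignment_proj (constraint_algebra k V C) k (constraint_gen k V C) V \<phi> =
      h (assignment_proj ?A k ?g V \<phi>)"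
    unfolding gen by (rule hom_assignment_proj[symmetric]) (use V g in auto)
  also have "\<dots> = \<zero>\<^bsub>constraint_algebra k V C\<^esub>"
    unfolding h_def constraint_algebra_def constraint_ideal_def
    by (rule quotient_relation_zero[OF A.star_ring_axioms star_ring_hom_constraint(2)[OF V]]) (use \<phi> in blast)
  finally show "assignment_proj (constraint_algebra k V C) k (constraint_gen k V C) V \<phi> =
      \<zero>\<^bsub>constraint_algebra k V C\<^esub>" .
qed

lemma free_cyclic_facts:
  shows "star_ring (free_cyclic_algebra k X)"
    and "x \<in> X \<Longrightarrow> order_unitary (free_cyclic_algebra k X) k (free_cyclic_gen k X x)"
proof -
  show "star_ring (free_cyclic_algebra k X)"
    using star_ring_hom_presented[OF order_relators_closed[of k X]]
    unfolding free_cyclic_algebra_def star_ring_hom_def by (elim conjE)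
  show "x \<in> X \<Longrightarrow> order_unitary (free_cyclic_algebra k X) k (free_cyclic_gen k X x)"
    unfolding free_cyclic_algebra_def free_cyclic_gen_def
    by (rule order_unitary_presented_gen[OF order_relators_closed order_refl])
qed

lemma free_cyclic_gen_closed: "x \<in> X \<Longrightarrow> free_cyclic_gen k X x \<in> carrier (free_cyclic_algebra k X)"
  using free_cyclic_facts(2)[of x X k] by (simp add: order_unitary_def)

lemma constraint_systemD:
  assumes "is_constraint_system k S" "i \<in> {1..num S}"
  shows "scope S i \<subseteq> vars S" "finite (scope S i)" "allowed S i \<subseteq> scope S i \<rightarrow>\<^sub>E {..<k}"
    "finite (allowed S i)"
proof -
  show *: "scope S i \<subseteq> vars S" "allowed S i \<subseteq> scope S i \<rightarrow>\<^sub>E {..<k}"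
    using assms unfolding is_constraint_system_def by blast+
  show "finite (scope S i)"
    by (rule finite_subset[OF *(1)]) (use assms(1) in \<open>simp add: is_constraint_system_def\<close>)
  then show "finite (allowed S i)"
    using finite_subset[OF *(2)] by (simp add: finite_PiE)
qed

text \<open>Both weight functions are regrouped by constraint, so that a common factor
  \<open>\<pi> i\<close> stands in front of what \<open>constraint_bound\<close> estimates.\<close>

lemma weighted_algebra_a_comm:
  fixes S :: "'v::linorder constraint_system" and A (structure)
  assumes S: "is_constraint_system k S" and \<pi>: "is_distribution (num S) \<pi>"
  defines "A \<equiv> free_cyclic_algebra k (vars S)" and "I \<equiv> {1..num S}"
  defines "q \<equiv> \<lambda>x. spectral_proj A k (free_cyclic_gen k (vars S) x)"
  shows "weighted_star_algebra (algebra_a_comm k S \<pi>)"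
    and "weighted_square_sum (algebra_a_comm k S \<pi>) =
      (\<Oplus>i\<in>I. complex_of_real (\<pi> i) \<odot>
        ((\<Oplus>\<phi>\<in>(scope S i \<rightarrow>\<^sub>E {..<k}) - allowed S i.
            adj (ordered_prod A q (sorted_list_of_set (scope S i)) \<phi>) \<otimes>
              ordered_prod A q (sorted_list_of_set (scope S i)) \<phi>) \<oplus>
         (\<Oplus>x\<in>scope S i. \<Oplus>y\<in>scope S i. \<Oplus>a\<in>{..<k}. \<Oplus>b\<in>{..<k}.
            adj (commutator A (q x a) (q y b)) \<otimes> commutator A (q x a) (q y b))))"
proof -
  interpret star_ring A unfolding A_def by (rule free_cyclic_facts)
  have pos: "0 \<le> \<pi> i" if "i \<in> I" for i using \<pi> that by (auto simp: is_distribution_def I_def)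
  have V: "scope S i \<subseteq> vars S" "finite (scope S i)" if "i \<in> I" for i
    using constraint_systemD[OF S] that by (auto simp: I_def)
  have X: "finite (vars S)" using S by (simp add: is_constraint_system_def)
  have q: "q x a \<in> carrier A" if "x \<in> vars S" for x a
    unfolding q_def using free_cyclic_gen_closed[OF that] by (intro spectral_proj_closed) (simp add: A_def)
  let ?\<Phi> = "\<lambda>i. ordered_prod A q (sorted_list_of_set (scope S i))"
  let ?N = "\<lambda>i. (scope S i \<rightarrow>\<^sub>E {..<k}) - allowed S i"
  have \<Phi>: "?\<Phi> i \<phi> \<in> carrier A" if "i \<in> I" for i \<phi>
    unfolding q_def assignment_proj_eq_ordered_prod[symmetric]
    by (rule assignment_proj_closed) (use V[OF that] in \<open>auto simp: A_def intro!: free_cyclic_gen_closed\<close>)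
  have N: "finite (?N i)" if "i \<in> I" for i using V[OF that] by (intro finite_Diff finite_PiE) auto
  let ?J = "SIGMA i:I. ?N i" and ?J' = "{..<k} \<times> {..<k} \<times> vars S \<times> vars S"
  let ?w' = "\<lambda>(a::nat, b::nat, x, y). \<Sum>i\<in>{i \<in> I. x \<in> scope S i \<and> y \<in> scope S i}. \<pi> i"
  have a: "weight_a k S \<pi> = listed_weight ?J (\<lambda>(i, \<phi>). ?\<Phi> i \<phi>) (\<lambda>(i, \<phi>). \<pi> i)"
    by (simp add: weight_a_def Let_def assignment_proj_eq_ordered_prod I_def A_def q_def)
  have c: "weight_comm k S \<pi> = listed_weight ?J' (\<lambda>(a, b, x, y). commutator A (q x a) (q y b)) ?w'"
    by (simp add: weight_comm_def Let_def I_def A_def q_def)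
  have J: "finite ?J" "(\<lambda>(i, \<phi>). ?\<Phi> i \<phi>) \<in> ?J \<rightarrow> carrier A"
    "\<And>j. j \<in> ?J \<Longrightarrow> 0 \<le> (case j of (i, \<phi>) \<Rightarrow> \<pi> i)"
    using N \<Phi> pos by (auto simp: I_def)
  have J': "finite ?J'" "(\<lambda>(a, b, x, y). commutator A (q x a) (q y b)) \<in> ?J' \<rightarrow> carrier A"
    "\<And>j. j \<in> ?J' \<Longrightarrow> 0 \<le> ?w' j"
    using X q pos by (auto intro!: sum_nonneg)
  have wa: "weighted_star_algebra (A, weight_a k S \<pi>)"
    unfolding a by (rule weighted_listed_weight(1)[OF star_ring_axioms J])
  have wc: "weighted_star_algebra (A, weight_comm k S \<pi>)"
    unfolding c by (rule weighted_listed_weight(1)[OF star_ring_axioms J'])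
  show "weighted_star_algebra (algebra_a_comm k S \<pi>)"
    unfolding algebra_a_comm_def A_def[symmetric] by (rule weighted_add(1)[OF wa wc])
  have "weighted_square_sum (A, weight_a k S \<pi>) =
      finsum A (\<lambda>(i, \<phi>). complex_of_real (\<pi> i) \<odot> sq (?\<Phi> i \<phi>)) ?J"
  proof -
    have "weighted_square_sum (A, weight_a k S \<pi>) =
      (\<Oplus>j\<in>?J. complex_of_real (case j of (i, \<phi>) \<Rightarrow> \<pi> i) \<odot> sq (case j of (i, \<phi>) \<Rightarrow> ?\<Phi> i \<phi>))"
      unfolding a by (rule weighted_listed_weight(2)[OF star_ring_axioms J])
    also have "\<dots> = finsum A (\<lambda>(i, \<phi>). complex_of_real (\<pi> i) \<odot> sq (?\<Phi> i \<phi>)) ?J"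
      by (rule finsum_cong') (use \<Phi> in auto)
    finally show ?thesis .
  qed
  also have "\<dots> = (\<Oplus>i\<in>I. \<Oplus>\<phi>\<in>?N i. complex_of_real (\<pi> i) \<odot> sq (?\<Phi> i \<phi>))"
    by (rule finsum_Sigma) (use N \<Phi> in \<open>auto simp: I_def\<close>)
  also have "\<dots> = (\<Oplus>i\<in>I. complex_of_real (\<pi> i) \<odot> (\<Oplus>\<phi>\<in>?N i. sq (?\<Phi> i \<phi>)))"
    by (intro finsum_cong' refl scale_finsum[symmetric]) (use \<Phi> in \<open>auto intro!: finsum_closed\<close>)
  finally have a': "weighted_square_sum (A, weight_a k S \<pi>) =
    (\<Oplus>i\<in>I. complex_of_real (\<pi> i) \<odot> (\<Oplus>\<phi>\<in>?N i. sq (?\<Phi> i \<phi>)))" .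
  let ?T = "\<lambda>a b x y. sq (commutator A (q x a) (q y b))"
  let ?C = "\<lambda>i. \<Oplus>x\<in>scope S i. \<Oplus>y\<in>scope S i. \<Oplus>a\<in>{..<k}. \<Oplus>b\<in>{..<k}. ?T a b x y"
  have C: "?C i \<in> carrier A" if "i \<in> I" for i
    using V[OF that] q by (intro finsum_closed Pi_I sq_closed commutator_closed) auto
  have "weighted_square_sum (A, weight_comm k S \<pi>) =
      finsum A (\<lambda>(a, b, x, y). complex_of_real (\<Sum>i\<in>{i \<in> I. x \<in> scope S i \<and> y \<in> scope S i}. \<pi> i) \<odot> ?T a b x y) ?J'"
  proof -
    have "weighted_square_sum (A, weight_comm k S \<pi>) = (\<Oplus>j\<in>?J'. complex_of_real (?w' j) \<odot>
        sq (case j of (a, b, x, y) \<Rightarrow> commutator A (q x a) (q y b)))"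
      unfolding c by (rule weighted_listed_weight(2)[OF star_ring_axioms J'])
    also have "\<dots> = finsum A (\<lambda>(a, b, x, y).
        complex_of_real (\<Sum>i\<in>{i \<in> I. x \<in> scope S i \<and> y \<in> scope S i}. \<pi> i) \<odot> ?T a b x y) ?J'"
      by (rule finsum_cong') (use q in auto)
    finally show ?thesis .
  qed
  also have "\<dots> = (\<Oplus>i\<in>I. complex_of_real (\<pi> i) \<odot> ?C i)"
    by (rule finsum_pairs_by_constraint) (use V X q in \<open>auto simp: I_def\<close>)
  finally have c': "weighted_square_sum (A, weight_comm k S \<pi>) =
    (\<Oplus>i\<in>I. complex_of_real (\<pi> i) \<odot> ?C i)" .
  have "weighted_square_sum (algebra_a_comm k S \<pi>) =
      (\<Oplus>i\<in>I. complex_of_real (\<pi> i) \<odot> (\<Oplus>\<phi>\<in>?N i. sq (?\<Phi> i \<phi>))) \<oplus>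
      (\<Oplus>i\<in>I. complex_of_real (\<pi> i) \<odot> ?C i)"
    unfolding algebra_a_comm_def A_def[symmetric] weighted_add(2)[OF wa wc] a' c' ..
  also have "\<dots> = (\<Oplus>i\<in>I. complex_of_real (\<pi> i) \<odot> (\<Oplus>\<phi>\<in>?N i. sq (?\<Phi> i \<phi>)) \<oplus> complex_of_real (\<pi> i) \<odot> ?C i)"
    by (rule finsum_addf[symmetric]) (use \<Phi> C in \<open>auto intro!: finsum_closed\<close>)
  also have "\<dots> = (\<Oplus>i\<in>I. complex_of_real (\<pi> i) \<odot> ((\<Oplus>\<phi>\<in>?N i. sq (?\<Phi> i \<phi>)) \<oplus> ?C i))"
    by (intro finsum_cong' refl scale_add_right[symmetric])
      (use \<Phi> C in \<open>auto intro!: finsum_closed\<close>)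
  finally show "weighted_square_sum (algebra_a_comm k S \<pi>) =
    (\<Oplus>i\<in>I. complex_of_real (\<pi> i) \<odot> ((\<Oplus>\<phi>\<in>?N i. sq (?\<Phi> i \<phi>)) \<oplus> ?C i))" .
qed

section \<open>The inclusion as a homomorphism of weighted algebras\<close>

theorem lemma3p9:
  fixes k :: nat and S :: "'v::linorder constraint_system" and \<pi> :: "nat \<Rightarrow> real"
  assumes "is_constraint_system k S"
    and "is_distribution (num S) \<pi>"
  shows "\<exists>\<alpha>. C_homomorphism (20 * (real (max_scope S))\<^sup>2) (algebra_a_comm k S \<pi>) (algebra_c_v k S \<pi>) \<alpha>"
proof -
  define I where "I = {1..num S}"
  define V where "V = scope S"
  define xs where "xs = (\<lambda>i. sorted_list_of_set (V i))"
  define F where "F = free_cyclic_algebra k (vars S)"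
  define A where "A = (\<lambda>i. constraint_algebra k (V i) (allowed S i))"
  define g where "g = (\<lambda>i. constraint_gen k (V i) (allowed S i))"
  define P where "P = free_product I A F"
  define \<alpha> where "\<alpha> = extra_incl I A F"
  define \<sigma> where "\<sigma> = (\<lambda>i. family_incl I A F i)"
  define q where "q = (\<lambda>x. spectral_proj P k (\<alpha> (free_cyclic_gen k (vars S) x)))"
  define p where "p = (\<lambda>i x. spectral_proj P k (\<sigma> i (g i x)))"
  define q0 where "q0 = (\<lambda>x. spectral_proj F k (free_cyclic_gen k (vars S) x))"
  define L where "L = real (max_scope S)"
  note cs = assms(1) and dist = assms(2)
  have k: "k > 0" and X: "finite (vars S)" using cs by (auto simp: is_constraint_system_def)
  have V: "V i \<subseteq> vars S" "finite (V i)" and allowed: "allowed S i \<subseteq> V i \<rightarrow>\<^sub>E {..<k}"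
    and fin_allowed: "finite (allowed S i)" if "i \<in> I" for i
    using constraint_systemD[OF cs, of i] that by (simp_all add: I_def V_def)
  have xs: "set (xs i) = V i" "distinct (xs i)" "length (xs i) = card (V i)" if "i \<in> I" for i
    using V[OF that] by (auto simp: xs_def)
  have pos: "0 \<le> \<pi> i" if "i \<in> I" for i using dist that by (auto simp: is_distribution_def I_def)
  have finI: "finite I" by (simp add: I_def)
  have A: "star_ring (A i)" if "i \<in> I" for i
    unfolding A_def by (rule constraint_algebra_facts(1)[OF V(2)[OF that]])
  have \<alpha>: "star_ring_hom F P \<alpha>"
    unfolding \<alpha>_def P_def
    by (rule star_ring_hom_extra_incl) (use A free_cyclic_facts in \<open>auto simp: F_def\<close>)
  interpret F: star_ring F unfolding F_def by (rule free_cyclic_facts)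
  interpret P: star_ring P using \<alpha> by (simp add: star_ring_hom_def)
  interpret \<alpha>: star_ring_hom F P \<alpha> by (rule \<alpha>)
  have \<sigma>: "star_ring_hom (A i) P (\<sigma> i)" if "i \<in> I" for i
    unfolding \<sigma>_def P_def
    by (rule star_ring_hom_family_incl) (use A free_cyclic_facts that in \<open>auto simp: F_def\<close>)

  have ug: "order_unitary F k (free_cyclic_gen k (vars S) x)" if "x \<in> vars S" for x
    unfolding F_def using that by (rule free_cyclic_facts)
  have q0: "q0 x a \<in> carrier F" if "x \<in> vars S" for x a
    unfolding q0_def using ug[OF that] by (auto simp: order_unitary_def)
  have \<alpha>q: "\<alpha> (q0 x a) = q x a" if "x \<in> vars S" for x a
    unfolding q0_def q_def using ug[OF that] by (intro \<alpha>.hom_spectral_proj) (simp add: order_unitary_def)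
  have qpvm: "pvm P {..<k} (q x)" if "x \<in> vars S" for x
    unfolding q_def by (intro P.pvm_spectral_proj \<alpha>.order_unitary_hom ug that k)
  have gu: "order_unitary (A i) k (g i x)" if "i \<in> I" "x \<in> V i" for i x
    unfolding A_def g_def by (rule constraint_algebra_facts(2)[OF V(2)[OF that(1)] that(2)])
  have \<sigma>u: "order_unitary P k (\<sigma> i (g i x))" if "i \<in> I" "x \<in> V i" for i x
    using star_ring_hom.order_unitary_hom[OF \<sigma> gu] that by blast
  have ppvm: "pvm P {..<k} (p i x)" if "i \<in> I" "x \<in> V i" for i x
    unfolding p_def by (intro P.pvm_spectral_proj \<sigma>u that k)
  have pcomm: "p i x a \<otimes>\<^bsub>P\<^esub> p i y b = p i y b \<otimes>\<^bsub>P\<^esub> p i x a"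
    if "i \<in> I" "x \<in> V i" "y \<in> V i" for i x y a b
  proof -
    interpret \<sigma>: star_ring_hom "A i" P "\<sigma> i" by (rule \<sigma>[OF that(1)])
    have g: "g i x \<in> carrier (A i)" "g i y \<in> carrier (A i)"
      using gu that by (auto simp: order_unitary_def)
    have "g i x \<otimes>\<^bsub>A i\<^esub> g i y = g i y \<otimes>\<^bsub>A i\<^esub> g i x"
      unfolding A_def g_def by (rule constraint_algebra_facts(3)[OF V(2)[OF that(1)] that(2,3)])
    then have "\<sigma> i (g i x) \<otimes>\<^bsub>P\<^esub> \<sigma> i (g i y) = \<sigma> i (g i y) \<otimes>\<^bsub>P\<^esub> \<sigma> i (g i x)"
      using g by (simp flip: \<sigma>.hom_mult)
    then show ?thesis unfolding p_def using g by (intro P.spectral_proj_commute) auto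
  qed
  \<comment> \<open>In the target algebra the assignment projection is formed before the inclusion
    is applied; here it becomes a product of measurements inside \<open>P\<close>, comparable with
    the product of the \<open>q\<close>.\<close>
  have \<sigma>\<Phi>: "\<sigma> i (assignment_proj (A i) k (g i) (V i) \<phi>) = ordered_prod P (p i) (xs i) \<phi>"
    if "i \<in> I" for i \<phi>
  proof -
    interpret \<sigma>: star_ring_hom "A i" P "\<sigma> i" by (rule \<sigma>[OF that])
    have "\<sigma> i (assignment_proj (A i) k (g i) (V i) \<phi>) = assignment_proj P k (\<lambda>x. \<sigma> i (g i x)) (V i) \<phi>"
      by (rule \<sigma>.hom_assignment_proj) (use gu[OF that] V[OF that] in \<open>auto simp: order_unitary_def\<close>)
    then show ?thesis by (simp add: assignment_proj_eq_ordered_prod p_def xs_def)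
  qed
  have zero: "ordered_prod P (p i) (xs i) \<phi> = \<zero>\<^bsub>P\<^esub>"
    if "i \<in> I" "\<phi> \<in> (V i \<rightarrow>\<^sub>E {..<k}) - allowed S i" for i \<phi>
  proof -
    interpret \<sigma>: star_ring_hom "A i" P "\<sigma> i" by (rule \<sigma>[OF that(1)])
    have "assignment_proj (A i) k (g i) (V i) \<phi> = \<zero>\<^bsub>A i\<^esub>"
      unfolding A_def g_def by (rule constraint_algebra_facts(4)[OF V(2)[OF that(1)] that(2)])
    then show ?thesis using \<sigma>\<Phi>[OF that(1), of \<phi>] by simp
  qed

  let ?sq = "\<lambda>a. adj\<^bsub>P\<^esub> a \<otimes>\<^bsub>P\<^esub> a"
  let ?N = "\<lambda>i. (V i \<rightarrow>\<^sub>E {..<k}) - allowed S i"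
  let ?Q = "\<lambda>i \<phi>. ordered_prod P q (xs i) \<phi>"
  let ?lhs = "\<lambda>i. (\<Oplus>\<^bsub>P\<^esub>\<phi>\<in>?N i. ?sq (?Q i \<phi>)) \<oplus>\<^bsub>P\<^esub>
    (\<Oplus>\<^bsub>P\<^esub>x\<in>V i. \<Oplus>\<^bsub>P\<^esub>y\<in>V i. \<Oplus>\<^bsub>P\<^esub>a\<in>{..<k}. \<Oplus>\<^bsub>P\<^esub>b\<in>{..<k}. ?sq (commutator P (q x a) (q y b)))"
  let ?r = "\<lambda>i x \<phi>. ordered_prod P (p i) (xs i) \<phi> \<otimes>\<^bsub>P\<^esub> (\<one>\<^bsub>P\<^esub> \<ominus>\<^bsub>P\<^esub> q x (\<phi> x))"
  let ?rhs = "\<lambda>i. \<Oplus>\<^bsub>P\<^esub>x\<in>V i. \<Oplus>\<^bsub>P\<^esub>\<phi>\<in>allowed S i. ?sq (?r i x \<phi>)"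

  have qc: "q x a \<in> carrier P" if "x \<in> vars S" for x a
    using \<alpha>q[OF that] \<alpha>.hom_closed[OF q0[OF that]] by simp
  have \<Phi>c: "ordered_prod P (p i) (xs i) \<phi> \<in> carrier P" if "i \<in> I" for i \<phi>
    unfolding p_def xs_def assignment_proj_eq_ordered_prod[symmetric]
    using V[OF that] \<sigma>u[OF that] by (intro P.assignment_proj_closed) (auto simp: order_unitary_def)
  have r: "?r i x \<phi> \<in> carrier P" if "i \<in> I" "x \<in> V i" for i x \<phi>
    using \<Phi>c[OF that(1)] qc[of x] V(1)[OF that(1)] that(2) by auto
  have rhs: "?rhs i \<in> carrier P" if "i \<in> I" for i
    using r that by (intro P.finsum_closed Pi_I P.sq_closed) auto

  have \<alpha>Q: "ordered_prod F q0 (xs i) \<phi> \<in> carrier F" "\<alpha> (ordered_prod F q0 (xs i) \<phi>) = ?Q i \<phi>" if "i \<in> I" for i \<phi>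
    unfolding q0_def q_def xs_def assignment_proj_eq_ordered_prod[symmetric]
    by (intro F.assignment_proj_closed \<alpha>.hom_assignment_proj;
        use V[OF that] ug in \<open>auto simp: order_unitary_def\<close>)+
  have lhs: "\<alpha> (weighted_square_sum (algebra_a_comm k S \<pi>)) =
      (\<Oplus>\<^bsub>P\<^esub>i\<in>I. complex_of_real (\<pi> i) \<odot>\<^bsub>P\<^esub> ?lhs i)"
  proof -
    let ?sqF = "\<lambda>a. adj\<^bsub>F\<^esub> a \<otimes>\<^bsub>F\<^esub> a"
    let ?X1 = "\<lambda>i. \<Oplus>\<^bsub>F\<^esub>\<phi>\<in>?N i. ?sqF (ordered_prod F q0 (xs i) \<phi>)"
    let ?X2 = "\<lambda>i. \<Oplus>\<^bsub>F\<^esub>x\<in>V i. \<Oplus>\<^bsub>F\<^esub>y\<in>V i. \<Oplus>\<^bsub>F\<^esub>a\<in>{..<k}. \<Oplus>\<^bsub>F\<^esub>b\<in>{..<k}.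
      ?sqF (commutator F (q0 x a) (q0 y b))"
    have X1: "?X1 i \<in> carrier F" "\<alpha> (?X1 i) = (\<Oplus>\<^bsub>P\<^esub>\<phi>\<in>?N i. ?sq (?Q i \<phi>))" if "i \<in> I" for i
      using \<alpha>Q[OF that]
      by (auto intro!: \<alpha>.hom_finsum_cong F.finsum_closed simp: \<alpha>.hom_adj)
    have T: "?sqF (commutator F (q0 x a) (q0 y b)) \<in> carrier F"
      "\<alpha> (?sqF (commutator F (q0 x a) (q0 y b))) = ?sq (commutator P (q x a) (q y b))"
      if "i \<in> I" "x \<in> V i" "y \<in> V i" for i x y a b
    proof -
      have "x \<in> vars S" "y \<in> vars S" using V[OF that(1)] that by auto
      then show "?sqF (commutator F (q0 x a) (q0 y b)) \<in> carrier F"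
        "\<alpha> (?sqF (commutator F (q0 x a) (q0 y b))) = ?sq (commutator P (q x a) (q y b))"
        by (simp_all add: q0 \<alpha>q \<alpha>.hom_adj \<alpha>.hom_commutator)
    qed
    have X2: "?X2 i \<in> carrier F"
      "\<alpha> (?X2 i) = (\<Oplus>\<^bsub>P\<^esub>x\<in>V i. \<Oplus>\<^bsub>P\<^esub>y\<in>V i. \<Oplus>\<^bsub>P\<^esub>a\<in>{..<k}. \<Oplus>\<^bsub>P\<^esub>b\<in>{..<k}. ?sq (commutator P (q x a) (q y b)))"
      if "i \<in> I" for i
      by (intro \<alpha>.hom_finsum_cong F.finsum_closed Pi_I T[OF that]; assumption)+
    have *: "weighted_square_sum (algebra_a_comm k S \<pi>) =
        (\<Oplus>\<^bsub>F\<^esub>i\<in>I. complex_of_real (\<pi> i) \<odot>\<^bsub>F\<^esub> (?X1 i \<oplus>\<^bsub>F\<^esub> ?X2 i))"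
      unfolding weighted_algebra_a_comm(2)[OF cs dist] I_def F_def q0_def V_def xs_def ..
    show ?thesis
      unfolding * by (rule \<alpha>.hom_finsum_cong) (simp_all add: Pi_iff X1 X2 \<alpha>.hom_scale)
  qed

  have cv: "algebra_c_v k S \<pi> = (P, listed_weight (SIGMA i:I. V i \<times> allowed S i)
      (\<lambda>(i, x, \<phi>). \<sigma> i (assignment_proj (A i) k (g i) (V i) \<phi>) \<otimes>\<^bsub>P\<^esub> (\<one>\<^bsub>P\<^esub> \<ominus>\<^bsub>P\<^esub> q x (\<phi> x)))
      (\<lambda>(i, x, \<phi>). \<pi> i / real (card (V i))))"
    by (simp add: algebra_c_v_def Let_def P_def A_def F_def I_def V_def \<sigma>_def \<alpha>_def g_def q_def)
  let ?J = "SIGMA i:I. V i \<times> allowed S i" and ?e = "\<lambda>(i, x, \<phi>). ?r i x \<phi>"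
  let ?w = "\<lambda>i. complex_of_real (\<pi> i / real (card (V i)))"
  have J: "finite ?J" "?e \<in> ?J \<rightarrow> carrier P"
    "\<And>j. j \<in> ?J \<Longrightarrow> 0 \<le> (case j of (i, x, \<phi>) \<Rightarrow> \<pi> i / real (card (V i)))"
    using finI V fin_allowed r pos by (auto intro!: finite_SigmaI)
  \<comment> \<open>The two listings are known to agree only for indices in \<open>?J\<close>, so
    the weight functions are equated rather than the maps.\<close>
  have e: "listed_weight ?J
      (\<lambda>(i, x, \<phi>). \<sigma> i (assignment_proj (A i) k (g i) (V i) \<phi>) \<otimes>\<^bsub>P\<^esub> (\<one>\<^bsub>P\<^esub> \<ominus>\<^bsub>P\<^esub> q x (\<phi> x))) w =
      listed_weight ?J ?e w" for w
    unfolding listed_weight_def by (intro ext sum.cong) (auto simp: \<sigma>\<Phi>)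
  have wcv: "weighted_star_algebra (algebra_c_v k S \<pi>)"
    unfolding cv e by (rule weighted_listed_weight(1)[OF P.star_ring_axioms J])
  have "weighted_square_sum (algebra_c_v k S \<pi>) =
      finsum P (\<lambda>(i, x, \<phi>). ?w i \<odot>\<^bsub>P\<^esub> ?sq (?r i x \<phi>)) ?J"
  proof -
    have "weighted_square_sum (algebra_c_v k S \<pi>) = (\<Oplus>\<^bsub>P\<^esub>j\<in>?J.
        complex_of_real (case j of (i, x, \<phi>) \<Rightarrow> \<pi> i / real (card (V i))) \<odot>\<^bsub>P\<^esub> ?sq (?e j))"
      unfolding cv e by (rule weighted_listed_weight(2)[OF P.star_ring_axioms J])
    also have "\<dots> = finsum P (\<lambda>(i, x, \<phi>). ?w i \<odot>\<^bsub>P\<^esub> ?sq (?r i x \<phi>)) ?J"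
      by (rule P.finsum_cong') (use r in auto)
    finally show ?thesis .
  qed
  also have "\<dots> = (\<Oplus>\<^bsub>P\<^esub>i\<in>I. finsum P (\<lambda>(x, \<phi>). ?w i \<odot>\<^bsub>P\<^esub> ?sq (?r i x \<phi>)) (V i \<times> allowed S i))"
    by (rule P.finsum_Sigma) (use finI V fin_allowed r in auto)
  also have "\<dots> = (\<Oplus>\<^bsub>P\<^esub>i\<in>I. ?w i \<odot>\<^bsub>P\<^esub> ?rhs i)"
  proof (rule P.finsum_cong'[OF refl])
    fix i assume i: "i \<in> I"
    have "finsum P (\<lambda>(x, \<phi>). ?w i \<odot>\<^bsub>P\<^esub> ?sq (?r i x \<phi>)) (V i \<times> allowed S i) =
        (\<Oplus>\<^bsub>P\<^esub>x\<in>V i. \<Oplus>\<^bsub>P\<^esub>\<phi>\<in>allowed S i. ?w i \<odot>\<^bsub>P\<^esub> ?sq (?r i x \<phi>))"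
      by (rule P.finsum_Sigma) (use i V fin_allowed r in auto)
    also have "\<dots> = (\<Oplus>\<^bsub>P\<^esub>x\<in>V i. ?w i \<odot>\<^bsub>P\<^esub> (\<Oplus>\<^bsub>P\<^esub>\<phi>\<in>allowed S i. ?sq (?r i x \<phi>)))"
      by (rule P.finsum_cong')
        (use i r in \<open>auto intro!: P.scale_finsum[symmetric] P.finsum_closed\<close>)
    also have "\<dots> = ?w i \<odot>\<^bsub>P\<^esub> ?rhs i"
      by (rule P.scale_finsum[symmetric]) (use i r in \<open>auto intro!: P.finsum_closed\<close>)
    finally show "finsum P (\<lambda>(x, \<phi>). ?w i \<odot>\<^bsub>P\<^esub> ?sq (?r i x \<phi>)) (V i \<times> allowed S i) =
        ?w i \<odot>\<^bsub>P\<^esub> ?rhs i" .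
  qed (use rhs in auto)
  finally have rhs_eq: "weighted_square_sum (algebra_c_v k S \<pi>) = (\<Oplus>\<^bsub>P\<^esub>i\<in>I. ?w i \<odot>\<^bsub>P\<^esub> ?rhs i)" .

  have bound: "cyclic_le P (complex_of_real (\<pi> i) \<odot>\<^bsub>P\<^esub> ?lhs i)
      (complex_of_real (20 * L\<^sup>2) \<odot>\<^bsub>P\<^esub> (?w i \<odot>\<^bsub>P\<^esub> ?rhs i))" if i: "i \<in> I" for i
  proof -
    have "card (V i) \<le> max_scope S"
      unfolding max_scope_def V_def by (rule Max_ge) (use i in \<open>auto simp: I_def\<close>)
    then have "cyclic_le P (?lhs i) (complex_of_real (20 * L\<^sup>2 / real (card (V i))) \<odot>\<^bsub>P\<^esub> ?rhs i)"
      using P.constraint_bound[of "xs i" "{..<k}" "p i" q "allowed S i" L]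
        ppvm[OF i] qpvm V[OF i] pcomm[OF i] zero[OF i] allowed[OF i]
      by (simp add: xs[OF i] L_def subset_iff)
    then have "cyclic_le P (complex_of_real (\<pi> i) \<odot>\<^bsub>P\<^esub> ?lhs i)
        (complex_of_real (\<pi> i) \<odot>\<^bsub>P\<^esub> (complex_of_real (20 * L\<^sup>2 / real (card (V i))) \<odot>\<^bsub>P\<^esub> ?rhs i))"
      using pos[OF i] by (rule P.cle_scale)
    \<comment> \<open>The division by the size of the scope moves from the constant to
      \<open>\<pi> i\<close>, forming the weight \<open>?w i\<close>. The remaining constant is the
      same for all constraints and can be taken out of the sum over \<open>i\<close>.\<close>
    also have "complex_of_real (\<pi> i) \<odot>\<^bsub>P\<^esub> (complex_of_real (20 * L\<^sup>2 / real (card (V i))) \<odot>\<^bsub>P\<^esub> ?rhs i) =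
        complex_of_real (20 * L\<^sup>2) \<odot>\<^bsub>P\<^esub> (?w i \<odot>\<^bsub>P\<^esub> ?rhs i)"
      by (simp only: P.scale_mult[OF rhs[OF i], symmetric] of_real_mult[symmetric]) (simp add: mult.commute)
    finally show ?thesis .
  qed
  have "cyclic_le P (\<alpha> (weighted_square_sum (algebra_a_comm k S \<pi>)))
      (\<Oplus>\<^bsub>P\<^esub>i\<in>I. complex_of_real (20 * L\<^sup>2) \<odot>\<^bsub>P\<^esub> (?w i \<odot>\<^bsub>P\<^esub> ?rhs i))"
    unfolding lhs using bound by (rule P.cle_finsum)
  also have "\<dots> = complex_of_real (20 * L\<^sup>2) \<odot>\<^bsub>P\<^esub> weighted_square_sum (algebra_c_v k S \<pi>)"
    unfolding rhs_eq by (rule P.scale_finsum[symmetric]) (use rhs in auto)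
  finally have "C_homomorphism (20 * L\<^sup>2) (algebra_a_comm k S \<pi>) (algebra_c_v k S \<pi>) \<alpha>"
    using weighted_algebra_a_comm(1)[OF cs dist] wcv \<alpha>.star_hom
    unfolding C_homomorphism_def cv algebra_a_comm_def F_def by simp
  then show ?thesis unfolding L_def by blast
qed

end
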